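(* Let $F^{\bullet}=\mathscr{F}(H,\chi)^{\bullet}\in\check{D}$, with $H\leq G_{\mathbb{R}}$ a maximal torus defined over $\mathbb{R}$ and $(H,\chi)$ $G(\mathbb{C})$-conjugate to $(H_{0},\chi_{0})$, and let $\mathfrak{g}_{\mathbb{C}}=\bigoplus_{p,q}\mathfrak{g}^{p,q}$ be the associated bigrading. Then the real codimension in $\check{D}$ of the orbit $\mathcal{O}_{F^{\bullet}}=G(\mathbb{R})^{\circ}.F^{\bullet}$ is $$c_{F^{\bullet}}:=\sum_{(p,q)\in(\mathbb{Z}_{>0})^{2}}\dim_{\mathbb{C}}(\mathfrak{g}^{p,q}).$$
   Context: $G$ is a connected $\mathbb{Q}$-algebraic adjoint group (semisimple, trivial center); $\mathfrak{g}=\mathfrak{g}_{\mathbb{C}}=Lie(G(\mathbb{C}))$; $B$ is the Killing form; bar is complex conjugation; $G(\mathbb{R})^{\circ}$ is the identity component; groups act on filtrations of $\mathfrak{g}$ through $\mathrm{Ad}$. For a maximal torus $H\leq G_{\mathbb{C}}$ with Lie algebra $\mathfrak{h}$, roots $\Delta$, root spaces $\mathfrak{g}_{\alpha}$, and $\chi\in X_{*}(H(\mathbb{C}))$, put $\pi_{\chi}(\alpha)=\tfrac12\alpha(\chi'(1))$ (so $\mathrm{Ad}(\chi(z))$ acts on $\mathfrak{g}_{\alpha}$ by $z^{2\pi_{\chi}(\alpha)}$) and let $\mathscr{F}(H,\chi)^{i}=\bigoplus_{\pi_{\chi}(\alpha)\geq i}\mathfrak{g}_{\alpha}$ for $i>0$,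 and $\mathfrak{h}\oplus\bigoplus_{\pi_{\chi}(\alpha)\geq i}\mathfrak{g}_{\alpha}$ for $i\leq0$. Standing assumptions: there is a maximal torus $H_{0}\leq G_{\mathbb{R}}$ with $H_{0}(\mathbb{R})$ compact (its roots are called compact, resp. noncompact, if $-B(X_{\alpha},\overline{X_{\alpha}})>0$, resp. $<0$, for root vectors $X_\alpha$); a cocharacter $\chi_{0}\in X_{*}(H_{0}(\mathbb{C}))$ is fixed with $\pi_{\chi_{0}}$ even on compact roots and odd on noncompact roots; and for a positive system $\Delta^{+}$ with $\pi_{\chi_{0}}(\Delta^{+})\subset\mathbb{Z}_{\geq0}$, $\pi_{\chi_{0}}$ takes only the values $0,1$ on simple roots. Put $F_{0}^{\bullet}=\mathscr{F}(H_{0},\chi_{0})^{\bullet}$ and $\check{D}=G(\mathbb{C}).F_{0}^{\bullet}$. Bigrading attached to $(H,\chi)$: with $\bar{\chi}$ the conjugate cocharacter (derivative $\overline{\chi'(1)}$), $\mathfrak{g}^{p,q}=\{\gamma\in\mathfrak{g}_{\mathbb{C}}:\mathrm{Ad}(\chi(z))\gamma=z^{2p}\gamma,\ \mathrm{Ad}(\bar{\chi}(z))\gamma=z^{2q}\gamma\}$. It satisfies $F^{a}=\bigoplus_{p\geq a}\mathfrak{g}^{p,q}$ and $\overline{\mathfrak{g}^{p,q}}=\mathfrak{g}^{q,p}$. *)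

theory Defs
  imports
    "HOL-Analysis.Analysis"
    "HOL-Algebra.Solvable_Groups"
    "HOL-Computational_Algebra.Polynomial"
    "HOL-Library.Function_Algebras"
begin

text \<open>
  A linear algebraic group over \<open>\<rat>\<close> is a Zariski closed subgroup of some \<open>GL\<^sub>n\<close>, cut out by
  polynomials with rational coefficients. A group is represented by its set of complex points,
  a set of complex \<open>n \<times> n\<close> matrices; coefficient fields \<open>K\<close> are subsets of the complex numbers.
  All groups are reduced (characteristic zero), so the complex points carry all the information.
\<close>

type_synonym 'n cmat = "complex^'n^'n"

definition cscale :: "complex \<Rightarrow> ('n::finite) cmat \<Rightarrow> 'n cmat" where
  "cscale c A = (\<chi> i j. c * A $ i $ j)"

global_interpretation cmat: vector_space "cscale :: complex \<Rightarrow> ('n::finite) cmat \<Rightarrow> 'n cmat"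
  by unfold_locales (simp_all add: cscale_def vec_eq_iff algebra_simps)

definition mconj :: "('n::finite) cmat \<Rightarrow> 'n cmat" where
  "mconj A = (\<chi> i j. cnj (A $ i $ j))"

inductive_set polynomial_functions :: "complex set \<Rightarrow> (('n::finite) cmat \<Rightarrow> complex) set"
  for K where
  const: "c \<in> K \<Longrightarrow> (\<lambda>A. c) \<in> polynomial_functions K"
| entry: "(\<lambda>A. A $ i $ j) \<in> polynomial_functions K"
| add: "p \<in> polynomial_functions K \<Longrightarrow> q \<in> polynomial_functions K \<Longrightarrow>
    (\<lambda>A. p A + q A) \<in> polynomial_functions K"
| mult: "p \<in> polynomial_functions K \<Longrightarrow> q \<in> polynomial_functions K \<Longrightarrow>
    (\<lambda>A. p A * q A) \<in> polynomial_functions K"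

text \<open>Closed in \<open>GL\<^sub>n\<close>, with equations over \<open>K\<close>.\<close>

definition zariski_closed :: "complex set \<Rightarrow> ('n::finite) cmat set \<Rightarrow> bool" where
  "zariski_closed K X \<longleftrightarrow>
    (\<exists>P \<subseteq> polynomial_functions K. X = {A. invertible A \<and> (\<forall>p\<in>P. p A = 0)})"

definition zariski_connected :: "('n::finite) cmat set \<Rightarrow> bool" where
  "zariski_connected X \<longleftrightarrow> X \<noteq> {} \<and>
    \<not> (\<exists>Y Z. zariski_closed UNIV Y \<and> zariski_closed UNIV Z \<and>
           Y \<noteq> {} \<and> Z \<noteq> {} \<and> Y \<inter> Z = {} \<and> Y \<union> Z = X)"

definition mat_group :: "('n::finite) cmat set \<Rightarrow> 'n cmat monoid" where
  "mat_group G = \<lparr>carrier = G, mult = (**), one = mat 1\<rparr>"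

definition algebraic_group :: "complex set \<Rightarrow> ('n::finite) cmat set \<Rightarrow> bool" where
  "algebraic_group K G \<longleftrightarrow> zariski_closed K G \<and> group (mat_group G)"

text \<open>The radical, the largest subgroup \<open>N\<close> as below, is trivial.\<close>

definition semisimple_group :: "('n::finite) cmat set \<Rightarrow> bool" where
  "semisimple_group G \<longleftrightarrow>
    (\<forall>N. zariski_closed UNIV N \<and> zariski_connected N \<and> normal N (mat_group G) \<and>
         solvable (mat_group N) \<longrightarrow> N = {mat 1})"

definition connected_adjoint_group_over_Q :: "('n::finite) cmat set \<Rightarrow> bool" where
  "connected_adjoint_group_over_Q G \<longleftrightarrow>
    algebraic_group \<rat> G \<and> zariski_connected G \<and> semisimple_group G \<and>
    {z\<in>G. \<forall>g\<in>G. z ** g = g ** z} = {mat 1}"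

definition alg_torus :: "('n::finite) cmat set \<Rightarrow> bool" where
  "alg_torus T \<longleftrightarrow> algebraic_group UNIV T \<and> zariski_connected T \<and>
    (\<exists>P :: 'n cmat. invertible P \<and> (\<forall>t\<in>T. \<forall>i j. i \<noteq> j \<longrightarrow> (P ** t ** matrix_inv P) $ i $ j = 0))"

definition maximal_torus :: "('n::finite) cmat set \<Rightarrow> 'n cmat set \<Rightarrow> bool" where
  "maximal_torus G H \<longleftrightarrow> alg_torus H \<and> H \<subseteq> G \<and> (\<forall>T. alg_torus T \<and> H \<subseteq> T \<and> T \<subseteq> G \<longrightarrow> T = H)"

definition real_points :: "('n::finite) cmat set \<Rightarrow> 'n cmat set" where
  "real_points G = {A\<in>G. mconj A = A}"

definition identity_component :: "('n::finite) cmat set \<Rightarrow> 'n cmat set" where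
  "identity_component G = connected_component_set G (mat 1)"

text \<open>The Lie algebra is the tangent space at the identity. For an algebraic group this real
  tangent space of the complex points is a complex subspace.\<close>

definition lie_algebra :: "('n::finite) cmat set \<Rightarrow> 'n cmat set" where
  "lie_algebra G = {X. \<exists>\<gamma> \<epsilon>. \<epsilon> > 0 \<and> \<gamma> 0 = mat 1 \<and> (\<forall>t\<in>{-\<epsilon><..<\<epsilon>}. \<gamma> t \<in> G) \<and>
     \<gamma> C1_differentiable_on {-\<epsilon><..<\<epsilon>} \<and> (\<gamma> has_vector_derivative X) (at 0)}"

definition lie_bracket :: "('n::finite) cmat \<Rightarrow> 'n cmat \<Rightarrow> 'n cmat" where
  "lie_bracket X Y = X ** Y - Y ** X"

definition Ad :: "('n::finite) cmat \<Rightarrow> 'n cmat \<Rightarrow> 'n cmat" where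
  "Ad g X = g ** X ** matrix_inv g"

text \<open>Trace of a complex-linear endomorphism of the subspace \<open>V\<close>, computed in a basis.\<close>

definition trace_on :: "('n::finite) cmat set \<Rightarrow> ('n cmat \<Rightarrow> 'n cmat) \<Rightarrow> complex" where
  "trace_on V f =
    (let b = (SOME b. b \<subseteq> V \<and> cmat.independent b \<and> cmat.span b = V)
     in \<Sum>v\<in>b. cmat.representation b (f v) v)"

definition killing_form :: "('n::finite) cmat set \<Rightarrow> 'n cmat \<Rightarrow> 'n cmat \<Rightarrow> complex" where
  "killing_form \<gg> X Y = trace_on \<gg> (\<lambda>Z. lie_bracket X (lie_bracket Y Z))"

definition root_space :: "('n::finite) cmat set \<Rightarrow> 'n cmat set \<Rightarrow> ('n cmat \<Rightarrow> complex) \<Rightarrow> 'n cmat set"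
  where
  "root_space G H \<alpha> =
    {X \<in> lie_algebra G. \<forall>h\<in>lie_algebra H. lie_bracket h X = cscale (\<alpha> h) X}"

text \<open>A root is a functional on the Lie algebra of \<open>H\<close>, extended by zero to all matrices so that
  equality and the pointwise operations of functions are those of the dual space. Linearity on
  the Lie algebra of \<open>H\<close> follows from the root space being nonzero.\<close>

definition roots :: "('n::finite) cmat set \<Rightarrow> 'n cmat set \<Rightarrow> ('n cmat \<Rightarrow> complex) set" where
  "roots G H = {\<alpha>. \<alpha> \<noteq> 0 \<and> (\<forall>h. h \<notin> lie_algebra H \<longrightarrow> \<alpha> h = 0) \<and> root_space G H \<alpha> \<noteq> {0}}"

definition positive_system ::
  "(('n::finite) cmat \<Rightarrow> complex) set \<Rightarrow> ('n cmat \<Rightarrow> complex) set \<Rightarrow> bool" where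
  "positive_system \<Delta> \<Delta>p \<longleftrightarrow> \<Delta>p \<subseteq> \<Delta> \<and> (\<forall>\<alpha>\<in>\<Delta>. (\<alpha> \<in> \<Delta>p) \<noteq> (- \<alpha> \<in> \<Delta>p)) \<and>
    (\<forall>\<alpha>\<in>\<Delta>p. \<forall>\<beta>\<in>\<Delta>p. \<alpha> + \<beta> \<in> \<Delta> \<longrightarrow> \<alpha> + \<beta> \<in> \<Delta>p)"

definition simple_roots ::
  "(('n::finite) cmat \<Rightarrow> complex) set \<Rightarrow> ('n cmat \<Rightarrow> complex) set" where
  "simple_roots \<Delta>p = {\<alpha>\<in>\<Delta>p. \<not> (\<exists>\<beta>\<in>\<Delta>p. \<exists>\<gamma>\<in>\<Delta>p. \<alpha> = \<beta> + \<gamma>)}"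

text \<open>The value of the Killing form below is real, since it is defined over the reals and
  symmetric; \<open>Re\<close> only changes the type.\<close>

definition compact_root :: "('n::finite) cmat set \<Rightarrow> 'n cmat set \<Rightarrow> ('n cmat \<Rightarrow> complex) \<Rightarrow> bool"
  where
  "compact_root G H \<alpha> \<longleftrightarrow> \<alpha> \<in> roots G H \<and>
    (\<forall>X\<in>root_space G H \<alpha> - {0}. - Re (killing_form (lie_algebra G) X (mconj X)) > 0)"

definition noncompact_root :: "('n::finite) cmat set \<Rightarrow> 'n cmat set \<Rightarrow> ('n cmat \<Rightarrow> complex) \<Rightarrow> bool"
  where
  "noncompact_root G H \<alpha> \<longleftrightarrow> \<alpha> \<in> roots G H \<and>
    (\<forall>X\<in>root_space G H \<alpha> - {0}. - Re (killing_form (lie_algebra G) X (mconj X)) < 0)"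

text \<open>A cocharacter is a homomorphism of algebraic groups from the multiplicative group: its
  entries are Laurent polynomials. The value at \<open>0\<close> is irrelevant.\<close>

definition cocharacter :: "('n::finite) cmat set \<Rightarrow> (complex \<Rightarrow> 'n cmat) \<Rightarrow> bool" where
  "cocharacter H \<xi> \<longleftrightarrow>
    (\<forall>z. z \<noteq> 0 \<longrightarrow> \<xi> z \<in> H) \<and>
    (\<forall>z w. z \<noteq> 0 \<longrightarrow> w \<noteq> 0 \<longrightarrow> \<xi> (z * w) = \<xi> z ** \<xi> w) \<and>
    (\<forall>i j. \<exists>(p :: complex poly) (k :: nat). \<forall>z. z \<noteq> 0 \<longrightarrow> \<xi> z $ i $ j = poly p z / z ^ k)"

definition cochar_deriv :: "(complex \<Rightarrow> ('n::finite) cmat) \<Rightarrow> 'n cmat" where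
  "cochar_deriv \<xi> = (\<chi> i j. deriv (\<lambda>z. \<xi> z $ i $ j) 1)"

definition conj_cocharacter :: "(complex \<Rightarrow> ('n::finite) cmat) \<Rightarrow> complex \<Rightarrow> 'n cmat" where
  "conj_cocharacter \<xi> z = mconj (\<xi> (cnj z))"

definition pi_weight :: "(complex \<Rightarrow> ('n::finite) cmat) \<Rightarrow> ('n cmat \<Rightarrow> complex) \<Rightarrow> complex" where
  "pi_weight \<xi> \<alpha> = \<alpha> (cochar_deriv \<xi>) / 2"

text \<open>Half-integrality of the weights \<open>pi_weight \<xi> \<alpha>\<close> is automatic, so comparing real parts
  compares the weights themselves.\<close>

definition filtration ::
  "('n::finite) cmat set \<Rightarrow> 'n cmat set \<Rightarrow> (complex \<Rightarrow> 'n cmat) \<Rightarrow> int \<Rightarrow> 'n cmat set" where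
  "filtration G H \<xi> i =
    cmat.span ((if i > 0 then {} else lie_algebra H) \<union>
      (\<Union>\<alpha>\<in>{\<alpha>\<in>roots G H. Re (pi_weight \<xi> \<alpha>) \<ge> of_int i}. root_space G H \<alpha>))"

definition orbit :: "('n::finite) cmat set \<Rightarrow> (int \<Rightarrow> 'n cmat set) \<Rightarrow> (int \<Rightarrow> 'n cmat set) set" where
  "orbit \<Gamma> F = {(\<lambda>i. Ad g ` F i) | g. g \<in> \<Gamma>}"

definition conjugate_pairs :: "('n::finite) cmat set \<Rightarrow>
  'n cmat set \<Rightarrow> (complex \<Rightarrow> 'n cmat) \<Rightarrow> 'n cmat set \<Rightarrow> (complex \<Rightarrow> 'n cmat) \<Rightarrow> bool" where
  "conjugate_pairs G H \<xi> H' \<xi>' \<longleftrightarrow>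
    (\<exists>g\<in>G. H = Ad g ` H' \<and> (\<forall>z. z \<noteq> 0 \<longrightarrow> \<xi> z = Ad g (\<xi>' z)))"

definition bigraded_piece ::
  "('n::finite) cmat set \<Rightarrow> (complex \<Rightarrow> 'n cmat) \<Rightarrow> int \<Rightarrow> int \<Rightarrow> 'n cmat set" where
  "bigraded_piece G \<xi> p q = {X \<in> lie_algebra G. \<forall>z. z \<noteq> 0 \<longrightarrow>
     Ad (\<xi> z) X = cscale (z powi (2 * p)) X \<and>
     Ad (conj_cocharacter \<xi> z) X = cscale (z powi (2 * q)) X}"

text \<open>
  The smooth structure on a set of filtrations is the one induced from a product of
  Grassmannians, a subspace \<open>V\<close> being identified with the orthogonal projection onto \<open>V\<close>
  (\<open>closest_point V\<close>). The tangent space of a set \<open>M\<close> of filtrations at \<open>F\<close> consists of the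
  velocities at \<open>F\<close> of the curves of class C1 that stay in \<open>M\<close>; a velocity is the family, indexed
  by the step \<open>i\<close> of the filtration, of derivatives of the projection operators. For an orbit of
  a Lie group this is the tangent space of the orbit as an immersed submanifold.
\<close>

definition tangent_space ::
  "(int \<Rightarrow> ('n::finite) cmat set) set \<Rightarrow> (int \<Rightarrow> 'n cmat set) \<Rightarrow> (int \<Rightarrow> 'n cmat \<Rightarrow> 'n cmat) set"
  where
  "tangent_space M F = {v. \<exists>\<Phi> \<epsilon>. \<epsilon> > 0 \<and> \<Phi> 0 = F \<and> (\<forall>t\<in>{-\<epsilon><..<\<epsilon>}. \<Phi> t \<in> M) \<and>
     (\<forall>i X. (\<lambda>t. closest_point (\<Phi> t i) X) C1_differentiable_on {-\<epsilon><..<\<epsilon>} \<and>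
            ((\<lambda>t. closest_point (\<Phi> t i) X) has_vector_derivative v i X) (at 0))}"

definition vscale ::
  "real \<Rightarrow> (int \<Rightarrow> ('n::finite) cmat \<Rightarrow> 'n cmat) \<Rightarrow> (int \<Rightarrow> 'n cmat \<Rightarrow> 'n cmat)" where
  "vscale r v = (\<lambda>i X. r *\<^sub>R v i X)"

global_interpretation velocity: vector_space
  "vscale :: real \<Rightarrow> (int \<Rightarrow> ('n::finite) cmat \<Rightarrow> 'n cmat) \<Rightarrow> (int \<Rightarrow> 'n cmat \<Rightarrow> 'n cmat)"
  by unfold_locales (simp_all add: vscale_def fun_eq_iff algebra_simps)

definition has_real_codim ::
  "(int \<Rightarrow> ('n::finite) cmat set) set \<Rightarrow> (int \<Rightarrow> 'n cmat set) set \<Rightarrow> nat \<Rightarrow> bool" where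
  "has_real_codim S M c \<longleftrightarrow> S \<subseteq> M \<and>
    (\<forall>F\<in>S. velocity.subspace (tangent_space S F) \<and> velocity.subspace (tangent_space M F) \<and>
       velocity.dim (tangent_space M F) = velocity.dim (tangent_space S F) + c)"

end

theory Submission
  imports Defs "HOL-Computational_Algebra.Fundamental_Theorem_Algebra"
begin

text \<open>
  Write \<open>\<gg>\<close> for the Lie algebra of \<open>G\<close> and \<open>F\<^sup>i\<close> for the steps of the filtration. An element \<open>X\<close>
  of \<open>\<gg>\<close> moves the filtration with a velocity that vanishes exactly when \<open>X\<close> lies in \<open>F\<^sup>0\<close>. So
  the tangent space of the complex orbit is \<open>\<gg> / F\<^sup>0\<close>, and that of the real orbit is the
  quotient of the real form of \<open>\<gg>\<close> by the real form of the intersection of \<open>F\<^sup>0\<close> with its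
  conjugate (\<open>orbit_tangent_dimensions\<close>). Counting real dimensions, the codimension is the
  complex codimension of \<open>F\<^sup>0 + mconj F\<^sup>0\<close> in \<open>\<gg>\<close>, hence the sum of the dimensions of the pieces
  of bidegree \<open>(p, q)\<close> with \<open>p < 0\<close> and \<open>q < 0\<close>. Complex conjugation negates the roots of a
  compact torus (\<open>compact_torus_mconj_weight\<close>); carried over to the torus at hand, this shows
  that the pieces of bidegrees \<open>(p, q)\<close> and \<open>(- p, - q)\<close> have equal dimensions, and gives the
  formula (\<open>codim_Q\<close>).

  A tangent vector is the velocity of an arbitrary curve of class C1 in an orbit, so it has to
  be shown that it comes from an element of \<open>\<gg>\<close>. For the complex orbit
  (\<open>tangent_vector_is_vel\<close>), the relation between the brackets and the filtration persists along
  the curve, so its velocity is a derivation modulo the filtration; the grading element \<open>e\<close>,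
  half the derivative of the cocharacter, makes such derivations inner. For the real orbit
  (\<open>real_tangent_vector_is_vel\<close>), the dimension of \<open>F\<^sup>0 + mconj F\<^sup>0\<close> is constant along the
  curve, which makes it possible to choose the element of \<open>\<gg>\<close> real.

  These arguments only see the eigenvalues of \<open>ad e\<close>, whereas the filtration is given by roots.
  Both descriptions agree once the Lie algebra of the torus is its own centralizer in \<open>\<gg>\<close>
  (\<open>filtration_eq_fil\<close>). For the compact maximal torus this is
  \<open>compact_maximal_torus_centralizer\<close>: the trace form is definite on the real part of its Lie
  algebra, and a larger centralizer would, by the Jordan decomposition and Engel's theorem,
  produce an abelian ideal, which a semisimple group does not have.

  The Lie algebra of an algebraic group is given by curves. That it is a complex subspace, that
  it contains with an element its one-parameter group and, in a maximal torus, the semisimple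
  part, all rests on \<open>lie_algebra_spectral_flow\<close>: along a one-parameter group an equation of \<open>G\<close>
  is an exponential polynomial, and one that vanishes to infinite order at the origin is
  formally zero.
\<close>

section \<open>Matrix algebra\<close>

lemma cscale_nth [simp]: "cscale c A $ i $ j = c * A $ i $ j"
  by (simp add: cscale_def)

lemma cscale_of_real: "cscale (of_real r) A = r *\<^sub>R A"
  by (simp add: vec_eq_iff scaleR_conv_of_real[where ?'a=complex])

lemma cscale_mult_left: "cscale c A ** B = cscale c (A ** B)"
  by (simp add: vec_eq_iff matrix_matrix_mult_def sum_distrib_left mult_ac)

lemma cscale_mult_right: "A ** cscale c B = cscale c (A ** B)"
  by (simp add: vec_eq_iff matrix_matrix_mult_def sum_distrib_left mult_ac)

lemma scaleR_mult_left: "(r *\<^sub>R (A :: ('n::finite) cmat)) ** (B :: ('n::finite) cmat) = r *\<^sub>R (A ** B)"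
  using cscale_mult_left[of "of_real r" A B] by (simp only: cscale_of_real)

lemma scaleR_mult_right: "(A :: ('n::finite) cmat) ** (r *\<^sub>R (B :: ('n::finite) cmat)) = r *\<^sub>R (A ** B)"
  using cscale_mult_right[of A "of_real r" B] by (simp only: cscale_of_real)

lemma mult_add_left: "(A + B) ** (C :: ('n::finite) cmat) = A ** C + B ** C"
  by (simp add: vec_eq_iff matrix_matrix_mult_def sum.distrib algebra_simps)

lemma mult_diff_left: "(A - B) ** (C :: ('n::finite) cmat) = A ** C - B ** C"
  by (simp add: vec_eq_iff matrix_matrix_mult_def sum_subtractf algebra_simps)

lemma mult_diff_right: "C ** (A - (B :: ('n::finite) cmat)) = C ** A - C ** B"
  by (simp add: vec_eq_iff matrix_matrix_mult_def sum_subtractf algebra_simps)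

lemma mult_zero_left: "0 ** (C :: ('n::finite) cmat) = 0"
  by (simp add: vec_eq_iff matrix_matrix_mult_def)

lemma mult_zero_right: "(C :: ('n::finite) cmat) ** 0 = 0"
  by (simp add: vec_eq_iff matrix_matrix_mult_def)

lemma mult_minus_left: "(- A) ** (C :: ('n::finite) cmat) = - (A ** C)"
  by (simp add: vec_eq_iff matrix_matrix_mult_def sum_negf)

lemma mult_minus_right: "(A :: ('n::finite) cmat) ** (- C) = - (A ** C)"
  by (simp add: vec_eq_iff matrix_matrix_mult_def sum_negf)

lemmas mult_distribs = mult_add_left matrix_add_ldistrib mult_diff_left mult_diff_right
  mult_zero_left mult_zero_right mult_minus_left mult_minus_right cscale_mult_left
  cscale_mult_right scaleR_mult_left scaleR_mult_right

lemma mult_sum_left: "(\<Sum>i\<in>I. f i) ** (C :: ('n::finite) cmat) = (\<Sum>i\<in>I. f i ** C)"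
  by (induction I rule: infinite_finite_induct) (simp_all add: mult_distribs)

lemma mult_sum_right: "(C :: ('n::finite) cmat) ** (\<Sum>i\<in>I. f i) = (\<Sum>i\<in>I. C ** f i)"
  by (induction I rule: infinite_finite_induct) (simp_all add: mult_distribs)

lemma bounded_bilinear_matrix_mult: "bounded_bilinear ((**) :: ('n::finite) cmat \<Rightarrow> 'n cmat \<Rightarrow> 'n cmat)"
  by (subst bilinear_conv_bounded_bilinear[symmetric])
     (auto simp: bilinear_def mult_distribs intro!: linearI)

interpretation matmul: bounded_bilinear "(**) :: ('n::finite) cmat \<Rightarrow> 'n cmat \<Rightarrow> 'n cmat"
  by (rule bounded_bilinear_matrix_mult)

lemma bounded_linear_cscale: "bounded_linear (cscale c)"
  by (subst linear_conv_bounded_linear[symmetric])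
     (auto intro!: linearI simp: cmat.scale_right_distrib vec_eq_iff scaleR_conv_of_real[where ?'a=complex])

lemma bounded_bilinear_cscale: "bounded_bilinear (cscale :: complex \<Rightarrow> ('n::finite) cmat \<Rightarrow> _)"
  by (subst bilinear_conv_bounded_bilinear[symmetric])
     (auto simp: bilinear_def cmat.scale_right_distrib cmat.scale_left_distrib vec_eq_iff
       scaleR_conv_of_real[where ?'a=complex] intro!: linearI)

interpretation cscale: bounded_bilinear "cscale :: complex \<Rightarrow> ('n::finite) cmat \<Rightarrow> 'n cmat"
  by (rule bounded_bilinear_cscale)

lemma mconj_nth [simp]: "mconj A $ i $ j = cnj (A $ i $ j)"
  by (simp add: mconj_def)

lemma mconj_simps [simp]:
  "mconj (mconj A) = A" "mconj (A + B) = mconj A + mconj B" "mconj (A - B) = mconj A - mconj B"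
  "mconj (- A) = - mconj A" "mconj 0 = 0" "mconj (mat 1) = mat 1"
  "mconj (cscale c A) = cscale (cnj c) (mconj A)" "mconj (A ** B) = mconj A ** mconj B"
  "mconj (r *\<^sub>R A) = r *\<^sub>R mconj A"
  by (auto simp: vec_eq_iff matrix_matrix_mult_def mat_def)

lemma bounded_linear_mconj: "bounded_linear mconj"
  by (subst linear_conv_bounded_linear[symmetric]) (auto intro!: linearI)

lemma invertible_mult_inv:
  assumes "invertible (A :: ('n::finite) cmat)"
  shows "A ** matrix_inv A = mat 1" "matrix_inv A ** A = mat 1"
  using assms unfolding invertible_def matrix_inv_def by (metis (mono_tags, lifting) someI_ex)+

lemma matrix_inv_unique:
  assumes "(A :: ('n::finite) cmat) ** B = mat 1" shows "matrix_inv A = B"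
proof -
  have "B ** A = mat 1" using assms by (simp add: matrix_left_right_inverse)
  then have "invertible A" using assms by (auto simp: invertible_def)
  then have "matrix_inv A = matrix_inv A ** (A ** B)" using assms by simp
  also have "\<dots> = B" using \<open>invertible A\<close> by (simp add: matrix_mul_assoc invertible_mult_inv)
  finally show ?thesis .
qed

lemma invertibleI: "(A :: ('n::finite) cmat) ** B = mat 1 \<Longrightarrow> invertible A"
  by (metis invertible_right_inverse)

lemma invertible_matrix_inv: "invertible (A :: ('n::finite) cmat) \<Longrightarrow> invertible (matrix_inv A)"
  by (meson invertibleI invertible_mult_inv(2))

lemma matrix_inv_inv: "invertible (A :: ('n::finite) cmat) \<Longrightarrow> matrix_inv (matrix_inv A) = A"
  by (simp add: invertible_mult_inv(2) matrix_inv_unique)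

lemma matrix_inv_mult:
  assumes "invertible (A :: ('n::finite) cmat)" "invertible (B :: 'n cmat)"
  shows "matrix_inv (A ** B) = matrix_inv B ** matrix_inv A"
proof (rule matrix_inv_unique)
  have "A ** (B ** matrix_inv B) ** matrix_inv A = mat 1"
    using assms by (simp add: invertible_mult_inv)
  then show "A ** B ** (matrix_inv B ** matrix_inv A) = mat 1" by (simp add: matrix_mul_assoc)
qed

lemma mult_inv_cancel:
  assumes "invertible (A :: ('n::finite) cmat)"
  shows "matrix_inv A ** (A ** X) = X" "A ** (matrix_inv A ** X) = X"
  using assms by (simp_all add: matrix_mul_assoc invertible_mult_inv)

lemma has_vector_derivative_matrix:
  fixes f :: "real \<Rightarrow> ('n::finite) cmat"
  assumes "\<And>i j. ((\<lambda>t. f t $ i $ j) has_vector_derivative D $ i $ j) (at s)"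
  shows "(f has_vector_derivative D) (at s)"
proof -
  define U where "U i j = (\<chi> a b. if a = i \<and> b = j then (1 :: complex) else 0)" for i j :: 'n
  have rep: "A = (\<Sum>i\<in>UNIV. \<Sum>j\<in>UNIV. cscale (A $ i $ j) (U i j))" for A
  proof -
    have "(\<Sum>i\<in>UNIV. \<Sum>j\<in>UNIV. cscale (A $ i $ j) (U i j)) $ a $ b
        = (\<Sum>i\<in>UNIV. if i = a then \<Sum>j\<in>UNIV. if j = b then A $ i $ j else 0 else 0)" for a b
      unfolding sum_component U_def by (intro sum.cong refl) (auto simp: if_distrib[of "(*) _"] cong: if_cong)
    then show ?thesis by (simp add: vec_eq_iff)
  qed
  have "((\<lambda>t. \<Sum>i\<in>UNIV. \<Sum>j\<in>UNIV. cscale (f t $ i $ j) (U i j)) has_vector_derivative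
      (\<Sum>i\<in>UNIV. \<Sum>j\<in>UNIV. cscale (D $ i $ j) (U i j))) (at s)"
    by (intro has_vector_derivative_sum bounded_linear.has_vector_derivative[OF cscale.bounded_linear_left] assms)
  then show ?thesis by (simp flip: rep)
qed

lemma Ad_simps:
  "Ad g (A + B) = Ad g A + Ad g B" "Ad g (A - B) = Ad g A - Ad g B" "Ad g (cscale c A) = cscale c (Ad g A)"
  "Ad g (- A) = - Ad g A" "Ad g 0 = 0" "Ad g (r *\<^sub>R A) = r *\<^sub>R Ad g A"
  by (simp_all add: Ad_def mult_distribs)

lemma bounded_linear_Ad: "bounded_linear (Ad g)"
  by (subst linear_conv_bounded_linear[symmetric]) (auto intro!: linearI simp: Ad_simps)

lemma Ad_mult: "invertible g \<Longrightarrow> Ad g (A ** B) = Ad g A ** Ad g B"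
  by (simp add: Ad_def mult_inv_cancel flip: matrix_mul_assoc)

lemma Ad_one: "invertible g \<Longrightarrow> Ad g (mat 1) = mat 1"
  by (simp add: Ad_def invertible_mult_inv)

lemma Ad_bracket: "invertible g \<Longrightarrow> Ad g (lie_bracket A B) = lie_bracket (Ad g A) (Ad g B)"
  by (simp add: lie_bracket_def Ad_simps Ad_mult)

lemma Ad_Ad: "invertible g \<Longrightarrow> invertible h \<Longrightarrow> Ad g (Ad h A) = Ad (g ** h) A"
  by (simp add: Ad_def matrix_inv_mult matrix_mul_assoc)

lemma Ad_inverse:
  assumes "invertible g"
  shows "Ad g (Ad (matrix_inv g) A) = A" "Ad (matrix_inv g) (Ad g A) = A"
  using assms by (simp_all add: Ad_def matrix_inv_inv mult_inv_cancel invertible_mult_inv flip: matrix_mul_assoc)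

lemma Ad_eq_iff: "invertible g \<Longrightarrow> Ad g A = Ad g B \<longleftrightarrow> A = B"
  by (metis Ad_inverse(2))

lemma trace_Ad:
  assumes "invertible (g :: ('n::finite) cmat)" shows "trace (Ad g A) = trace A"
proof -
  have "trace (Ad g A) = trace (matrix_inv g ** (g ** A))" unfolding Ad_def by (rule trace_mul_sym)
  then show ?thesis using assms by (simp add: mult_inv_cancel)
qed

lemma Ad_identity: "Ad (mat 1) X = X"
  by (simp add: Ad_def matrix_inv_unique[of "mat 1" "mat 1"])

lemma linear_Ad: "linear (Ad g)"
  by (rule bounded_linear.linear[OF bounded_linear_Ad])

lemma inj_Ad: "invertible g \<Longrightarrow> inj (Ad g)"
  by (simp add: inj_on_def Ad_eq_iff)

lemma linear_mconj: "linear mconj"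
  by (rule bounded_linear.linear[OF bounded_linear_mconj])

lemma mconj_matrix_inv:
  assumes "invertible (A :: ('n::finite) cmat)" shows "mconj (matrix_inv A) = matrix_inv (mconj A)"
proof (rule matrix_inv_unique[symmetric])
  have "mconj A ** mconj (matrix_inv A) = mconj (A ** matrix_inv A)" by simp
  then show "mconj A ** mconj (matrix_inv A) = mat 1" by (simp only: invertible_mult_inv[OF assms] mconj_simps)
qed

lemma mconj_Ad: "invertible g \<Longrightarrow> mconj (Ad g A) = Ad (mconj g) (mconj A)"
  by (simp add: Ad_def mconj_matrix_inv)

lemma Ad_nonzero_entry:
  assumes "invertible g" "A \<noteq> 0" obtains i j where "Ad g A $ i $ j \<noteq> 0"
proof -
  have "Ad g A \<noteq> 0" using assms Ad_eq_iff[of g A 0] by (simp add: Ad_simps)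
  then show ?thesis using that by (auto simp: vec_eq_iff)
qed

section \<open>Polynomials in a matrix and the spectral decomposition\<close>

fun mpow :: "('n::finite) cmat \<Rightarrow> nat \<Rightarrow> 'n cmat" where
  "mpow X 0 = mat 1"
| "mpow X (Suc k) = X ** mpow X k"

lemma mpow_add: "mpow X (j + k) = mpow X j ** mpow X k"
  by (induction j) (simp_all add: matrix_mul_assoc)

lemma mpow_commute: "X ** Y = Y ** X \<Longrightarrow> mpow X k ** Y = Y ** mpow X k"
  by (induction k) (simp, metis matrix_mul_assoc mpow.simps(2))

lemma mpow_Suc_right: "mpow X (Suc k) = mpow X k ** X"
  by (simp add: mpow_commute)

lemma mpow_mult_commute: "X ** Y = Y ** X \<Longrightarrow> mpow (X ** Y) k = mpow X k ** mpow Y k"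
proof (induction k)
  case (Suc k)
  have "mpow (X ** Y) (Suc k) = X ** (Y ** mpow X k) ** mpow Y k"
    using Suc by (simp add: matrix_mul_assoc)
  also have "Y ** mpow X k = mpow X k ** Y" using mpow_commute[OF Suc.prems] by simp
  finally show ?case by (simp add: matrix_mul_assoc)
qed simp

lemma mpow_zero_mono: "mpow X m = 0 \<Longrightarrow> m \<le> k \<Longrightarrow> mpow X k = 0"
  by (metis le_add_diff_inverse mpow_add mult_zero_left)

definition pev :: "('n::finite) cmat \<Rightarrow> complex poly \<Rightarrow> 'n cmat" where
  "pev X p = fold_coeffs (\<lambda>a M. cscale a (mat 1) + X ** M) p 0"

lemma pev_0 [simp]: "pev X 0 = 0"
  by (simp add: pev_def)

lemma pev_pCons [simp]: "pev X (pCons a p) = cscale a (mat 1) + X ** pev X p"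
  by (cases "p = 0 \<and> a = 0") (auto simp: pev_def mult_distribs)

lemma pev_1 [simp]: "pev X 1 = mat 1"
  by (simp add: one_pCons mult_distribs)

lemma pev_add: "pev X (p + q) = pev X p + pev X q"
  by (induction p q rule: poly_induct2) (simp_all add: mult_distribs cmat.scale_left_distrib)

lemma pev_smult: "pev X (smult c p) = cscale c (pev X p)"
  by (induction p) (simp_all add: mult_distribs cmat.scale_right_distrib)

lemma pev_mult: "pev X (p * q) = pev X p ** pev X q"
  by (induction p) (simp_all add: mult_distribs pev_add pev_smult matrix_mul_assoc)

lemma pev_sum: "pev X (\<Sum>i\<in>I. f i) = (\<Sum>i\<in>I. pev X (f i))"
  by (induction I rule: infinite_finite_induct) (simp_all add: pev_add)

lemma pev_power: "pev X (p ^ k) = mpow (pev X p) k"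
  by (induction k) (simp_all add: pev_mult)

lemma pev_monom: "pev X (monom c k) = cscale c (mpow X k)"
  by (induction k) (simp_all add: monom_0 monom_Suc mult_distribs)

lemma pev_commute:
  assumes "X ** Y = Y ** X" shows "pev X p ** Y = Y ** pev X p"
  by (induction p) (simp_all add: mult_distribs, metis assms matrix_mul_assoc)

text \<open>
  The powers of \<open>X\<close> lie in a space of finite dimension, so they are linearly dependent.
\<close>

lemma annihilating_polynomial:
  fixes X :: "('n::finite) cmat"
  obtains q where "q \<noteq> 0" "pev X q = 0"
proof (cases "inj_on (mpow X) {..DIM('n cmat)}")
  case False
  then obtain j k where "j \<noteq> k" "mpow X j = mpow X k" by (auto simp: inj_on_def)
  then have "pev X (monom 1 j + smult (-1) (monom 1 k)) = 0"
    by (simp only: pev_add pev_smult pev_monom) (simp add: vec_eq_iff)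
  moreover have "monom 1 j + smult (-1) (monom 1 k) \<noteq> (0 :: complex poly)"
    using \<open>j \<noteq> k\<close> by (auto dest!: arg_cong[where f = "\<lambda>p. coeff p j"])
  ultimately show ?thesis using that by blast
next
  case True
  let ?f = "mpow X" and ?I = "{..DIM('n cmat)}"
  have "card (?f ` ?I) > DIM('n cmat)" using True by (simp add: card_image)
  then have "dependent (?f ` ?I)" by (intro dependent_biggerset) auto
  then obtain u v where u: "v \<in> ?f ` ?I" "u v \<noteq> 0" "(\<Sum>v\<in>?f ` ?I. u v *\<^sub>R v) = 0"
    by (auto simp: real_vector.dependent_finite)
  define q :: "complex poly" where "q = (\<Sum>k\<in>?I. monom (of_real (u (?f k))) k)"
  have "pev X q = (\<Sum>k\<in>?I. u (?f k) *\<^sub>R ?f k)"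
    by (simp add: q_def pev_sum pev_monom cscale_of_real)
  also have "\<dots> = (\<Sum>v\<in>?f ` ?I. u v *\<^sub>R v)" by (subst sum.reindex[OF True]) simp
  also have "\<dots> = 0" by (rule u(3))
  finally have "pev X q = 0" .
  moreover obtain k where "k \<in> ?I" "v = ?f k" using u by auto
  then have "coeff q k \<noteq> 0" using u(2) by (simp add: q_def coeff_sum)
  then have "q \<noteq> 0" by auto
  ultimately show ?thesis using that by blast
qed

lemma coprime_combination_power:
  fixes a b :: "'a::comm_ring_1"
  assumes "u * a + w * b = 1"
  shows "\<exists>u' w'. u' * a + w' * b ^ k = 1"
proof (induction k)
  case 0
  show ?case by (rule exI[of _ 0], rule exI[of _ 1]) simp
next
  case (Suc k)
  then obtain u' w' where *: "u' * a + w' * b ^ k = 1" by blast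
  have "(u * a + w * b) * (u' * a + w' * b ^ k) = 1" using assms * by simp
  then have "(u * (u' * a + w' * b ^ k) + w * b * u') * a + (w * w') * b ^ Suc k = 1"
    by (simp add: algebra_simps)
  then show ?case by blast
qed

text \<open>
  In the induction, the product for the old roots does not vanish at the new root \<open>x\<close>, so it is
  coprime to the power of \<open>[:- x, 1:]\<close>.
\<close>

lemma partial_fractions:
  assumes "finite \<Lambda>" "\<Lambda> \<noteq> {}"
  shows "\<exists>a. (\<Sum>l\<in>\<Lambda>. a l * (\<Prod>m\<in>\<Lambda>-{l}. [:-m, 1:] ^ k)) = (1 :: complex poly)"
  using assms
proof (induction rule: finite_ne_induct)
  case (singleton x)
  then show ?case by (intro exI[of _ "\<lambda>_. 1"]) simp
next
  case (insert x F)
  then obtain a where a: "(\<Sum>l\<in>F. a l * (\<Prod>m\<in>F-{l}. [:-m, 1:] ^ k)) = (1 :: complex poly)"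
    by blast
  define Q :: "complex poly" where "Q = (\<Prod>m\<in>F. [:-m, 1:] ^ k)"
  have nz: "poly Q x \<noteq> 0" using insert by (auto simp: Q_def poly_prod)
  have "[:-x, 1:] dvd Q - [:poly Q x:]" by (simp add: poly_eq_0_iff_dvd[symmetric])
  then obtain R where R: "Q - [:poly Q x:] = [:-x, 1:] * R" by blast
  have expand: "c * Q + (- c * R) * y = c * (Q - y * R)" for c y :: "complex poly"
    by (simp add: algebra_simps)
  have "[:inverse (poly Q x):] * Q + (- [:inverse (poly Q x):] * R) * [:-x, 1:]
      = [:inverse (poly Q x):] * (Q - [:-x, 1:] * R)"
    by (rule expand)
  also have "\<dots> = [:inverse (poly Q x):] * [:poly Q x:]"
    unfolding R[symmetric] by (simp only: diff_diff_eq2 add_diff_cancel_left')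
  also have "\<dots> = 1" using nz by (simp add: one_pCons)
  finally have "\<exists>u w. u * Q + w * [:-x, 1:] ^ k = 1" by (rule coprime_combination_power)
  then obtain u w where uw: "u * Q + w * [:-x, 1:] ^ k = 1" by blast
  define a' where "a' = (\<lambda>l. if l = x then u else w * a l)"
  have "(\<Sum>l\<in>insert x F. a' l * (\<Prod>m\<in>insert x F-{l}. [:-m, 1:] ^ k))
     = u * Q + (\<Sum>l\<in>F. a' l * (\<Prod>m\<in>insert x F-{l}. [:-m, 1:] ^ k))"
    using insert by (simp add: a'_def Q_def)
  also have "(\<Sum>l\<in>F. a' l * (\<Prod>m\<in>insert x F-{l}. [:-m, 1:] ^ k))
     = (\<Sum>l\<in>F. (w * [:-x, 1:] ^ k) * (a l * (\<Prod>m\<in>F-{l}. [:-m, 1:] ^ k)))"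
  proof (rule sum.cong[OF refl])
    fix l assume "l \<in> F"
    then have "insert x F - {l} = insert x (F - {l})" "x \<notin> F - {l}" "l \<noteq> x" using insert by auto
    then show "a' l * (\<Prod>m\<in>insert x F-{l}. [:-m, 1:] ^ k)
        = (w * [:-x, 1:] ^ k) * (a l * (\<Prod>m\<in>F-{l}. [:-m, 1:] ^ k))"
      using insert by (simp add: a'_def mult_ac)
  qed
  also have "\<dots> = w * [:-x, 1:] ^ k" using a by (simp flip: sum_distrib_left)
  finally show ?case using uw by metis
qed

text \<open>
  \<open>E l\<close> is the projection onto the generalized eigenspace of \<open>l\<close>. It is obtained by inserting
  \<open>X\<close> into the partial fraction decomposition for the roots of an annihilating polynomial, so it
  is a polynomial in \<open>X\<close> and commutes with whatever commutes with \<open>X\<close>.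
\<close>

lemma spectral_decomposition:
  fixes X :: "('n::finite) cmat"
  obtains \<Lambda> :: "complex set" and E N k where "finite \<Lambda>" "(\<Sum>l\<in>\<Lambda>. E l) = mat 1"
    "\<And>l m. l \<in> \<Lambda> \<Longrightarrow> m \<in> \<Lambda> \<Longrightarrow> E l ** E m = (if l = m then E l else 0)"
    "X = (\<Sum>l\<in>\<Lambda>. cscale l (E l)) + N" "mpow N k = 0"
    "\<And>Y l. X ** Y = Y ** X \<Longrightarrow> E l ** Y = Y ** E l"
proof -
  obtain q where q: "q \<noteq> 0" "pev X q = 0" by (rule annihilating_polynomial)
  define \<Lambda> where "\<Lambda> = {z. poly q z = 0}"
  define k where "k = degree q"
  have fin: "finite \<Lambda>" using q by (simp add: \<Lambda>_def poly_roots_finite)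
  define Q where "Q = (\<Prod>l\<in>\<Lambda>. [:-l, 1:] ^ k)"
  have "(\<Prod>l\<in>\<Lambda>. [:-l, 1:] ^ Polynomial.order l q) dvd Q"
    unfolding Q_def by (intro prod_dvd_prod le_imp_power_dvd) (simp add: k_def order_degree q)
  moreover have "q = smult (lead_coeff q) (\<Prod>l\<in>\<Lambda>. [:-l, 1:] ^ Polynomial.order l q)"
    unfolding \<Lambda>_def by (rule complex_poly_decompose[symmetric])
  ultimately have "q dvd Q" using q
    by (metis leading_coeff_0_iff smult_dvd)
  then have Q0: "pev X Q = 0" using q by (auto simp: dvd_def pev_mult mult_distribs)
  have ne: "\<Lambda> \<noteq> {}"
  proof
    assume "\<Lambda> = {}"
    then have "Q = 1" by (simp add: Q_def)
    then have "(mat 1 :: 'n cmat) = 0" using Q0 by simp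
    then show False by (simp add: vec_eq_iff mat_def) (metis zero_neq_one)
  qed
  obtain a where a: "(\<Sum>l\<in>\<Lambda>. a l * (\<Prod>m\<in>\<Lambda>-{l}. [:-m, 1:] ^ k)) = (1 :: complex poly)"
    using partial_fractions[OF fin ne] by blast
  define P where "P l = a l * (\<Prod>m\<in>\<Lambda>-{l}. [:-m, 1:] ^ k)" for l
  define E where "E l = pev X (P l)" for l
  have sum1: "(\<Sum>l\<in>\<Lambda>. E l) = mat 1" using arg_cong[OF a, of "pev X"] by (simp add: E_def P_def pev_sum)
  have comm: "E l ** Y = Y ** E l" if "X ** Y = Y ** X" for Y l
    using that by (simp add: E_def pev_commute)
  have orth: "E l ** E m = 0" if lm: "l \<in> \<Lambda>" "m \<in> \<Lambda>" "l \<noteq> m" for l m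
  proof -
    have "Q dvd P l * P m"
    proof -
      have "Q = (\<Prod>j\<in>\<Lambda>-{l}. [:-j, 1:] ^ k) * [:-l, 1:] ^ k"
        unfolding Q_def using lm fin by (subst prod.remove[of _ l]) (auto simp: mult.commute)
      moreover have "[:-l, 1:] ^ k dvd (\<Prod>j\<in>\<Lambda>-{m}. [:-j, 1:] ^ k)"
        using lm fin by (intro dvd_prodI) auto
      ultimately show ?thesis unfolding P_def
        by (metis dvd_mult dvd_triv_right mult_dvd_mono)
    qed
    then show ?thesis unfolding E_def pev_mult[symmetric] using Q0
      by (metis dvdE mult_zero_left pev_mult)
  qed
  have idem: "E l ** E l = E l" if "l \<in> \<Lambda>" for l
  proof -
    have "E l = E l ** (\<Sum>m\<in>\<Lambda>. E m)" by (simp add: sum1)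
    also have "\<dots> = (\<Sum>m\<in>\<Lambda>. if m = l then E l ** E l else 0)"
      unfolding mult_sum_right using that orth by (intro sum.cong) auto
    also have "\<dots> = E l ** E l" using that fin by simp
    finally show ?thesis by simp
  qed
  define N where "N = X - (\<Sum>l\<in>\<Lambda>. cscale l (E l))"
  have NE: "N ** E l = (X - cscale l (mat 1)) ** E l" if "l \<in> \<Lambda>" for l
  proof -
    have "(\<Sum>m\<in>\<Lambda>. cscale m (E m)) ** E l = (\<Sum>m\<in>\<Lambda>. if m = l then cscale l (E l) else 0)"
      unfolding mult_sum_left using that orth idem
      by (intro sum.cong) (auto simp: cscale_mult_left)
    also have "\<dots> = cscale l (E l)" using that fin by simp
    finally show ?thesis by (simp add: N_def mult_distribs)
  qed
  have NkE: "mpow N j ** E l = mpow (X - cscale l (mat 1)) j ** E l" if "l \<in> \<Lambda>" for j l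
  proof (induction j)
    case (Suc j)
    have c: "E l ** (X - cscale l (mat 1)) = (X - cscale l (mat 1)) ** E l"
      by (simp add: mult_distribs comm)
    have "mpow N (Suc j) ** E l = mpow N j ** (N ** E l)"
      by (simp only: mpow_Suc_right matrix_mul_assoc)
    also have "\<dots> = (mpow N j ** E l) ** (X - cscale l (mat 1))"
      unfolding NE[OF that] c[symmetric] by (simp add: matrix_mul_assoc)
    also have "\<dots> = mpow (X - cscale l (mat 1)) j ** (E l ** (X - cscale l (mat 1)))"
      unfolding Suc by (simp add: matrix_mul_assoc)
    also have "\<dots> = mpow (X - cscale l (mat 1)) (Suc j) ** E l"
      unfolding c by (simp only: mpow_Suc_right matrix_mul_assoc)
    finally show ?case .
  qed simp
  have kill: "mpow (X - cscale l (mat 1)) k ** E l = 0" if "l \<in> \<Lambda>" for l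
  proof -
    have "X - cscale l (mat 1) = pev X [:-l, 1:]" by (simp add: mult_distribs)
    then have "mpow (X - cscale l (mat 1)) k ** E l = pev X ([:-l, 1:] ^ k * P l)"
      by (simp add: E_def pev_mult pev_power)
    also have "[:-l, 1:] ^ k * P l = a l * Q"
      unfolding P_def Q_def using that fin by (subst (2) prod.remove[of _ l]) (auto simp: mult_ac)
    finally show ?thesis using Q0 by (simp add: pev_mult mult_distribs)
  qed
  have "mpow N k = mpow N k ** (\<Sum>l\<in>\<Lambda>. E l)" by (simp add: sum1)
  also have "\<dots> = 0" unfolding mult_sum_right using NkE kill by simp
  finally have "mpow N k = 0" .
  show ?thesis
  proof (rule that[of \<Lambda> E N k])
    show "E l ** E m = (if l = m then E l else 0)" if "l \<in> \<Lambda>" "m \<in> \<Lambda>" for l m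
      using orth idem that by simp
    show "X = (\<Sum>l\<in>\<Lambda>. cscale l (E l)) + N" by (simp add: N_def)
  qed fact+
qed

section \<open>Exponential polynomials\<close>

text \<open>
  The two arguments are separate times for the semisimple part, which enters through
  exponentials, and for the nilpotent part, which enters through polynomials. On the diagonal
  this is an ordinary exponential polynomial.
\<close>

definition exp_poly :: "(complex \<Rightarrow> complex \<Rightarrow> complex) \<Rightarrow> bool" where
  "exp_poly \<phi> \<longleftrightarrow>
    (\<exists>M c. finite M \<and> \<phi> = (\<lambda>z w. \<Sum>\<mu>\<in>M. exp (z * \<mu>) * poly (c \<mu>) w))"

lemma exp_poly_monomial: "exp_poly (\<lambda>z w. exp (z * \<mu>) * poly p w)"
  unfolding exp_poly_def by (intro exI[of _ "{\<mu>}"] exI[of _ "\<lambda>_. p"]) simp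

lemma exp_poly_const: "exp_poly (\<lambda>z w. a)"
  using exp_poly_monomial[of 0 "[:a:]"] by simp

lemma exp_poly_add:
  assumes "exp_poly \<phi>" "exp_poly \<psi>" shows "exp_poly (\<lambda>z w. \<phi> z w + \<psi> z w)"
proof -
  obtain M c where M: "finite M" "\<phi> = (\<lambda>z w. \<Sum>\<mu>\<in>M. exp (z * \<mu>) * poly (c \<mu>) w)"
    using assms unfolding exp_poly_def by blast
  obtain M' c' where M': "finite M'" "\<psi> = (\<lambda>z w. \<Sum>\<mu>\<in>M'. exp (z * \<mu>) * poly (c' \<mu>) w)"
    using assms unfolding exp_poly_def by blast
  define d where "d \<mu> = (if \<mu> \<in> M then c \<mu> else 0)" for \<mu>
  define d' where "d' \<mu> = (if \<mu> \<in> M' then c' \<mu> else 0)" for \<mu>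
  have 1: "\<phi> z w = (\<Sum>\<mu>\<in>M \<union> M'. exp (z * \<mu>) * poly (d \<mu>) w)" for z w
    unfolding M(2) using M M' by (intro sum.mono_neutral_cong_left) (auto simp: d_def)
  have 2: "\<psi> z w = (\<Sum>\<mu>\<in>M \<union> M'. exp (z * \<mu>) * poly (d' \<mu>) w)" for z w
    unfolding M'(2) using M M' by (intro sum.mono_neutral_cong_left) (auto simp: d'_def)
  show ?thesis unfolding exp_poly_def
    using M(1) M'(1) by (intro exI[of _ "M \<union> M'"] exI[of _ "\<lambda>\<mu>. d \<mu> + d' \<mu>"])
      (simp add: 1 2 sum.distrib ring_distribs)
qed

lemma exp_poly_sum:
  "(\<And>i. i \<in> I \<Longrightarrow> exp_poly (f i)) \<Longrightarrow> exp_poly (\<lambda>z w. \<Sum>i\<in>I. f i z w)"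
  by (induction I rule: infinite_finite_induct) (simp_all add: exp_poly_const exp_poly_add)

lemma exp_poly_mult:
  assumes "exp_poly \<phi>" "exp_poly \<psi>" shows "exp_poly (\<lambda>z w. \<phi> z w * \<psi> z w)"
proof -
  obtain M c where M: "finite M" "\<phi> = (\<lambda>z w. \<Sum>\<mu>\<in>M. exp (z * \<mu>) * poly (c \<mu>) w)"
    using assms unfolding exp_poly_def by blast
  obtain M' c' where M': "finite M'" "\<psi> = (\<lambda>z w. \<Sum>\<mu>\<in>M'. exp (z * \<mu>) * poly (c' \<mu>) w)"
    using assms unfolding exp_poly_def by blast
  have "(\<lambda>z w. \<phi> z w * \<psi> z w)
      = (\<lambda>z w. \<Sum>\<mu>\<in>M. \<Sum>\<nu>\<in>M'. exp (z * (\<mu> + \<nu>)) * poly (c \<mu> * c' \<nu>) w)"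
    unfolding M(2) M'(2)
    by (intro ext, subst sum_product, intro sum.cong refl) (simp add: ring_distribs exp_add mult_ac)
  then show ?thesis by (simp only:) (intro exp_poly_sum exp_poly_monomial)
qed

text \<open>
  The operator \<open>d/dt - \<mu>0\<close> preserves flatness at the origin, lowers the degree of the
  coefficient of \<open>\<mu>0\<close> and does not raise the others. Induction on the total degree leaves
  one exponential with a constant coefficient, which is its value at the origin. The higher
  derivatives are passed as a sequence \<open>\<phi>\<close>, because they will be known as values of
  iterated derivations.
\<close>

lemma flat_exp_poly:
  fixes c :: "complex \<Rightarrow> complex poly" and \<phi> :: "nat \<Rightarrow> real \<Rightarrow> complex"
  assumes "finite M" "\<And>\<mu>. \<mu> \<in> M \<Longrightarrow> c \<mu> \<noteq> 0"
    and "\<And>k t. (\<phi> k has_vector_derivative \<phi> (Suc k) t) (at t)" "\<And>k. \<phi> k 0 = 0"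
    and "\<And>t. \<phi> 0 t = (\<Sum>\<mu>\<in>M. exp (of_real t * \<mu>) * poly (c \<mu>) (of_real t))"
  shows "M = {}"
  using assms
proof (induction "\<Sum>\<mu>\<in>M. Suc (degree (c \<mu>))" arbitrary: M c \<phi> rule: less_induct)
  case less
  show ?case
  proof (rule ccontr)
    assume "M \<noteq> {}"
    then obtain \<mu>0 where \<mu>0: "\<mu>0 \<in> M" by blast
    define \<psi> where "\<psi> k t = \<phi> (Suc k) t - \<mu>0 * \<phi> k t" for k t
    define c' where "c' \<mu> = pderiv (c \<mu>) + smult (\<mu> - \<mu>0) (c \<mu>)" for \<mu>
    define M' where "M' = {\<mu> \<in> M. c' \<mu> \<noteq> 0}"
    have deg: "degree (c' \<mu>) = degree (c \<mu>) \<and> c' \<mu> \<noteq> 0" if "\<mu> \<in> M" "\<mu> \<noteq> \<mu>0" for \<mu>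
    proof (cases "degree (c \<mu>) = 0")
      case True
      then have "pderiv (c \<mu>) = 0" by (simp add: pderiv_eq_0_iff)
      then show ?thesis using that less.prems(2) by (simp add: c'_def)
    next
      case False
      then have "degree (pderiv (c \<mu>)) < degree (smult (\<mu> - \<mu>0) (c \<mu>))"
        using that by (simp add: degree_pderiv)
      then have "degree (c' \<mu>) = degree (c \<mu>)"
        unfolding c'_def using that by (subst degree_add_eq_right) auto
      then show ?thesis using False by auto
    qed
    have 0: "c' \<mu>0 = pderiv (c \<mu>0)" by (simp add: c'_def)
    have lt: "(\<Sum>\<mu>\<in>M'. Suc (degree (c' \<mu>))) < (\<Sum>\<mu>\<in>M. Suc (degree (c \<mu>)))"
    proof -
      have "(\<Sum>\<mu>\<in>M'. Suc (degree (c' \<mu>))) = (\<Sum>\<mu>\<in>M. if c' \<mu> \<noteq> 0 then Suc (degree (c' \<mu>)) else 0)"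
        unfolding M'_def using less.prems(1) by (intro sum.mono_neutral_cong_left) auto
      also have "\<dots> < (\<Sum>\<mu>\<in>M. Suc (degree (c \<mu>)))"
      proof (rule sum_strict_mono_ex1[OF less.prems(1)])
        have "(if c' \<mu>0 \<noteq> 0 then Suc (degree (c' \<mu>0)) else 0) < Suc (degree (c \<mu>0))"
          by (auto simp: 0 degree_pderiv pderiv_eq_0_iff)
        then show "\<exists>a\<in>M. (if c' a \<noteq> 0 then Suc (degree (c' a)) else 0) < Suc (degree (c a))"
          using \<mu>0 by blast
        show "\<forall>x\<in>M. (if c' x \<noteq> 0 then Suc (degree (c' x)) else 0) \<le> Suc (degree (c x))"
          using deg by (auto simp: 0 degree_pderiv)
            (metis "0" degree_pderiv diff_le_self le_refl)
      qed
      finally show ?thesis .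
    qed
    have d1: "\<phi> 1 t = (\<Sum>\<mu>\<in>M. exp (of_real t * \<mu>) * poly (pderiv (c \<mu>) + smult \<mu> (c \<mu>)) (of_real t))"
      for t
    proof -
      have "((\<lambda>z. \<Sum>\<mu>\<in>M. exp (z * \<mu>) * poly (c \<mu>) z) has_field_derivative
          (\<Sum>\<mu>\<in>M. exp (of_real t * \<mu>) * poly (pderiv (c \<mu>) + smult \<mu> (c \<mu>)) (of_real t)))
          (at (of_real t))"
        by (auto intro!: derivative_eq_intros sum.cong poly_DERIV simp: algebra_simps)
      from has_vector_derivative_real_field[OF this]
      have "(\<phi> 0 has_vector_derivative
          (\<Sum>\<mu>\<in>M. exp (of_real t * \<mu>) * poly (pderiv (c \<mu>) + smult \<mu> (c \<mu>)) (of_real t))) (at t)"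
        unfolding less.prems(5) by simp
      then show ?thesis using less.prems(3)[of 0 t] vector_derivative_unique_at by fastforce
    qed
    have "M' = {}"
    proof (rule less.hyps[OF lt])
      show "finite M'" using less.prems(1) by (simp add: M'_def)
      show "c' \<mu> \<noteq> 0" if "\<mu> \<in> M'" for \<mu> using that by (simp add: M'_def)
      show "(\<psi> k has_vector_derivative \<psi> (Suc k) t) (at t)" for k t
        unfolding \<psi>_def by (intro derivative_intros has_vector_derivative_mult_right less.prems(3))
      show "\<psi> k 0 = 0" for k by (simp add: \<psi>_def less.prems(4))
      have "\<psi> 0 t = (\<Sum>\<mu>\<in>M. exp (of_real t * \<mu>) * poly (c' \<mu>) (of_real t))" for t
        unfolding \<psi>_def using d1[of t] less.prems(5)[of t]
        by (simp add: c'_def sum_distrib_left algebra_simps flip: sum_subtractf)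
      also have "\<dots> t = (\<Sum>\<mu>\<in>M'. exp (of_real t * \<mu>) * poly (c' \<mu>) (of_real t))" for t
        unfolding M'_def using less.prems(1) by (intro sum.mono_neutral_right) auto
      finally show "\<psi> 0 t = (\<Sum>\<mu>\<in>M'. exp (of_real t * \<mu>) * poly (c' \<mu>) (of_real t))" for t .
    qed
    then have "M = {\<mu>0}" "pderiv (c \<mu>0) = 0" using \<mu>0 deg 0 by (auto simp: M'_def)
    then obtain a where a: "c \<mu>0 = [:a:]" by (auto simp: pderiv_eq_0_iff elim: degree_eq_zeroE)
    have "\<phi> 0 0 = a" unfolding less.prems(5) by (simp add: \<open>M = _\<close> a)
    then show False using less.prems(2)[OF \<mu>0] less.prems(4)[of 0] a by simp
  qed
qed

section \<open>One-parameter groups of matrices\<close>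

definition flow :: "('n::finite) cmat \<Rightarrow> (real \<Rightarrow> 'n cmat) \<Rightarrow> bool" where
  "flow X c \<longleftrightarrow> c 0 = mat 1 \<and> (\<forall>t. (c has_vector_derivative c t ** X) (at t))"

text \<open>The derivative of the product is zero.\<close>

lemma flow_mult_left_flow:
  assumes "flow X c" "d 0 = mat 1" "\<And>t. (d has_vector_derivative - (X ** d t)) (at t)"
  shows "c t ** d t = mat 1"
proof -
  have "((\<lambda>t. c t ** d t) has_vector_derivative 0) (at s within UNIV)" for s
    using matmul.has_vector_derivative[of c "c s ** X" s UNIV d "- (X ** d s)"] assms(1,3)
    by (simp add: flow_def mult_distribs matrix_mul_assoc)
  then obtain k where "\<And>s. c s ** d s = k"
    using has_vector_derivative_zero_constant[of UNIV "\<lambda>t. c t ** d t"] by auto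
  from this[of t] this[of 0] show ?thesis using assms by (simp add: flow_def)
qed

text \<open>
  For the spectral decomposition \<open>X = S + N\<close>, \<open>\<Psi> z w\<close> is the product of the exponential of
  \<open>z S\<close>, which is a sum over the eigenvalues, and of that of \<open>w N\<close>, which is a finite sum.
\<close>

lemma spectral_flow:
  fixes X :: "('n::finite) cmat"
  obtains \<Lambda> :: "complex set" and E S N k \<Psi> where
    "finite \<Lambda>" "(\<Sum>l\<in>\<Lambda>. E l) = mat 1"
    "\<And>l. l \<in> \<Lambda> \<Longrightarrow> S ** E l = cscale l (E l)"
    "\<And>Y l. X ** Y = Y ** X \<Longrightarrow> E l ** Y = Y ** E l"
    "S = (\<Sum>l\<in>\<Lambda>. cscale l (E l))" "X = S + N" "mpow N k = 0"
    "\<And>z w. flow (cscale z S + cscale w N) (\<lambda>t. \<Psi> (of_real t * z) (of_real t * w))"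
    "\<And>Y z w. X ** Y = Y ** X \<Longrightarrow> \<Psi> z w ** Y = Y ** \<Psi> z w"
    "\<And>i j. exp_poly (\<lambda>z w. \<Psi> z w $ i $ j)"
proof -
  obtain \<Lambda> :: "complex set" and E N k where sd: "finite \<Lambda>" "(\<Sum>l\<in>\<Lambda>. E l) = mat 1"
    "\<And>l m. l \<in> \<Lambda> \<Longrightarrow> m \<in> \<Lambda> \<Longrightarrow> E l ** E m = (if l = m then E l else 0)"
    "X = (\<Sum>l\<in>\<Lambda>. cscale l (E l)) + N" "mpow N k = 0"
    and comm: "\<And>Y l. X ** Y = Y ** X \<Longrightarrow> E l ** Y = Y ** E l"
    by (rule spectral_decomposition[of X], rule that)
  define S where "S = (\<Sum>l\<in>\<Lambda>. cscale l (E l))"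
  have XSN: "X = S + N" using sd(4) by (simp add: S_def)
  have commS: "S ** Y = Y ** S" if "X ** Y = Y ** X" for Y
    unfolding S_def mult_sum_left mult_sum_right using comm[OF that] by (simp add: mult_distribs)
  have commN: "N ** Y = Y ** N" if "X ** Y = Y ** X" for Y
  proof -
    have "N = X - S" using XSN by simp
    then show ?thesis using commS[OF that] that by (simp add: mult_distribs)
  qed
  define A where "A z = (\<Sum>l\<in>\<Lambda>. cscale (exp (z * l)) (E l))" for z
  define U where "U w = (\<Sum>j<k. cscale (w ^ j / fact j) (mpow N j))" for w
  define \<Psi> where "\<Psi> z w = A z ** U w" for z w
  have SE: "S ** E l = cscale l (E l)" if "l \<in> \<Lambda>" for l
  proof -
    have "S ** E l = (\<Sum>m\<in>\<Lambda>. if m = l then cscale l (E l) else 0)"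
      unfolding S_def mult_sum_left using that sd(3)
      by (intro sum.cong) (auto simp: cscale_mult_left)
    also have "\<dots> = cscale l (E l)" using that sd(1) by simp
    finally show ?thesis .
  qed
  have commA: "A z ** Y = Y ** A z" if "X ** Y = Y ** X" for Y z
    unfolding A_def mult_sum_left mult_sum_right using comm[OF that] by (simp add: mult_distribs)
  have commU: "U w ** Y = Y ** U w" if "X ** Y = Y ** X" for Y w
    unfolding U_def mult_sum_left mult_sum_right using mpow_commute[OF commN[OF that]]
    by (simp add: mult_distribs)
  have comm\<Psi>: "\<Psi> z w ** Y = Y ** \<Psi> z w" if "X ** Y = Y ** X" for Y z w
    unfolding \<Psi>_def using commA[OF that] commU[OF that] by (metis matrix_mul_assoc)
  have dA: "((\<lambda>t. A (of_real t * z)) has_vector_derivative cscale z S ** A (of_real t * z)) (at t)"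
    for t z
  proof -
    have *: "((\<lambda>t. exp (of_real t * z * l)) has_vector_derivative z * l * exp (of_real t * z * l)) (at t)"
      for l
      by (rule has_vector_derivative_real_field) (auto intro!: derivative_eq_intros)
    have "((\<lambda>t. A (of_real t * z)) has_vector_derivative
        (\<Sum>l\<in>\<Lambda>. cscale (z * l * exp (of_real t * z * l)) (E l))) (at t)"
      unfolding A_def
      by (intro has_vector_derivative_sum bounded_linear.has_vector_derivative[OF cscale.bounded_linear_left] *)
    also have "(\<Sum>l\<in>\<Lambda>. cscale (z * l * exp (of_real t * z * l)) (E l)) = cscale z S ** A (of_real t * z)"
      unfolding A_def mult_sum_right
      by (intro sum.cong) (simp_all add: cscale_mult_left cscale_mult_right SE mult_ac)
    finally show ?thesis .
  qed
  have dU: "((\<lambda>t. U (of_real t * w)) has_vector_derivative cscale w N ** U (of_real t * w)) (at t)"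
    for t w
  proof -
    have *: "((\<lambda>t. (of_real t * w) ^ j / fact j) has_vector_derivative
        (if j = 0 then 0 else w * ((of_real t * w) ^ (j - 1) / fact (j - 1)))) (at t)" for j
    proof (rule has_vector_derivative_real_field[where f = "\<lambda>t. (t * w) ^ j / fact j"])
      show "((\<lambda>t. (t * w) ^ j / fact j) has_field_derivative
        (if j = 0 then 0 else w * ((of_real t * w) ^ (j - 1) / fact (j - 1)))) (at (of_real t))"
      proof (cases j)
        case (Suc n)
        have 1: "((\<lambda>t. t * w) has_field_derivative w) (at (of_real t))"
          by (auto intro!: derivative_eq_intros)
        have "((\<lambda>t. (t * w) ^ Suc n / fact (Suc n)) has_field_derivative
            ((1 + of_nat n) * (w * (of_real t * w) ^ n)) / fact (Suc n)) (at (of_real t))"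
          by (rule DERIV_cdivide[OF DERIV_power_Suc[OF 1]])
        also have "((1 + of_nat n) * (w * (of_real t * w) ^ n)) / fact (Suc n)
            = w * ((of_real t * w) ^ n / fact n)"
          using of_nat_neq_0[of n, where ?'a = complex] by (simp add: divide_simps)
        finally show ?thesis using Suc by simp
      qed simp
    qed
    have "((\<lambda>t. U (of_real t * w)) has_vector_derivative
        (\<Sum>j<k. cscale (if j = 0 then 0 else w * ((of_real t * w) ^ (j - 1) / fact (j - 1))) (mpow N j)))
        (at t)"
      unfolding U_def
      by (intro has_vector_derivative_sum bounded_linear.has_vector_derivative[OF cscale.bounded_linear_left] *)
    also have "(\<Sum>j<k. cscale (if j = 0 then 0 else w * ((of_real t * w) ^ (j - 1) / fact (j - 1))) (mpow N j))
        = cscale w N ** U (of_real t * w)"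
    proof (cases k)
      case 0
      then show ?thesis by (simp add: U_def mult_distribs)
    next
      case (Suc m)
      have "cscale w N ** U (of_real t * w)
          = (\<Sum>j<k. cscale (w * ((of_real t * w) ^ j / fact j)) (mpow N (Suc j)))"
        unfolding U_def mult_sum_right by (simp add: cscale_mult_left cscale_mult_right mult_ac)
      also have "\<dots> = (\<Sum>j<m. cscale (w * ((of_real t * w) ^ j / fact j)) (mpow N (Suc j)))"
        unfolding Suc using sd(5) by (simp add: Suc)
      finally show ?thesis
        unfolding Suc by (subst sum.lessThan_Suc_shift) simp
    qed
    finally show ?thesis .
  qed
  have d\<Psi>: "((\<lambda>t. \<Psi> (of_real t * z) (of_real t * w)) has_vector_derivative
      \<Psi> (of_real t * z) (of_real t * w) ** (cscale z S + cscale w N)) (at t)" for t z w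
  proof -
    let ?A = "A (of_real t * z)" and ?U = "U (of_real t * w)"
    have XX: "X ** X = X ** X" ..
    have XS: "X ** S = S ** X" using commS[OF XX] by simp
    have XN: "X ** N = N ** X" using commN[OF XX] by simp
    have e1: "cscale z S ** ?A ** ?U = ?A ** ?U ** cscale z S"
      using comm\<Psi>[OF XS, of "of_real t * z" "of_real t * w"]
      by (simp add: \<Psi>_def mult_distribs matrix_mul_assoc)
    have e2: "?A ** (cscale w N ** ?U) = ?A ** ?U ** cscale w N"
      using commU[OF XN, of "of_real t * w"] by (simp add: mult_distribs flip: matrix_mul_assoc)
    show ?thesis
      using matmul.has_vector_derivative[OF dA[where t = t and z = z] dU[where t = t and w = w]]
      unfolding \<Psi>_def matrix_add_ldistrib e1 e2 by (simp only: add.commute)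
  qed
  have 0: "\<Psi> 0 0 = mat 1"
  proof -
    have "U 0 = mat 1"
    proof (cases k)
      case 0
      then have "(mat 1 :: 'n cmat) = 0" using sd(5) by simp
      then show ?thesis by (simp add: U_def 0)
    next
      case (Suc m)
      show ?thesis unfolding U_def Suc by (subst sum.lessThan_Suc_shift) (simp add: mult_distribs)
    qed
    then show ?thesis using sd(2) by (simp add: \<Psi>_def A_def)
  qed
  have ep: "exp_poly (\<lambda>z w. \<Psi> z w $ i $ j)" for i j
  proof -
    have "exp_poly (\<lambda>z w. exp (z * l) * E l $ i $ m)" for l i m
      using exp_poly_monomial[of l "[:E l $ i $ m:]"] by simp
    then have 1: "exp_poly (\<lambda>z w. A z $ i $ m)" for i m
      unfolding A_def by (simp add: exp_poly_sum)
    have "exp_poly (\<lambda>z w. w ^ n / fact n * mpow N n $ m $ j)" for n m j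
      using exp_poly_monomial[of 0 "monom (mpow N n $ m $ j / fact n) n"]
      by (simp add: poly_monom mult_ac)
    then have 2: "exp_poly (\<lambda>z w. U w $ m $ j)" for m j
      unfolding U_def by (simp add: exp_poly_sum)
    show ?thesis unfolding \<Psi>_def matrix_matrix_mult_def
      by (simp add: exp_poly_sum exp_poly_mult 1 2)
  qed
  show ?thesis
  proof (rule that[of \<Lambda> E S N k \<Psi>])
    show "flow (cscale z S + cscale w N) (\<lambda>t. \<Psi> (of_real t * z) (of_real t * w))" for z w
      unfolding flow_def using 0 d\<Psi> by simp
  qed (fact sd comm S_def XSN comm\<Psi> ep SE)+
qed

text \<open>
  As \<open>\<Psi>\<close> commutes with \<open>X\<close>, its curve is also a solution of the equation with the factor
  \<open>X\<close> on the left. Such a solution inverts every flow of \<open>X\<close>, which gives uniqueness of flows.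
\<close>

lemma left_flow_exists:
  fixes X :: "('n::finite) cmat"
  obtains d where "d 0 = mat 1" "\<And>t. (d has_vector_derivative - (X ** d t)) (at t)"
    "\<And>Y t. X ** Y = Y ** X \<Longrightarrow> d t ** Y = Y ** d t" "flow (- X) d"
proof -
  obtain \<Lambda> :: "complex set" and E S N k \<Psi> where XSN: "- X = S + N"
    and fl: "\<And>z w. flow (cscale z S + cscale w N) (\<lambda>t. \<Psi> (of_real t * z) (of_real t * w))"
    and comm: "\<And>Y z w. - X ** Y = Y ** - X \<Longrightarrow> \<Psi> z w ** Y = Y ** \<Psi> z w"
    by (rule spectral_flow[of "- X"]) blast
  define d where "d t = \<Psi> (of_real t) (of_real t)" for t :: real
  have f: "flow (- X) d" using fl[of 1 1] XSN by (simp add: d_def[abs_def])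
  have c: "d t ** Y = Y ** d t" if "X ** Y = Y ** X" for Y t
    unfolding d_def using that by (intro comm) (simp add: mult_distribs)
  have "(d has_vector_derivative - (X ** d t)) (at t)" for t
  proof -
    have "(d has_vector_derivative - (d t ** X)) (at t)"
      using f by (simp add: flow_def mult_distribs)
    then show ?thesis by (simp add: c)
  qed
  with f c show ?thesis using that by (auto simp: flow_def)
qed

text \<open>
  The exponential of \<open>t X\<close>, characterized by its differential equation, from which its
  functional equations follow by uniqueness.
\<close>

definition mexp :: "('n::finite) cmat \<Rightarrow> real \<Rightarrow> 'n cmat" where
  "mexp X = (THE c. flow X c)"

lemma flow_unique: "flow X c \<Longrightarrow> flow X c' \<Longrightarrow> c = c'"
proof
  fix t assume c: "flow X c" "flow X c'"
  obtain d where d: "d 0 = mat 1" "\<And>t. (d has_vector_derivative - (X ** d t)) (at t)"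
    by (rule left_flow_exists[of X]) blast
  have "c t ** d t = mat 1" "c' t ** d t = mat 1" using flow_mult_left_flow c d by blast+
  then show "c t = c' t" by (metis matrix_left_right_inverse matrix_mul_assoc matrix_mul_rid matrix_mul_lid)
qed

lemma flow_mexp: "flow X (mexp X)"
proof -
  have "flow X (mexp X)" if "flow X c" for c
    unfolding mexp_def using that flow_unique by (metis theI)
  moreover obtain d where "flow (- (- X)) d" by (rule left_flow_exists[of "- X"]) blast
  ultimately show ?thesis by simp
qed

lemma mexp_eqI: "flow X c \<Longrightarrow> mexp X = c"
  using flow_mexp flow_unique by blast

lemma mexp_0 [simp]: "mexp X 0 = mat 1"
  using flow_mexp by (auto simp: flow_def)

lemma mexp_derivative: "(mexp X has_vector_derivative mexp X t ** X) (at t)"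
  using flow_mexp by (auto simp: flow_def)

lemma mexp_commute:
  assumes "X ** Y = Y ** X" shows "mexp X t ** Y = Y ** mexp X t"
proof -
  obtain d where "flow (- (- X)) d" "\<And>Y t. - X ** Y = Y ** - X \<Longrightarrow> d t ** Y = Y ** d t"
    by (rule left_flow_exists[of "- X"]) blast
  then show ?thesis using assms by (simp add: mexp_eqI mult_distribs)
qed

lemma invertible_mexp: "invertible (mexp X t)"
proof -
  obtain d where "d 0 = mat 1" "\<And>t. (d has_vector_derivative - (X ** d t)) (at t)"
    by (rule left_flow_exists[of X]) blast
  then show ?thesis using flow_mult_left_flow[OF flow_mexp] invertibleI by blast
qed

lemma mexp_conjugate:
  assumes "invertible g" shows "mexp (Ad g X) t = Ad g (mexp X t)"
proof -
  have "flow (Ad g X) (\<lambda>t. g ** (mexp X t ** matrix_inv g))"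
    unfolding flow_def
  proof (intro conjI allI)
    show "g ** (mexp X 0 ** matrix_inv g) = mat 1" using assms by (simp add: invertible_mult_inv)
    fix t
    have "((\<lambda>t. g ** (mexp X t ** matrix_inv g)) has_vector_derivative
        g ** (mexp X t ** X ** matrix_inv g)) (at t)"
      by (intro bounded_linear.has_vector_derivative[OF matmul.bounded_linear_right]
          bounded_linear.has_vector_derivative[OF matmul.bounded_linear_left] mexp_derivative)
    also have "g ** (mexp X t ** X ** matrix_inv g)
        = g ** (mexp X t ** matrix_inv g) ** Ad g X"
      using assms by (simp add: Ad_def mult_inv_cancel flip: matrix_mul_assoc)
    finally show "((\<lambda>t. g ** (mexp X t ** matrix_inv g)) has_vector_derivative
        g ** (mexp X t ** matrix_inv g) ** Ad g X) (at t)" .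
  qed
  from mexp_eqI[OF this] show ?thesis by (simp add: Ad_def matrix_mul_assoc)
qed

lemma matrix_inv_mexp: "matrix_inv (mexp X t) = mexp (- X) t"
proof (rule matrix_inv_unique)
  have "mexp (- X) t ** X = X ** mexp (- X) t" for t
    by (rule mexp_commute) (simp add: mult_distribs)
  then show "mexp X t ** mexp (- X) t = mat 1"
    using mexp_derivative[of "- X"] by (intro flow_mult_left_flow[OF flow_mexp]) (auto simp: mult_distribs)
qed

lemma Ad_mexp_derivative: "((\<lambda>t. Ad (mexp X t) Y) has_vector_derivative lie_bracket X Y) (at 0)"
proof -
  have "((\<lambda>t. mexp X t ** Y ** mexp (- X) t) has_vector_derivative
      (mexp X 0 ** Y) ** (mexp (-X) 0 ** - X) + (mexp X 0 ** X ** Y) ** mexp (-X) 0) (at 0)"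
    by (intro matmul.has_vector_derivative mexp_derivative
        bounded_linear.has_vector_derivative[OF matmul.bounded_linear_left])
  then show ?thesis by (simp add: Ad_def matrix_inv_mexp lie_bracket_def mult_distribs)
qed

lemma mexp_mconj: "mexp (mconj X) t = mconj (mexp X t)"
proof -
  have "flow (mconj X) (\<lambda>t. mconj (mexp X t))"
    unfolding flow_def
    using bounded_linear.has_vector_derivative[OF bounded_linear_mconj mexp_derivative[of X]]
    by auto
  from mexp_eqI[OF this] show ?thesis by simp
qed

lemma continuous_mexp: "continuous_on A (mexp X)"
  using mexp_derivative by (meson continuous_at_imp_continuous_on has_vector_derivative_continuous)

lemma C1_mexp: "mexp X C1_differentiable_on A"
  unfolding C1_differentiable_on_def
  using mexp_derivative
  by (intro exI[of _ "\<lambda>t. mexp X t ** X"]) (auto intro!: matmul.continuous_on continuous_intros continuous_mexp)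

section \<open>Zariski closed groups of matrices\<close>

lemma polynomial_functions_mono:
  assumes "p \<in> polynomial_functions K" "K \<subseteq> L" shows "p \<in> polynomial_functions L"
  using assms(1)
proof induction
  case (const c)
  then show ?case using assms(2) by (intro polynomial_functions.const) blast
next
  case (entry i j)
  show ?case by (rule polynomial_functions.entry)
next
  case (add p q)
  show ?case by (rule polynomial_functions.add[OF add.IH])
next
  case (mult p q)
  show ?case by (rule polynomial_functions.mult[OF mult.IH])
qed

lemma zariski_closed_mono: "zariski_closed K X \<Longrightarrow> K \<subseteq> L \<Longrightarrow> zariski_closed L X"
proof -
  assume KL: "K \<subseteq> L" and "zariski_closed K X"
  then obtain P where P: "P \<subseteq> polynomial_functions K" "X = {A. invertible A \<and> (\<forall>p\<in>P. p A = 0)}"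
    unfolding zariski_closed_def by blast
  have "P \<subseteq> polynomial_functions L" using P(1) polynomial_functions_mono[OF _ KL] by blast
  then show ?thesis unfolding zariski_closed_def using P(2) by blast
qed

lemma polynomial_functions_sum:
  "(\<And>i. i \<in> I \<Longrightarrow> f i \<in> polynomial_functions UNIV) \<Longrightarrow>
    (\<lambda>A. \<Sum>i\<in>I. f i A) \<in> polynomial_functions UNIV"
proof (induction I rule: infinite_finite_induct)
  case (insert x F)
  then have "(\<lambda>A. f x A + (\<Sum>i\<in>F. f i A)) \<in> polynomial_functions UNIV"
    by (intro polynomial_functions.add) simp_all
  then show ?case using insert by simp
qed (simp_all add: polynomial_functions.const)

lemma polynomial_functions_substitute:
  assumes "p \<in> polynomial_functions UNIV" "\<And>i j. (\<lambda>A. f A $ i $ j) \<in> polynomial_functions UNIV"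
  shows "(\<lambda>A. p (f A)) \<in> polynomial_functions UNIV"
  using assms(1)
proof induction
  case (add p q)
  show ?case by (rule polynomial_functions.add[OF add.IH])
next
  case (mult p q)
  show ?case by (rule polynomial_functions.mult[OF mult.IH])
qed (auto intro: polynomial_functions.const assms(2))

lemma polynomial_functions_translate:
  assumes "p \<in> polynomial_functions UNIV"
  shows "(\<lambda>A. p (B ** A ** C)) \<in> polynomial_functions UNIV"
  using assms
  by (rule polynomial_functions_substitute)
     (simp add: matrix_matrix_mult_def polynomial_functions_sum polynomial_functions.intros)

lemma continuous_polynomial_function:
  assumes "p \<in> polynomial_functions K" shows "continuous_on S p"
  using assms by induction (auto intro!: continuous_intros)

definition vanishing :: "('n::finite) cmat set \<Rightarrow> ('n cmat \<Rightarrow> complex) set" where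
  "vanishing X = {p \<in> polynomial_functions UNIV. \<forall>A\<in>X. p A = 0}"

lemma zariski_closed_iff:
  "zariski_closed UNIV X \<longleftrightarrow> X = {A. invertible A \<and> (\<forall>p\<in>vanishing X. p A = 0)}"
proof
  assume "zariski_closed UNIV X"
  then obtain P where P: "P \<subseteq> polynomial_functions UNIV" "X = {A. invertible A \<and> (\<forall>p\<in>P. p A = 0)}"
    unfolding zariski_closed_def by blast
  then have "P \<subseteq> vanishing X" by (auto simp: vanishing_def)
  then show "X = {A. invertible A \<and> (\<forall>p\<in>vanishing X. p A = 0)}"
    using P by (auto simp: vanishing_def)
next
  assume X: "X = {A. invertible A \<and> (\<forall>p\<in>vanishing X. p A = 0)}"
  have "vanishing X \<subseteq> polynomial_functions UNIV" by (auto simp: vanishing_def)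
  with X show "zariski_closed UNIV X" unfolding zariski_closed_def by blast
qed

lemma zariski_closed_invertible: "zariski_closed K X \<Longrightarrow> A \<in> X \<Longrightarrow> invertible A"
  by (auto simp: zariski_closed_def)

lemma zariski_closedI:
  assumes "\<And>A. A \<in> X \<Longrightarrow> invertible A"
    and "\<And>A. invertible A \<Longrightarrow> (\<And>p. p \<in> vanishing X \<Longrightarrow> p A = 0) \<Longrightarrow> A \<in> X"
  shows "zariski_closed UNIV X"
proof -
  have "X = {A. invertible A \<and> (\<forall>p\<in>vanishing X. p A = 0)}"
  proof (intro Set.set_eqI iffI)
    fix A assume "A \<in> X"
    then show "A \<in> {A. invertible A \<and> (\<forall>p\<in>vanishing X. p A = 0)}"
      using assms(1) by (auto simp: vanishing_def)
  qed (use assms(2) in auto)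
  then show ?thesis by (simp only: zariski_closed_iff)
qed

lemma zariski_closedD:
  assumes "zariski_closed UNIV X" "invertible A" "\<And>p. p \<in> vanishing X \<Longrightarrow> p A = 0"
  shows "A \<in> X"
  using assms zariski_closed_iff[of X] by blast

lemma zariski_closed_Inter:
  assumes "\<And>X. X \<in> F \<Longrightarrow> zariski_closed UNIV X" "F \<noteq> {}"
  shows "zariski_closed UNIV (\<Inter>F)"
proof (rule zariski_closedI)
  show "invertible A" if "A \<in> \<Inter>F" for A using that assms zariski_closed_invertible by fast
  fix A :: "'a cmat" assume A: "invertible A" "\<And>p. p \<in> vanishing (\<Inter>F) \<Longrightarrow> p A = 0"
  show "A \<in> \<Inter>F"
  proof
    fix X assume "X \<in> F"
    then have "vanishing X \<subseteq> vanishing (\<Inter>F)" by (auto simp: vanishing_def)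
    then show "A \<in> X" using zariski_closedD[OF assms(1)[OF \<open>X \<in> F\<close>] A(1)] A(2) by blast
  qed
qed

lemma zariski_closed_Int:
  "zariski_closed UNIV X \<Longrightarrow> zariski_closed UNIV Y \<Longrightarrow> zariski_closed UNIV (X \<inter> Y)"
  using zariski_closed_Inter[of "{X, Y}"] by auto

lemma zariski_closed_translate:
  assumes "zariski_closed UNIV X" "invertible (B :: ('n::finite) cmat)" "invertible (C :: 'n cmat)"
  shows "zariski_closed UNIV {A. B ** A ** C \<in> X}"
proof -
  obtain P where P: "P \<subseteq> polynomial_functions UNIV" "X = {A. invertible A \<and> (\<forall>p\<in>P. p A = 0)}"
    using assms unfolding zariski_closed_def by blast
  have "invertible A" if "invertible (B ** A ** C)" for A
  proof -
    have "A = matrix_inv B ** (B ** A ** C) ** matrix_inv C"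
      using assms by (simp add: mult_inv_cancel invertible_mult_inv flip: matrix_mul_assoc)
    then show ?thesis using that assms invertible_matrix_inv invertible_mult by metis
  qed
  then have "invertible (B ** A ** C) \<longleftrightarrow> invertible A" for A
    using assms invertible_mult by metis
  then have "{A. B ** A ** C \<in> X} = {A. invertible A \<and> (\<forall>p\<in>(\<lambda>p A. p (B ** A ** C)) ` P. p A = 0)}"
    unfolding P by auto
  moreover have "(\<lambda>p A. p (B ** A ** C)) ` P \<subseteq> polynomial_functions UNIV"
    using P polynomial_functions_translate by blast
  ultimately show ?thesis unfolding zariski_closed_def by blast
qed

text \<open>
  The same notion as \<open>algebraic_group UNIV\<close>, expressed by the matrix inverse instead of the
  inverse in \<open>mat_group\<close>.
\<close>

definition zgroup :: "('n::finite) cmat set \<Rightarrow> bool" where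
  "zgroup G \<longleftrightarrow> zariski_closed UNIV G \<and> mat 1 \<in> G \<and> (\<forall>A\<in>G. \<forall>B\<in>G. A ** B \<in> G) \<and>
    (\<forall>A\<in>G. matrix_inv A \<in> G)"

lemma zgroupD:
  assumes "zgroup G"
  shows "zariski_closed UNIV G" "mat 1 \<in> G" "A \<in> G \<Longrightarrow> B \<in> G \<Longrightarrow> A ** B \<in> G"
    "A \<in> G \<Longrightarrow> matrix_inv A \<in> G" "A \<in> G \<Longrightarrow> invertible A"
    "A \<in> G \<Longrightarrow> B \<in> G \<Longrightarrow> Ad A B \<in> G"
  using assms zariski_closed_invertible by (auto simp: zgroup_def Ad_def)

lemma algebraic_group_imp_zgroup:
  assumes "algebraic_group K G" shows "zgroup G"
proof -
  have z: "zariski_closed UNIV G" using assms zariski_closed_mono by (auto simp: algebraic_group_def)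
  interpret group "mat_group G" using assms by (simp add: algebraic_group_def)
  have "matrix_inv A \<in> G" if A: "A \<in> G" for A
  proof -
    obtain B where B: "B \<in> G" "A ** B = mat 1"
      using r_inv_ex[of A] A by (auto simp: mat_group_def)
    then show ?thesis using matrix_inv_unique by metis
  qed
  then show ?thesis using z one_closed m_closed by (auto simp: zgroup_def mat_group_def)
qed

lemma zgroup_imp_group:
  assumes "zgroup G" shows "group (mat_group G)"
proof (rule groupI)
  show "\<exists>y\<in>carrier (mat_group G). y \<otimes>\<^bsub>mat_group G\<^esub> x = \<one>\<^bsub>mat_group G\<^esub>"
    if "x \<in> carrier (mat_group G)" for x
    using that zgroupD[OF assms]
    by (auto simp: mat_group_def intro!: bexI[of _ "matrix_inv x"] invertible_mult_inv)
qed (use zgroupD[OF assms] in \<open>auto simp: mat_group_def matrix_mul_assoc\<close>)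

lemma zgroup_imp_algebraic_group: "zgroup G \<Longrightarrow> algebraic_group UNIV G"
  by (simp add: algebraic_group_def zgroupD zgroup_imp_group)

lemma zgroup_Inter:
  "(\<And>X. X \<in> F \<Longrightarrow> zgroup X) \<Longrightarrow> F \<noteq> {} \<Longrightarrow> zgroup (\<Inter>F)"
  unfolding zgroup_def by (auto intro!: zariski_closed_Inter)

lemma zgroup_Ad_vimage:
  assumes "zgroup X" "invertible g" shows "zgroup {A. Ad g A \<in> X}"
proof -
  have inv: "invertible A" if "Ad g A \<in> X" for A
    using zariski_closed_translate[OF zgroupD(1)[OF assms(1)] assms(2) invertible_matrix_inv[OF assms(2)]]
      that zariski_closed_invertible by (fastforce simp: Ad_def)
  have "Ad g (matrix_inv A) = matrix_inv (Ad g A)" if "invertible A" for A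
    by (rule matrix_inv_unique[symmetric])
       (simp add: that assms(2) invertible_mult_inv Ad_one flip: Ad_mult)
  then show ?thesis
    using zariski_closed_translate[OF zgroupD(1)[OF assms(1)] assms(2) invertible_matrix_inv[OF assms(2)]]
      zgroupD[OF assms(1)] inv
    unfolding zgroup_def by (auto simp: Ad_mult Ad_one assms(2)) (auto simp: Ad_def)
qed

lemma zgroup_centralizer: "zgroup {A. invertible A \<and> (\<forall>B\<in>X. A ** B = B ** A)}" (is "zgroup ?C")
  unfolding zgroup_def
proof (intro conjI ballI)
  define P where "P = (\<lambda>(B, i, j) A. (A ** B) $ i $ j + (- 1) * (B ** A) $ i $ j) ` (X \<times> UNIV)"
  have "(\<lambda>A. (A ** B) $ i $ j + (- 1) * (B ** A) $ i $ j) \<in> polynomial_functions UNIV" for B i j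
    unfolding matrix_matrix_mult_def vec_lambda_beta
    by (intro polynomial_functions.intros polynomial_functions_sum UNIV_I)
  then have "P \<subseteq> polynomial_functions UNIV" by (auto simp: P_def)
  moreover have "?C = {A. invertible A \<and> (\<forall>p\<in>P. p A = 0)}"
    by (auto simp: P_def vec_eq_iff)
  ultimately show "zariski_closed UNIV ?C" unfolding zariski_closed_def by blast
  show "mat 1 \<in> ?C" by (auto intro: invertibleI[of _ "mat 1"])
  show "A ** B \<in> ?C" if "A \<in> ?C" "B \<in> ?C" for A B
  proof -
    have "A ** B ** W = W ** (A ** B)" if "W \<in> X" for W
    proof -
      have "A ** (B ** W) = (A ** W) ** B" using \<open>B \<in> ?C\<close> that by (simp add: matrix_mul_assoc)
      also have "A ** W = W ** A" using \<open>A \<in> ?C\<close> that by simp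
      finally show ?thesis by (simp add: matrix_mul_assoc)
    qed
    then show ?thesis using that invertible_mult by blast
  qed
  show "matrix_inv A \<in> ?C" if "A \<in> ?C" for A
  proof -
    have "matrix_inv A ** B = matrix_inv A ** (B ** A) ** matrix_inv A" if "B \<in> X" for B
      using \<open>A \<in> ?C\<close> by (simp add: invertible_mult_inv flip: matrix_mul_assoc)
    also have "\<dots> B = B ** matrix_inv A" if "B \<in> X" for B
    proof -
      have "B ** A = A ** B" using that \<open>A \<in> ?C\<close> by auto
      then show ?thesis using \<open>A \<in> ?C\<close> by (simp add: mult_inv_cancel)
    qed
    finally show ?thesis using that by (auto simp: invertible_matrix_inv)
  qed
qed

definition zariski_generated :: "('n::finite) cmat set \<Rightarrow> 'n cmat set" where
  "zariski_generated R = \<Inter>{T. zgroup T \<and> R \<subseteq> T}"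

lemma zgroup_GL: "zgroup {A :: ('n::finite) cmat. invertible A}"
  using zgroup_centralizer[of "{}"] by simp

lemma zgroup_zariski_generated:
  assumes "\<And>A. A \<in> R \<Longrightarrow> invertible A" shows "zgroup (zariski_generated R)"
  unfolding zariski_generated_def using zgroup_GL assms by (intro zgroup_Inter) auto

lemma zariski_generated_superset: "R \<subseteq> zariski_generated R"
  by (auto simp: zariski_generated_def)

lemma zariski_generated_least: "zgroup T \<Longrightarrow> R \<subseteq> T \<Longrightarrow> zariski_generated R \<subseteq> T"
  by (auto simp: zariski_generated_def)

text \<open>
  Connectedness seen from the identity. Unlike \<open>zariski_connected\<close>, it applies to sets that are
  not closed and passes to unions, so it can be checked on generators.
\<close>

definition connected_to_one :: "('n::finite) cmat set \<Rightarrow> bool" where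
  "connected_to_one R \<longleftrightarrow> (\<forall>Y Z. zariski_closed UNIV Y \<longrightarrow> zariski_closed UNIV Z \<longrightarrow>
    Y \<inter> Z = {} \<longrightarrow> R \<subseteq> Y \<union> Z \<longrightarrow> mat 1 \<in> Y \<longrightarrow> R \<subseteq> Y)"

lemma connected_to_one_Union:
  "(\<And>X. X \<in> F \<Longrightarrow> connected_to_one X) \<Longrightarrow> connected_to_one (\<Union>F)"
proof -
  assume F: "\<And>X. X \<in> F \<Longrightarrow> connected_to_one X"
  show ?thesis unfolding connected_to_one_def
  proof (intro allI impI Union_least)
    fix Y Z X assume "zariski_closed UNIV Y" "zariski_closed UNIV Z" "Y \<inter> Z = {}" "\<Union>F \<subseteq> Y \<union> Z"
      "mat 1 \<in> Y" "X \<in> F"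
    then show "X \<subseteq> Y" using F[OF \<open>X \<in> F\<close>] unfolding connected_to_one_def by (meson Sup_upper subset_trans)
  qed
qed

lemma connected_to_one_zariski_connected:
  assumes "zariski_closed UNIV X" "zariski_connected X" "mat 1 \<in> X" shows "connected_to_one X"
  unfolding connected_to_one_def
proof (intro allI impI)
  fix Y Z assume YZ: "zariski_closed UNIV Y" "zariski_closed UNIV Z" "Y \<inter> Z = {}" "X \<subseteq> Y \<union> Z" "mat 1 \<in> Y"
  have "Z \<inter> X = {}"
  proof (rule ccontr)
    assume "Z \<inter> X \<noteq> {}"
    moreover have "zariski_closed UNIV (Y \<inter> X)" "zariski_closed UNIV (Z \<inter> X)"
      using YZ assms zariski_closed_Int by blast+
    moreover have "Y \<inter> X \<noteq> {}" "(Y \<inter> X) \<inter> (Z \<inter> X) = {}" "(Y \<inter> X) \<union> (Z \<inter> X) = X"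
      using YZ assms by auto
    ultimately show False using assms(2) unfolding zariski_connected_def by blast
  qed
  then show "X \<subseteq> Y" using YZ by blast
qed

lemma zariski_closed_imp_closedin:
  assumes "zariski_closed UNIV X"
  obtains C where "closed C" "X = {A. invertible A} \<inter> C"
proof -
  obtain P where P: "P \<subseteq> polynomial_functions UNIV" "X = {A. invertible A \<and> (\<forall>p\<in>P. p A = 0)}"
    using assms unfolding zariski_closed_def by blast
  have "closed (p -` {0})" if "p \<in> P" for p
    using P(1) that continuous_polynomial_function[of p UNIV UNIV]
    by (intro continuous_closed_vimage) (auto simp: continuous_on_eq_continuous_at)
  then have "closed (\<Inter>p\<in>P. p -` {0})" by blast
  moreover have "X = {A. invertible A} \<inter> (\<Inter>p\<in>P. p -` {0})" unfolding P(2) by auto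
  ultimately show ?thesis by (rule that)
qed

text \<open>
  Zariski closed sets of invertible matrices are closed among these in the usual topology.
\<close>

lemma connected_to_one_connected:
  assumes "connected R" "mat 1 \<in> R" "\<And>A. A \<in> R \<Longrightarrow> invertible A" shows "connected_to_one R"
  unfolding connected_to_one_def
proof (intro allI impI)
  fix Y Z assume YZ: "zariski_closed UNIV Y" "zariski_closed UNIV Z" "Y \<inter> Z = {}" "R \<subseteq> Y \<union> Z" "mat 1 \<in> Y"
  obtain C where C: "closed C" "Y = {A. invertible A} \<inter> C"
    using zariski_closed_imp_closedin YZ(1) by blast
  obtain D where D: "closed D" "Z = {A. invertible A} \<inter> D"
    using zariski_closed_imp_closedin YZ(2) by blast
  have "C \<inter> R = {} \<or> D \<inter> R = {}"
  proof (rule ccontr)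
    assume ne: "\<not> (C \<inter> R = {} \<or> D \<inter> R = {})"
    have "R \<subseteq> C \<union> D" using YZ(4) C(2) D(2) by blast
    moreover have "C \<inter> D \<inter> R = {}" using YZ(3) C(2) D(2) assms(3) by blast
    ultimately show False using assms(1) C(1) D(1) ne unfolding connected_closed by blast
  qed
  then show "R \<subseteq> Y" using YZ C D assms by blast
qed

text \<open>
  The intersection of the clopen neighbourhoods of the identity is a closed subgroup: if \<open>Y\<close> is
  one and \<open>y\<close> lies in all of them, then so is the translate of \<open>Y\<close> by the inverse of \<open>y\<close>, which
  contains the identity. Since it contains \<open>R\<close>, minimality makes it the whole group, which is
  therefore connected.
\<close>

lemma zariski_generated_connected:
  assumes R: "\<And>A. A \<in> R \<Longrightarrow> invertible A" and c: "connected_to_one R"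
  shows "zariski_connected (zariski_generated R)"
proof -
  define T where "T = zariski_generated R"
  define F where "F = {Y. zariski_closed UNIV Y \<and> zariski_closed UNIV (T - Y) \<and> Y \<subseteq> T \<and> mat 1 \<in> Y}"
  have T: "zgroup T" unfolding T_def by (rule zgroup_zariski_generated) (rule R)
  have empty: "zariski_closed UNIV ({} :: 'a cmat set)"
  proof -
    have "{} = {A :: 'a cmat. invertible A \<and> (\<forall>p\<in>{\<lambda>A. 1}. p A = (0 :: complex))}" by simp
    moreover have "{\<lambda>A :: 'a cmat. 1 :: complex} \<subseteq> polynomial_functions UNIV"
      using polynomial_functions.const[of 1 UNIV] by simp
    ultimately show ?thesis unfolding zariski_closed_def by blast
  qed
  have TF: "T \<in> F" using T empty by (simp add: F_def zgroupD)
  have left: "{A. y ** A \<in> Y} \<in> F" if "Y \<in> F" "y \<in> Y" for y Y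
  proof -
    have y: "y \<in> T" "invertible y" using that zgroupD(5)[OF T] by (auto simp: F_def)
    have tr: "zariski_closed UNIV {A. y ** A \<in> W}" if "zariski_closed UNIV W" for W
      using zariski_closed_translate[OF that y(2) invertibleI[of "mat 1" "mat 1"]] by simp
    have inT: "y ** A \<in> T \<longleftrightarrow> A \<in> T" for A
      using y T by (metis mult_inv_cancel(1) zgroupD(3) zgroupD(4))
    have "T - {A. y ** A \<in> Y} = {A. y ** A \<in> T - Y}" using inT by auto
    then have "zariski_closed UNIV (T - {A. y ** A \<in> Y})"
      using that tr[of "T - Y"] by (simp add: F_def)
    moreover have "zariski_closed UNIV {A. y ** A \<in> Y}" using that tr by (simp add: F_def)
    moreover have "{A. y ** A \<in> Y} \<subseteq> T" using that inT by (auto simp: F_def)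
    ultimately show ?thesis using that by (simp add: F_def)
  qed
  have right: "{A. matrix_inv y ** A \<in> T - Y} \<in> F" if "Y \<in> F" "y \<in> T" "matrix_inv y \<notin> Y" for y Y
  proof -
    have y: "invertible (matrix_inv y)" "matrix_inv y \<in> T"
      using that T zgroupD invertible_matrix_inv by blast+
    have tr: "zariski_closed UNIV {A. matrix_inv y ** A \<in> W}" if "zariski_closed UNIV W" for W
      using zariski_closed_translate[OF that y(1) invertibleI[of "mat 1" "mat 1"]] by simp
    have inT: "matrix_inv y ** A \<in> T \<longleftrightarrow> A \<in> T" for A
      using y T by (metis mult_inv_cancel(1) zgroupD(3) zgroupD(4))
    have "T - {A. matrix_inv y ** A \<in> T - Y} = {A. matrix_inv y ** A \<in> Y}"
      using inT that by (auto simp: F_def)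
    then have "zariski_closed UNIV (T - {A. matrix_inv y ** A \<in> T - Y})"
      using that tr[of Y] by (simp add: F_def)
    moreover have "zariski_closed UNIV {A. matrix_inv y ** A \<in> T - Y}"
      using that tr[of "T - Y"] by (simp add: F_def)
    moreover have "{A. matrix_inv y ** A \<in> T - Y} \<subseteq> T" using inT by auto
    ultimately show ?thesis using that y by (simp add: F_def)
  qed
  have Q: "zgroup (\<Inter>F)"
    unfolding zgroup_def
  proof (intro conjI ballI)
    show "zariski_closed UNIV (\<Inter>F)" using TF by (intro zariski_closed_Inter) (auto simp: F_def)
    show "mat 1 \<in> \<Inter>F" by (simp add: F_def)
    show "A ** B \<in> \<Inter>F" if "A \<in> \<Inter>F" "B \<in> \<Inter>F" for A B
      using that left by blast
    show "matrix_inv A \<in> \<Inter>F" if "A \<in> \<Inter>F" for A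
    proof (rule ccontr)
      assume "matrix_inv A \<notin> \<Inter>F"
      then obtain Y where Y: "Y \<in> F" "matrix_inv A \<notin> Y" by blast
      have "A \<in> T" using that TF by blast
      then have "A \<in> {B. matrix_inv A ** B \<in> T - Y}" using right Y that by blast
      then have "mat 1 \<notin> Y" using \<open>A \<in> T\<close> T by (simp add: zgroupD invertible_mult_inv)
      then show False using Y by (simp add: F_def)
    qed
  qed
  have "R \<subseteq> Y" if "Y \<in> F" for Y
    using c that zariski_generated_superset[of R] unfolding connected_to_one_def F_def T_def
    by (auto 0 0) (metis Diff_disjoint Diff_partition subsetD)
  then have "T \<subseteq> \<Inter>F" unfolding T_def by (intro zariski_generated_least) (use Q in auto)
  then have min: "T \<subseteq> Y" if "Y \<in> F" for Y using that by blast
  show ?thesis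
    unfolding zariski_connected_def T_def[symmetric]
  proof (intro conjI notI)
    assume "T = {}" then show False using T zgroupD(2) by blast
  next
    assume "\<exists>Y Z. zariski_closed UNIV Y \<and> zariski_closed UNIV Z \<and>
           Y \<noteq> {} \<and> Z \<noteq> {} \<and> Y \<inter> Z = {} \<and> Y \<union> Z = T"
    then obtain Y Z where YZ: "zariski_closed UNIV Y" "zariski_closed UNIV Z"
      "Y \<noteq> {}" "Z \<noteq> {}" "Y \<inter> Z = {}" "Y \<union> Z = T" by blast
    then have "T - Y = Z" "T - Z = Y" by auto
    moreover have "mat 1 \<in> Y \<or> mat 1 \<in> Z" using YZ T zgroupD(2) by blast
    ultimately have "Y \<in> F \<or> Z \<in> F" using YZ by (auto simp: F_def)
    then show False using min YZ by blast
  qed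
qed

text \<open>
  Centralizers are Zariski closed groups. Hence the generated group centralizes \<open>R\<close>, and then,
  by the same argument, itself.
\<close>

lemma zariski_generated_commute:
  assumes "\<And>A. A \<in> R \<Longrightarrow> invertible A" "\<And>A B. A \<in> R \<Longrightarrow> B \<in> R \<Longrightarrow> A ** B = B ** A"
    and "A \<in> zariski_generated R" "B \<in> zariski_generated R"
  shows "A ** B = B ** A"
proof -
  have 1: "zariski_generated R \<subseteq> {A. invertible A \<and> (\<forall>B\<in>R. A ** B = B ** A)}"
    using assms by (intro zariski_generated_least zgroup_centralizer) auto
  have "zariski_generated R \<subseteq> {A. invertible A \<and> (\<forall>B\<in>zariski_generated R. A ** B = B ** A)}"
    using assms(1) 1 by (intro zariski_generated_least zgroup_centralizer) fastforce
  then show ?thesis using assms by blast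
qed

section \<open>The Lie algebra of a Zariski closed group\<close>

text \<open>
  \<open>f'\<close> is the image of \<open>f\<close> under the left invariant vector field of \<open>X\<close>. It is the same
  polynomial function for all curves.
\<close>

lemma polynomial_derivation:
  assumes "f \<in> polynomial_functions UNIV"
  shows "\<exists>f'\<in>polynomial_functions UNIV. \<forall>c t. (c has_vector_derivative c t ** X) (at t) \<longrightarrow>
    ((\<lambda>t. f (c t)) has_vector_derivative f' (c t)) (at t)"
  using assms
proof induction
  case (const a)
  show ?case by (rule bexI[of _ "\<lambda>_. 0"]) (simp_all add: polynomial_functions.const)
next
  case (entry i j)
  have "(\<lambda>A. (A ** X) $ i $ j) \<in> polynomial_functions UNIV"
    unfolding matrix_matrix_mult_def vec_lambda_beta
    by (intro polynomial_functions.intros polynomial_functions_sum UNIV_I)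
  moreover have "bounded_linear (\<lambda>A :: 'a cmat. A $ i $ j)"
    by (intro bounded_linear_compose[OF bounded_linear_vec_nth] bounded_linear_vec_nth)
  ultimately show ?case
    by (intro bexI[of _ "\<lambda>A. (A ** X) $ i $ j"] allI impI) (rule bounded_linear.has_vector_derivative)
next
  case (add p q)
  then obtain p' q' where
    "p' \<in> polynomial_functions UNIV" "q' \<in> polynomial_functions UNIV"
    "\<forall>c t. (c has_vector_derivative c t ** X) (at t) \<longrightarrow> ((\<lambda>t. p (c t)) has_vector_derivative p' (c t)) (at t)"
    "\<forall>c t. (c has_vector_derivative c t ** X) (at t) \<longrightarrow> ((\<lambda>t. q (c t)) has_vector_derivative q' (c t)) (at t)"
    by blast
  then show ?case
    by (intro bexI[of _ "\<lambda>A. p' A + q' A"])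
       (simp_all add: has_vector_derivative_add polynomial_functions.add)
next
  case (mult p q)
  then obtain p' q' where
    "p' \<in> polynomial_functions UNIV" "q' \<in> polynomial_functions UNIV"
    "\<forall>c t. (c has_vector_derivative c t ** X) (at t) \<longrightarrow> ((\<lambda>t. p (c t)) has_vector_derivative p' (c t)) (at t)"
    "\<forall>c t. (c has_vector_derivative c t ** X) (at t) \<longrightarrow> ((\<lambda>t. q (c t)) has_vector_derivative q' (c t)) (at t)"
    by blast
  then show ?case
    using mult.hyps
    by (intro bexI[of _ "\<lambda>A. p A * q' A + p' A * q A"])
       (auto intro!: has_vector_derivative_mult polynomial_functions.add polynomial_functions.mult)
qed

lemma lie_algebraI:
  assumes "c 0 = mat 1" "\<And>t. c t \<in> G" "c C1_differentiable_on UNIV"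
    "(c has_vector_derivative X) (at 0)"
  shows "X \<in> lie_algebra G"
  unfolding lie_algebra_def
  by (rule CollectI, rule exI[of _ c], rule exI[of _ 1])
     (use assms in \<open>auto intro: C1_differentiable_on_subset\<close>)

lemma lie_algebra_flow:
  assumes "flow X c" "\<And>t. c t \<in> G" shows "X \<in> lie_algebra G"
proof -
  have "c = mexp X" using assms(1) by (simp add: mexp_eqI)
  then show ?thesis
    using assms mexp_derivative[of X 0] by (intro lie_algebraI[of c]) (auto simp: C1_mexp)
qed

text \<open>
  The left invariant vector field of \<open>X\<close> preserves the ideal of \<open>G\<close>: its value on an equation at
  a point \<open>A\<close> is the derivative of the equation along a curve through \<open>A\<close> that is the translate
  of a curve in \<open>G\<close>.
\<close>

lemma vanishing_derivation:
  assumes "zgroup G" "X \<in> lie_algebra G"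
  obtains D where "\<And>f. f \<in> vanishing G \<Longrightarrow> D f \<in> vanishing G"
    "\<And>f t. f \<in> vanishing G \<Longrightarrow> ((\<lambda>t. f (mexp X t)) has_vector_derivative D f (mexp X t)) (at t)"
proof -
  obtain \<gamma> \<epsilon> where g: "\<epsilon> > 0" "\<gamma> 0 = mat 1" "\<And>t. t \<in> {-\<epsilon><..<\<epsilon>} \<Longrightarrow> \<gamma> t \<in> G"
    "(\<gamma> has_vector_derivative X) (at 0)"
    using assms(2) unfolding lie_algebra_def by blast
  have "\<exists>f'\<in>vanishing G. \<forall>t. ((\<lambda>t. f (mexp X t)) has_vector_derivative f' (mexp X t)) (at t)"
    if f: "f \<in> vanishing G" for f
  proof -
    obtain f' where f': "f' \<in> polynomial_functions UNIV"
      "\<And>c t. (c has_vector_derivative c t ** X) (at t) \<Longrightarrow>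
        ((\<lambda>t. f (c t)) has_vector_derivative f' (c t)) (at t)"
      using polynomial_derivation[of f X] f by (auto simp: vanishing_def)
    have "f' A = 0" if A: "A \<in> G" for A
    proof -
      have "((\<lambda>t. A ** \<gamma> t) has_vector_derivative A ** \<gamma> 0 ** X) (at 0)"
        using bounded_linear.has_vector_derivative[OF matmul.bounded_linear_right g(4)] g(2) by simp
      from f'(2)[OF this] have 1: "((\<lambda>t. f (A ** \<gamma> t)) has_vector_derivative f' A) (at 0)"
        using g(2) by simp
      have "((\<lambda>t. f (A ** \<gamma> t)) has_vector_derivative 0) (at 0)"
        by (rule has_vector_derivative_transform_within_open[of "\<lambda>_. 0" _ _ "{-\<epsilon><..<\<epsilon>}"])
           (use g f A zgroupD(3)[OF assms(1)] in \<open>auto simp: vanishing_def\<close>)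
      then show ?thesis using 1 vector_derivative_unique_at by blast
    qed
    then have "f' \<in> vanishing G" using f'(1) by (simp add: vanishing_def)
    moreover have "((\<lambda>t. f (mexp X t)) has_vector_derivative f' (mexp X t)) (at t)" for t
      by (rule f'(2)[OF mexp_derivative])
    ultimately show ?thesis by blast
  qed
  then have "\<exists>D. \<forall>f\<in>vanishing G. D f \<in> vanishing G \<and>
    (\<forall>t. ((\<lambda>t. f (mexp X t)) has_vector_derivative D f (mexp X t)) (at t))"
    by (intro bchoice) blast
  then show ?thesis using that by blast
qed

text \<open>
  Along the one-parameter group of \<open>S + N\<close> every equation of \<open>G\<close> is an exponential polynomial, and
  it is flat at the origin because its derivatives are again equations of \<open>G\<close>. Hence it is formally
  zero and remains so when \<open>S\<close> and \<open>N\<close> are given independent complex times. For a group that is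
  closed but not algebraic this fails.
\<close>

lemma lie_algebra_spectral_flow:
  assumes G: "zgroup G" "S + N \<in> lie_algebra G"
    and fl: "\<And>z w. flow (cscale z S + cscale w N) (\<lambda>t. \<Psi> (of_real t * z) (of_real t * w))"
    and ep: "\<And>i j. exp_poly (\<lambda>z w. \<Psi> z w $ i $ j)"
  shows "\<Psi> z w \<in> G"
proof -
  let ?X = "S + N"
  have "mexp (cscale z S + cscale w N) 1 = \<Psi> z w" using mexp_eqI[OF fl[of z w]] by simp
  then have inv: "invertible (\<Psi> z w)" using invertible_mexp by metis
  have m: "mexp ?X t = \<Psi> (of_real t) (of_real t)" for t using mexp_eqI[OF fl[of 1 1]] by simp
  obtain D where D: "\<And>f. f \<in> vanishing G \<Longrightarrow> D f \<in> vanishing G"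
    "\<And>f t. f \<in> vanishing G \<Longrightarrow> ((\<lambda>t. f (mexp ?X t)) has_vector_derivative D f (mexp ?X t)) (at t)"
    using vanishing_derivation[OF G] by blast
  have "f (\<Psi> z w) = 0" if f: "f \<in> vanishing G" for f
  proof -
    have "f \<in> polynomial_functions UNIV" using f by (simp add: vanishing_def)
    then have "exp_poly (\<lambda>z w. f (\<Psi> z w))"
    proof induction
      case (add p q)
      show ?case by (rule exp_poly_add[OF add.IH])
    next
      case (mult p q)
      show ?case by (rule exp_poly_mult[OF mult.IH])
    qed (rule exp_poly_const ep)+
    then obtain M c where fin: "finite M"
      and eq: "(\<lambda>z w. f (\<Psi> z w)) = (\<lambda>z w. \<Sum>\<mu>\<in>M. exp (z * \<mu>) * poly (c \<mu>) w)"
      unfolding exp_poly_def by blast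
    have M: "finite M" "f (\<Psi> z w) = (\<Sum>\<mu>\<in>M. exp (z * \<mu>) * poly (c \<mu>) w)" for z w
      using fin fun_cong[OF fun_cong[OF eq, of z], of w] by simp_all
    define M0 where "M0 = {\<mu>\<in>M. c \<mu> \<noteq> 0}"
    have M0: "f (\<Psi> z w) = (\<Sum>\<mu>\<in>M0. exp (z * \<mu>) * poly (c \<mu>) w)" for z w
      unfolding M(2) M0_def using M(1) by (intro sum.mono_neutral_right) auto
    have Dk: "(D ^^ k) f \<in> vanishing G" for k by (induction k) (auto intro: f D)
    have "M0 = {}"
    proof (rule flat_exp_poly[where c = c and \<phi> = "\<lambda>k t. (D ^^ k) f (mexp ?X t)"])
      show "finite M0" "\<And>\<mu>. \<mu> \<in> M0 \<Longrightarrow> c \<mu> \<noteq> 0" using M(1) by (auto simp: M0_def)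
      show "((\<lambda>t. (D ^^ k) f (mexp ?X t)) has_vector_derivative (D ^^ Suc k) f (mexp ?X t)) (at t)"
        for k t using D(2)[OF Dk] by simp
      show "(D ^^ k) f (mexp ?X 0) = 0" for k
        using Dk[of k] zgroupD(2)[OF G(1)] by (simp add: vanishing_def)
      show "(D ^^ 0) f (mexp ?X t) = (\<Sum>\<mu>\<in>M0. exp (of_real t * \<mu>) * poly (c \<mu>) (of_real t))" for t
        by (simp add: m M0)
    qed
    then show ?thesis using M0 by simp
  qed
  then show ?thesis using zariski_closedD[OF zgroupD(1)[OF G(1)] inv] by blast
qed

lemma lie_algebra_mexp:
  assumes "zgroup G" "X \<in> lie_algebra G" shows "mexp X t \<in> G"
proof -
  obtain S N \<Psi> where XSN: "X = S + N"
    and fl: "\<And>z w. flow (cscale z S + cscale w N) (\<lambda>t. \<Psi> (of_real t * z) (of_real t * w))"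
    and ep: "\<And>i j. exp_poly (\<lambda>z w. \<Psi> z w $ i $ j)"
    by (rule spectral_flow[of X]) blast
  have "mexp X t = \<Psi> (of_real t) (of_real t)" using mexp_eqI[OF fl[of 1 1]] XSN by simp
  then show ?thesis using lie_algebra_spectral_flow[OF assms(1) assms(2)[unfolded XSN] fl ep] by simp
qed

lemma lie_algebra_cscale:
  assumes "zgroup G" "X \<in> lie_algebra G" shows "cscale a X \<in> lie_algebra G"
proof -
  obtain S N \<Psi> where XSN: "X = S + N"
    and fl: "\<And>z w. flow (cscale z S + cscale w N) (\<lambda>t. \<Psi> (of_real t * z) (of_real t * w))"
    and ep: "\<And>i j. exp_poly (\<lambda>z w. \<Psi> z w $ i $ j)"
    by (rule spectral_flow[of X]) blast
  have "flow (cscale a X) (\<lambda>t. \<Psi> (of_real t * a) (of_real t * a))"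
    using fl[of a a] XSN by (simp add: cmat.scale_right_distrib)
  then show ?thesis
    using lie_algebra_flow lie_algebra_spectral_flow[OF assms(1) assms(2)[unfolded XSN] fl ep] by blast
qed

lemma lie_algebra_zero: "zgroup G \<Longrightarrow> 0 \<in> lie_algebra G"
  using mexp_eqI[of 0 "\<lambda>_. mat 1"]
  by (intro lie_algebra_flow[of 0 "\<lambda>_. mat 1"]) (auto simp: flow_def mult_distribs zgroupD)

lemma lie_algebra_add:
  assumes "zgroup G" "X \<in> lie_algebra G" "Y \<in> lie_algebra G" shows "X + Y \<in> lie_algebra G"
proof (rule lie_algebraI[of "\<lambda>t. mexp X t ** mexp Y t"])
  show "mexp X t ** mexp Y t \<in> G" for t using assms lie_algebra_mexp zgroupD(3) by blast
  have d: "((\<lambda>t. mexp X t ** mexp Y t) has_vector_derivative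
    mexp X t ** (mexp Y t ** Y) + (mexp X t ** X) ** mexp Y t) (at t)" for t
    by (intro matmul.has_vector_derivative mexp_derivative)
  show "((\<lambda>t. mexp X t ** mexp Y t) has_vector_derivative X + Y) (at 0)"
    using d[of 0] by (simp add: add.commute)
  show "(\<lambda>t. mexp X t ** mexp Y t) C1_differentiable_on UNIV"
    unfolding C1_differentiable_on_def using d
    by (intro exI[of _ "\<lambda>t. mexp X t ** (mexp Y t ** Y) + (mexp X t ** X) ** mexp Y t"])
       (auto intro!: continuous_intros matmul.continuous_on continuous_mexp)
qed simp

lemma lie_algebra_subspace: "zgroup G \<Longrightarrow> cmat.subspace (lie_algebra G)"
  by (rule cmat.subspaceI) (auto intro: lie_algebra_cscale lie_algebra_zero lie_algebra_add)

lemma subspace_real_of_complex: "cmat.subspace V \<Longrightarrow> subspace V"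
  unfolding cmat.subspace_def subspace_def by (metis cscale_of_real)

lemma lie_algebra_mono: "G \<subseteq> G' \<Longrightarrow> lie_algebra G \<subseteq> lie_algebra G'"
  unfolding lie_algebra_def by blast

lemma lie_algebra_Ad:
  assumes "zgroup G" "g \<in> G" "X \<in> lie_algebra G" shows "Ad g X \<in> lie_algebra G"
proof (rule lie_algebra_flow[OF flow_mexp])
  show "mexp (Ad g X) t \<in> G" for t
    unfolding mexp_conjugate[OF zgroupD(5)[OF assms(1,2)]]
    by (intro zgroupD(6) lie_algebra_mexp assms)
qed

text \<open>The component of \<open>f\<close> orthogonal to \<open>V\<close> is constant.\<close>

lemma derivative_in_subspace:
  fixes V :: "'a::euclidean_space set"
  assumes "subspace V" "\<epsilon> > 0" "\<And>t. t \<in> {-\<epsilon><..<\<epsilon>} \<Longrightarrow> f t \<in> V" "(f has_vector_derivative D) (at 0)"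
  shows "D \<in> V"
proof -
  obtain y z where D: "y \<in> span V" "\<And>w. w \<in> span V \<Longrightarrow> orthogonal z w" "D = y + z"
    using orthogonal_subspace_decomp_exists[of V D] by blast
  have "((\<lambda>t. f t \<bullet> z) has_vector_derivative D \<bullet> z) (at 0)"
    by (rule bounded_linear.has_vector_derivative[OF bounded_linear_inner_left assms(4)])
  moreover have "((\<lambda>t. f t \<bullet> z) has_vector_derivative 0) (at 0)"
  proof (rule has_vector_derivative_transform_within_open[of "\<lambda>_. 0"])
    show "0 = f t \<bullet> z" if "t \<in> {-\<epsilon><..<\<epsilon>}" for t
      using D(2)[OF span_base[OF assms(3)[OF that]]] by (simp add: orthogonal_def inner_commute)
  qed (use assms in auto)
  ultimately have "D \<bullet> z = 0" using vector_derivative_unique_at by blast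
  moreover have "y \<bullet> z = 0" using D(2)[OF D(1)] by (simp add: orthogonal_def inner_commute)
  ultimately have "z = 0" using D(3) by (simp add: inner_add_left)
  then show ?thesis using D assms(1) by (simp add: span_eq_iff[THEN iffD2])
qed

lemma lie_algebra_bracket:
  assumes "zgroup G" "X \<in> lie_algebra G" "Y \<in> lie_algebra G"
  shows "lie_bracket X Y \<in> lie_algebra G"
proof (rule derivative_in_subspace[OF _ zero_less_one _ Ad_mexp_derivative])
  show "subspace (lie_algebra G)" by (intro subspace_real_of_complex lie_algebra_subspace assms)
  show "Ad (mexp X t) Y \<in> lie_algebra G" for t by (intro lie_algebra_Ad lie_algebra_mexp assms)
qed

lemma lie_algebra_mconj:
  assumes "zgroup G" "\<And>A. A \<in> G \<Longrightarrow> mconj A \<in> G" "X \<in> lie_algebra G"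
  shows "mconj X \<in> lie_algebra G"
proof (rule lie_algebra_flow[OF flow_mexp])
  show "mexp (mconj X) t \<in> G" for t
    unfolding mexp_mconj by (intro assms(2) lie_algebra_mexp assms)
qed

lemma connected_mexp: "connected (range (mexp X))"
  by (intro connected_continuous_image continuous_mexp connected_UNIV)

lemma mexp_eq_one_imp_zero:
  assumes "\<And>t. mexp X t = mat 1" shows "X = 0"
proof -
  have "mexp X = (\<lambda>t. mat 1)" using assms by blast
  then have "((\<lambda>t. mat 1) has_vector_derivative X) (at 0)"
    using mexp_derivative[of X 0] by simp
  then show ?thesis by (metis has_vector_derivative_const vector_derivative_unique_at)
qed

text \<open>
  The one-parameter groups of an abelian ideal generate a closed connected commutative normal
  subgroup, which a trivial radical does not allow.
\<close>

lemma semisimple_no_abelian_ideal: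
  assumes G: "zgroup G" "semisimple_group G"
    and a: "a \<subseteq> lie_algebra G" "\<And>g X. g \<in> G \<Longrightarrow> X \<in> a \<Longrightarrow> Ad g X \<in> a"
    and ab: "\<And>X Y. X \<in> a \<Longrightarrow> Y \<in> a \<Longrightarrow> X ** Y = Y ** X"
    and X: "X \<in> a"
  shows "X = 0"
proof -
  define R where "R = (\<Union>X\<in>a. range (mexp X))"
  define N where "N = zariski_generated R"
  have R: "invertible A" if "A \<in> R" for A using that invertible_mexp by (auto simp: R_def)
  have RG: "R \<subseteq> G" using a lie_algebra_mexp[OF G(1)] by (auto simp: R_def)
  have N: "zgroup N" unfolding N_def by (rule zgroup_zariski_generated) (rule R)
  have NG: "N \<subseteq> G" unfolding N_def by (rule zariski_generated_least[OF G(1) RG])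
  have conn: "zariski_connected N" unfolding N_def
  proof (rule zariski_generated_connected[OF R])
    show "connected_to_one R" unfolding R_def
      by (rule connected_to_one_Union)
         (auto intro!: connected_to_one_connected connected_mexp invertible_mexp
           intro: range_eqI[of _ _ 0])
  qed
  have Rcomm: "A ** B = B ** A" if "A \<in> R" "B \<in> R" for A B
    using that ab by (auto simp: R_def intro!: mexp_commute mexp_commute[symmetric])
  have comm: "A ** B = B ** A" if "A \<in> N" "B \<in> N" for A B
    using zariski_generated_commute[OF R Rcomm] that unfolding N_def by blast
  have Ad: "Ad g A \<in> N" if "g \<in> G" "A \<in> N" for g A
  proof -
    have "invertible g" using that G zgroupD by blast
    have "R \<subseteq> {A. Ad g A \<in> N}"
    proof
      fix A assume "A \<in> R"
      then obtain X t where X: "X \<in> a" "A = mexp X t" by (auto simp: R_def)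
      then have "Ad g A = mexp (Ad g X) t" using mexp_conjugate[OF \<open>invertible g\<close>] by simp
      then have "Ad g A \<in> R" using a(2)[OF that(1) X(1)] by (auto simp: R_def)
      then show "A \<in> {A. Ad g A \<in> N}" using zariski_generated_superset[of R] by (auto simp: N_def)
    qed
    then have "N \<subseteq> {A. Ad g A \<in> N}"
      unfolding N_def using zgroup_Ad_vimage[OF N \<open>invertible g\<close>, unfolded N_def]
      by (intro zariski_generated_least)
    then show ?thesis using that by blast
  qed
  interpret group "mat_group G" by (rule zgroup_imp_group[OF G(1)])
  have invG: "inv\<^bsub>mat_group G\<^esub> g = matrix_inv g" if "g \<in> G" for g
    by (rule inv_equality) (use that G in \<open>auto simp: mat_group_def zgroupD invertible_mult_inv\<close>)
  have sg: "subgroup N (mat_group G)"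
    by (rule subgroupI) (use NG N invG zgroupD[OF N] in \<open>auto simp: mat_group_def\<close>)
  have "normal N (mat_group G)"
    unfolding normal_inv_iff
    using sg Ad invG by (auto simp: mat_group_def Ad_def)
  moreover have "solvable (mat_group N)"
  proof -
    interpret N: group "mat_group N" by (rule zgroup_imp_group[OF N])
    interpret N: comm_group "mat_group N"
      by (rule N.group_comm_groupI) (auto simp: mat_group_def comm)
    have "(derived (mat_group N) ^^ 1) (carrier (mat_group N)) = {\<one>\<^bsub>mat_group N\<^esub>}"
      by (simp add: N.derived_eq_singleton)
    then show ?thesis
      using N.solvable_iff_trivial_derived_seq by blast
  qed
  ultimately have "N = {mat 1}"
    using G(2) conn zgroupD(1)[OF N] by (auto simp: semisimple_group_def)
  then have "mexp X t = mat 1" for t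
  proof -
    have "mexp X t \<in> R" using X by (auto simp: R_def)
    then show ?thesis using \<open>N = {mat 1}\<close> zariski_generated_superset[of R] by (auto simp: N_def)
  qed
  then show ?thesis by (rule mexp_eq_one_imp_zero)
qed

section \<open>Diagonalizable groups\<close>

definition dg :: "('n \<Rightarrow> complex) \<Rightarrow> ('n::finite) cmat" where
  "dg d = (\<chi> i j. if i = j then d i else 0)"

lemma dg_nth: "dg d $ i $ j = (if i = j then d i else 0)"
  by (simp add: dg_def)

lemma dg_mult_left: "(dg d ** A) $ i $ j = d i * A $ i $ j"
  by (simp add: matrix_matrix_mult_def dg_nth if_distrib[of "\<lambda>x. x * _"] cong: if_cong)

lemma dg_mult_right: "(A ** dg d) $ i $ j = A $ i $ j * d j"
  by (simp add: matrix_matrix_mult_def dg_nth if_distrib[of "\<lambda>x. _ * x"] cong: if_cong)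

lemma dg_mult: "dg a ** dg b = dg (\<lambda>i. a i * b i)"
  by (simp add: vec_eq_iff dg_mult_left dg_nth)

lemma mexp_dg: "mexp (dg d) t = dg (\<lambda>i. exp (of_real t * d i))"
proof -
  have "((\<lambda>t. exp (of_real t * d i)) has_vector_derivative exp (of_real t * d i) * d i) (at t)" for i t
    by (rule has_vector_derivative_real_field) (auto intro!: derivative_eq_intros)
  then have "((\<lambda>t. dg (\<lambda>i. exp (of_real t * d i))) has_vector_derivative
      dg (\<lambda>i. exp (of_real t * d i) * d i)) (at t)" for t
    by (intro has_vector_derivative_matrix) (simp add: dg_nth)
  then have "flow (dg d) (\<lambda>t. dg (\<lambda>i. exp (of_real t * d i)))"
    unfolding flow_def dg_mult by (simp add: dg_def mat_def)
  from mexp_eqI[OF this] show ?thesis by simp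
qed

definition diag_by :: "('n::finite) cmat \<Rightarrow> 'n cmat \<Rightarrow> bool" where
  "diag_by P A \<longleftrightarrow> (\<forall>i j. i \<noteq> j \<longrightarrow> Ad P A $ i $ j = 0)"

text \<open>
  For the matrices with \<open>diag_by P A\<close> these are the eigenvalues, in an order that is the same
  for all of them, so that they depend linearly on \<open>A\<close>.
\<close>

definition ev :: "('n::finite) cmat \<Rightarrow> 'n cmat \<Rightarrow> 'n \<Rightarrow> complex" where
  "ev P A i = Ad P A $ i $ i"

lemma diag_by_iff: "diag_by P A \<longleftrightarrow> Ad P A = dg (ev P A)"
  by (auto simp: diag_by_def vec_eq_iff dg_nth ev_def)

lemma diag_by_commute:
  assumes "invertible P" "diag_by P A" "diag_by P B" shows "A ** B = B ** A"
proof -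
  have "Ad P (A ** B) = Ad P (B ** A)"
    using assms by (simp add: Ad_mult diag_by_iff dg_mult mult.commute)
  then show ?thesis using assms by (simp add: Ad_eq_iff)
qed

lemma ev_mult:
  assumes "invertible P" "diag_by P A" shows "ev P (A ** B) i = ev P A i * ev P B i"
  using assms by (simp add: ev_def Ad_mult diag_by_iff dg_mult_left)

lemma ev_one: "invertible P \<Longrightarrow> ev P (mat 1) i = 1"
  by (simp add: ev_def Ad_one) (simp add: mat_def)

lemma ev_mexp:
  assumes "invertible P" "diag_by P A" shows "ev P (mexp A t) i = exp (of_real t * ev P A i)"
proof -
  have "Ad P (mexp A t) = mexp (dg (ev P A)) t"
    using mexp_conjugate[OF assms(1), of A t] assms(2) by (simp add: diag_by_iff)
  then show ?thesis by (simp add: ev_def mexp_dg dg_nth)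
qed

lemma commute_diag_iff:
  assumes "invertible P" "diag_by P A"
  shows "A ** X = X ** A \<longleftrightarrow> (\<forall>i j. Ad P X $ i $ j \<noteq> 0 \<longrightarrow> ev P A i = ev P A j)"
proof -
  have "A ** X = X ** A \<longleftrightarrow> Ad P (A ** X) = Ad P (X ** A)" using assms by (simp add: Ad_eq_iff)
  also have "\<dots> \<longleftrightarrow> (\<forall>i j. Ad P X $ i $ j \<noteq> 0 \<longrightarrow> ev P A i = ev P A j)"
  proof -
    have D: "Ad P A = dg (ev P A)" using assms(2) by (simp add: diag_by_iff)
    show ?thesis using assms(1)
      by (simp add: Ad_mult D) (auto simp: vec_eq_iff dg_mult_left dg_mult_right)
  qed
  finally show ?thesis .
qed

lemma alg_torusE:
  assumes "alg_torus H"
  obtains P where "zgroup H" "zariski_connected H" "invertible P" "\<And>A. A \<in> H \<Longrightarrow> diag_by P A"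
  using assms algebraic_group_imp_zgroup unfolding alg_torus_def diag_by_def Ad_def by blast

lemma lie_algebra_diag:
  assumes "zgroup H" "invertible P" "\<And>A. A \<in> H \<Longrightarrow> diag_by P A" "X \<in> lie_algebra H"
  shows "diag_by P X"
proof -
  have sub: "subspace {A. diag_by P A}"
    by (rule subspaceI) (auto simp: diag_by_def Ad_simps)
  have "X \<in> {A. diag_by P A}"
    by (rule derivative_in_subspace[OF sub, of 1 "mexp X"])
       (use assms lie_algebra_mexp mexp_derivative[of X 0] in auto)
  then show ?thesis by simp
qed

subsection \<open>Characters of a diagonal group are detected on its Lie algebra\<close>

text \<open>
  The independence of characters, by the argument of Dedekind, for a multiplication \<open>m\<close> on a set
  \<open>S\<close>. The characters are zero outside \<open>S\<close>, so that distinct ones differ at a point of \<open>S\<close>.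
\<close>

lemma character_independence:
  fixes X :: "('a \<Rightarrow> complex) set"
  assumes "finite X" "\<And>\<eta> x y. \<eta> \<in> X \<Longrightarrow> x \<in> S \<Longrightarrow> y \<in> S \<Longrightarrow> \<eta> (m x y) = \<eta> x * \<eta> y"
    and "\<And>\<eta> x. \<eta> \<in> X \<Longrightarrow> x \<notin> S \<Longrightarrow> \<eta> x = 0" "\<And>\<eta>. \<eta> \<in> X \<Longrightarrow> \<eta> e = 1" "e \<in> S"
    and "\<And>x y. x \<in> S \<Longrightarrow> y \<in> S \<Longrightarrow> m x y \<in> S"
    and "\<And>x. x \<in> S \<Longrightarrow> (\<Sum>\<eta>\<in>X. c \<eta> * \<eta> x) = 0" "\<eta> \<in> X"
  shows "c \<eta> = 0"
  using assms
proof (induction arbitrary: c \<eta> rule: finite_induct)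
  case (insert \<psi> X)
  have 0: "c \<eta> = 0" if \<eta>: "\<eta> \<in> X" for \<eta>
  proof -
    have "c \<eta> * (\<eta> y - \<psi> y) = 0" if y: "y \<in> S" for y
    proof (rule insert.IH[where c = "\<lambda>\<eta>. c \<eta> * (\<eta> y - \<psi> y)"])
      fix x assume x: "x \<in> S"
      have "(\<Sum>\<eta>\<in>X. c \<eta> * (\<eta> y - \<psi> y) * \<eta> x)
          = (\<Sum>\<eta>\<in>insert \<psi> X. c \<eta> * (\<eta> y - \<psi> y) * \<eta> x)" using insert by simp
      also have "\<dots> = (\<Sum>\<eta>\<in>insert \<psi> X. c \<eta> * \<eta> (m x y)) - \<psi> y * (\<Sum>\<eta>\<in>insert \<psi> X. c \<eta> * \<eta> x)"
        unfolding sum_distrib_left sum_subtractf[symmetric]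
      proof (rule sum.cong[OF refl])
        fix \<kappa> assume "\<kappa> \<in> insert \<psi> X"
        then have "\<kappa> (m x y) = \<kappa> x * \<kappa> y" using insert.prems(1) x y by blast
        then show "c \<kappa> * (\<kappa> y - \<psi> y) * \<kappa> x = c \<kappa> * \<kappa> (m x y) - \<psi> y * (c \<kappa> * \<kappa> x)"
          by (simp add: algebra_simps)
      qed
      also have "\<dots> = 0" using insert.prems(6)[OF x] insert.prems(6)[OF insert.prems(5)[OF x y]] by simp
      finally show "(\<Sum>\<eta>\<in>X. c \<eta> * (\<eta> y - \<psi> y) * \<eta> x) = 0" .
    qed (use insert.prems \<eta> in \<open>(blast | simp)+\<close>)
    moreover obtain y where "\<eta> y \<noteq> \<psi> y" using \<eta> insert.hyps(2) by (metis ext)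
    moreover have "y \<in> S" using calculation(2) insert.prems(2) \<eta> by (metis insertCI)
    ultimately show ?thesis by (metis eq_iff_diff_eq_0 mult_eq_0_iff)
  qed
  have "(\<Sum>\<eta>\<in>X. c \<eta> * \<eta> e) = 0" using 0 by simp
  then have "c \<psi> = 0" using insert.prems(6)[OF insert.prems(4)] insert.hyps insert.prems(3)[of \<psi>] by simp
  then show ?case using 0 insert.prems by blast
qed simp

definition monomial_sum :: "(('n::finite \<Rightarrow> complex) \<Rightarrow> complex) \<Rightarrow> bool" where
  "monomial_sum \<phi> \<longleftrightarrow> (\<exists>M c. finite M \<and> \<phi> = (\<lambda>a. \<Sum>m\<in>M. c m * (\<Prod>i\<in>UNIV. a i ^ m i)))"

lemma monomial_sum_monomial: "monomial_sum (\<lambda>a. c * (\<Prod>i\<in>UNIV. a i ^ m i))"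
  unfolding monomial_sum_def by (intro exI[of _ "{m}"] exI[of _ "\<lambda>_. c"]) simp

lemma monomial_sum_const: "monomial_sum (\<lambda>a. c)"
  using monomial_sum_monomial[of c "\<lambda>_. 0"] by simp

lemma monomial_sum_var: "monomial_sum (\<lambda>a. c * a i)"
proof -
  have "(\<Prod>k\<in>UNIV. a k ^ (if k = i then 1 else 0)) = a i" for a :: "'a \<Rightarrow> complex"
    by (subst prod.remove[of _ i]) (auto simp: prod.neutral)
  then show ?thesis using monomial_sum_monomial[of c "\<lambda>k. if k = i then 1 else 0"] by simp
qed

lemma monomial_sum_add:
  assumes "monomial_sum \<phi>" "monomial_sum \<psi>" shows "monomial_sum (\<lambda>a. \<phi> a + \<psi> a)"
proof -
  obtain M c where M: "finite M" "\<phi> = (\<lambda>a. \<Sum>m\<in>M. c m * (\<Prod>i\<in>UNIV. a i ^ m i))"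
    using assms unfolding monomial_sum_def by blast
  obtain M' c' where M': "finite M'" "\<psi> = (\<lambda>a. \<Sum>m\<in>M'. c' m * (\<Prod>i\<in>UNIV. a i ^ m i))"
    using assms unfolding monomial_sum_def by blast
  define d where "d m = (if m \<in> M then c m else 0)" for m
  define d' where "d' m = (if m \<in> M' then c' m else 0)" for m
  have 1: "\<phi> a = (\<Sum>m\<in>M \<union> M'. d m * (\<Prod>i\<in>UNIV. a i ^ m i))" for a
    unfolding M(2) using M(1) M'(1) by (intro sum.mono_neutral_cong_left) (auto simp: d_def)
  have 2: "\<psi> a = (\<Sum>m\<in>M \<union> M'. d' m * (\<Prod>i\<in>UNIV. a i ^ m i))" for a
    unfolding M'(2) using M(1) M'(1) by (intro sum.mono_neutral_cong_left) (auto simp: d'_def)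
  show ?thesis unfolding monomial_sum_def
    using M(1) M'(1) by (intro exI[of _ "M \<union> M'"] exI[of _ "\<lambda>m. d m + d' m"])
      (simp add: 1 2 sum.distrib ring_distribs)
qed

lemma monomial_sum_sum:
  "(\<And>i. i \<in> I \<Longrightarrow> monomial_sum (f i)) \<Longrightarrow> monomial_sum (\<lambda>a. \<Sum>i\<in>I. f i a)"
  by (induction I rule: infinite_finite_induct) (simp_all add: monomial_sum_const monomial_sum_add)

lemma monomial_sum_mult:
  assumes "monomial_sum \<phi>" "monomial_sum \<psi>" shows "monomial_sum (\<lambda>a. \<phi> a * \<psi> a)"
proof -
  obtain M c where M: "finite M" "\<phi> = (\<lambda>a. \<Sum>m\<in>M. c m * (\<Prod>i\<in>UNIV. a i ^ m i))"
    using assms unfolding monomial_sum_def by blast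
  obtain M' c' where M': "finite M'" "\<psi> = (\<lambda>a. \<Sum>m\<in>M'. c' m * (\<Prod>i\<in>UNIV. a i ^ m i))"
    using assms unfolding monomial_sum_def by blast
  have "(\<lambda>a. \<phi> a * \<psi> a)
      = (\<lambda>a. \<Sum>m\<in>M. \<Sum>n\<in>M'. (c m * c' n) * (\<Prod>i\<in>UNIV. a i ^ (m i + n i)))"
    unfolding M(2) M'(2)
    by (intro ext, subst sum_product, intro sum.cong refl) (simp add: power_add prod.distrib mult_ac)
  then show ?thesis by (simp only:) (intro monomial_sum_sum monomial_sum_monomial)
qed

lemma polynomial_function_diagonal:
  assumes "f \<in> polynomial_functions UNIV"
  shows "monomial_sum (\<lambda>a. f (Ad Q (dg a)))"
  using assms
proof induction
  case (entry i j)
  have "Ad Q (dg a) $ i $ j = (\<Sum>k\<in>UNIV. Q $ i $ k * matrix_inv Q $ k $ j * a k)" for a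
    by (simp add: Ad_def matrix_matrix_mult_def[of "Q ** dg a"] dg_mult_right mult_ac)
  then show ?case by (simp add: monomial_sum_sum monomial_sum_var)
next
  case (add p q)
  show ?case by (rule monomial_sum_add[OF add.IH])
next
  case (mult p q)
  show ?case by (rule monomial_sum_mult[OF mult.IH])
qed (rule monomial_sum_const)

text \<open>
  The lattice \<open>L\<close> of characters that are trivial on \<open>H\<close> decides everything. By independence of
  characters, a direction orthogonal to \<open>L\<close> is tangent to \<open>H\<close>; so if the character \<open>e_i - e_j\<close> has
  zero derivative, it lies in the real span of \<open>L\<close>. Rounding its multiples to lattice points and
  using the pigeonhole principle, some positive multiple lies in \<open>L\<close> itself, so the character
  takes finitely many values, and connectedness leaves only the value one.
\<close>

lemma torus_character_trivial:
  fixes P :: "('n::finite) cmat"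
  assumes H: "zgroup H" "zariski_connected H" and P: "invertible P" "\<And>A. A \<in> H \<Longrightarrow> diag_by P A"
    and d: "\<And>h. h \<in> lie_algebra H \<Longrightarrow> ev P h i = ev P h j" and A: "A \<in> H"
  shows "ev P A i = ev P A j"
proof (cases "i = j")
  case ij: False
  define Q where "Q = matrix_inv P"
  have Q: "invertible Q" "\<And>X. Ad P (Ad Q X) = X" "\<And>X. Ad Q (Ad P X) = X"
    using P Ad_inverse by (auto simp: Q_def invertible_matrix_inv)
  have nz: "ev P A k \<noteq> 0" if "A \<in> H" for A k
  proof -
    have "ev P (A ** matrix_inv A) k = 1" using zgroupD(5)[OF H(1) that] P by (simp add: invertible_mult_inv ev_one)
    then show ?thesis using P that by (auto simp: ev_mult)
  qed
  define \<theta> where "\<theta> m A = (\<Prod>k\<in>UNIV. ev P A k powi m k)" for m :: "'n \<Rightarrow> int" and A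
  define L where "L = {m. \<forall>A\<in>H. \<theta> m A = 1}"
  define vec :: "('n \<Rightarrow> int) \<Rightarrow> real^'n" where "vec m = (\<chi> k. of_int (m k))" for m
  define v :: "real^'n" where "v = axis i 1 - axis j 1"
  have inspan: "v \<in> span (vec ` L)"
  proof (rule ccontr)
    assume nspan: "v \<notin> span (vec ` L)"
    obtain y w where yw: "y \<in> span (vec ` L)" "\<And>x. x \<in> span (vec ` L) \<Longrightarrow> orthogonal w x" "v = y + w"
      using orthogonal_subspace_decomp_exists[of "vec ` L" v] by blast
    have "w \<noteq> 0" using nspan yw by auto
    moreover have "w \<bullet> v = w \<bullet> w" using yw by (simp add: inner_add_right orthogonal_def)
    ultimately have wv: "w \<bullet> v \<noteq> 0" by simp
    define W where "W = Ad Q (dg (\<lambda>k. of_real (w $ k)))"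
    have "mexp W t \<in> H" for t
    proof (rule zariski_closedD[OF zgroupD(1)[OF H(1)] invertible_mexp])
      fix f assume f: "f \<in> vanishing H"
      then have "monomial_sum (\<lambda>a. f (Ad Q (dg a)))"
        by (intro polynomial_function_diagonal) (simp add: vanishing_def)
      then obtain M c where M: "finite M"
        and eq: "(\<lambda>a. f (Ad Q (dg a))) = (\<lambda>a. \<Sum>m\<in>M. c m * (\<Prod>k\<in>UNIV. a k ^ m k))"
        unfolding monomial_sum_def by blast
      have eq: "f (Ad Q (dg a)) = (\<Sum>m\<in>M. c m * (\<Prod>k\<in>UNIV. a k ^ m k))" for a
        using fun_cong[OF eq, of a] .
      define \<rho> where "\<rho> m A = (if A \<in> H then \<Prod>k\<in>UNIV. ev P A k ^ m k else 0)" for m :: "'n \<Rightarrow> nat" and A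
      define C where "C \<kappa> = (\<Sum>m\<in>{m\<in>M. \<rho> m = \<kappa>}. c m)" for \<kappa>
      have C0: "C \<kappa> = 0" if "\<kappa> \<in> \<rho> ` M" for \<kappa>
      proof (rule character_independence[where S = H and m = "(**)" and e = "mat 1" and X = "\<rho> ` M" and c = C])
        show "\<eta> (A ** B) = \<eta> A * \<eta> B" if "\<eta> \<in> \<rho> ` M" "A \<in> H" "B \<in> H" for \<eta> A B
          using that P H by (auto simp: \<rho>_def zgroupD ev_mult power_mult_distrib prod.distrib)
        show "\<eta> (mat 1) = 1" if "\<eta> \<in> \<rho> ` M" for \<eta>
          using that P H by (auto simp: \<rho>_def zgroupD ev_one)
        show "(\<Sum>\<kappa>\<in>\<rho> ` M. C \<kappa> * \<kappa> A) = 0" if A: "A \<in> H" for A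
        proof -
          have "0 = f (Ad Q (dg (ev P A)))" using f A P(2)[OF A] Q by (simp add: vanishing_def diag_by_iff flip: diag_by_iff) (metis diag_by_iff)
          also have "\<dots> = (\<Sum>m\<in>M. c m * \<rho> m A)" using A by (simp add: eq \<rho>_def)
          also have "\<dots> = (\<Sum>\<kappa>\<in>\<rho> ` M. \<Sum>m\<in>{m\<in>M. \<rho> m = \<kappa>}. c m * \<rho> m A)"
            by (rule sum.image_gen[OF M])
          also have "\<dots> = (\<Sum>\<kappa>\<in>\<rho> ` M. C \<kappa> * \<kappa> A)"
            unfolding C_def sum_distrib_right by (intro sum.cong refl) auto
          finally show ?thesis by simp
        qed
      qed (use M that H in \<open>auto simp: \<rho>_def zgroupD\<close>)
      define dot where "dot m = (\<Sum>k\<in>UNIV. real (m k) * w $ k)" for m :: "'n \<Rightarrow> nat"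
      have dot: "dot m = dot m'" if "\<rho> m = \<rho> m'" for m m'
      proof -
        define n where "n k = int (m k) - int (m' k)" for k
        have "\<theta> n A = 1" if "A \<in> H" for A
        proof -
          have "\<theta> n A = (\<Prod>k\<in>UNIV. ev P A k ^ m k / ev P A k ^ m' k)"
            unfolding \<theta>_def n_def using nz[OF that] by (simp add: power_int_diff)
          also have "\<dots> = \<rho> m A / \<rho> m' A" using that by (simp add: \<rho>_def prod_dividef)
          also have "\<dots> = 1" using \<open>\<rho> m = \<rho> m'\<close> nz that by (simp add: \<rho>_def)
          finally show ?thesis .
        qed
        then have "n \<in> L" by (simp add: L_def)
        then have "orthogonal w (vec n)" using yw(2) span_base by blast
        then have "(\<Sum>k\<in>UNIV. w $ k * of_int (n k)) = 0" by (simp add: orthogonal_def inner_vec_def vec_def)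
        then show ?thesis by (simp add: dot_def n_def algebra_simps sum_subtractf)
      qed
      have "f (mexp W t) = (\<Sum>m\<in>M. c m * exp (of_real (t * dot m)))"
        unfolding W_def mexp_conjugate[OF Q(1)] mexp_dg eq dot_def
        by (simp add: sum_distrib_left exp_sum mult_ac flip: exp_of_nat_mult)
      also have "\<dots> = (\<Sum>\<kappa>\<in>\<rho> ` M. \<Sum>m\<in>{m\<in>M. \<rho> m = \<kappa>}. c m * exp (of_real (t * dot m)))"
        by (rule sum.image_gen[OF M])
      also have "\<dots> = (\<Sum>\<kappa>\<in>\<rho> ` M. C \<kappa> * exp (of_real (t * dot (SOME m. \<rho> m = \<kappa>))))"
        unfolding C_def sum_distrib_right
      proof (intro sum.cong refl)
        fix \<kappa> m assume "m \<in> {m \<in> M. \<rho> m = \<kappa>}"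
        then have "\<rho> m = \<kappa>" by simp
        moreover from this have "\<rho> (SOME m. \<rho> m = \<kappa>) = \<kappa>"
          by (rule someI[where P = "\<lambda>m. \<rho> m = \<kappa>"])
        ultimately have "\<rho> m = \<rho> (SOME m. \<rho> m = \<kappa>)" by simp
        then show "c m * exp (of_real (t * dot m)) = c m * exp (of_real (t * dot (SOME m. \<rho> m = \<kappa>)))"
          using dot[of m "SOME m. \<rho> m = \<kappa>"] by simp
      qed
      also have "\<dots> = 0" using C0 by simp
      finally show "f (mexp W t) = 0" .
    qed
    then have "W \<in> lie_algebra H" using lie_algebra_flow flow_mexp by blast
    then have "ev P W i = ev P W j" by (rule d)
    then have "w $ i = w $ j" by (simp add: ev_def W_def Q dg_nth)
    then show False using wv by (simp add: v_def inner_diff_right inner_axis)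
  qed
  obtain K where K: "K > 0" "\<And>A. A \<in> H \<Longrightarrow> ev P A i ^ K = ev P A j ^ K"
  proof -
    obtain B r where B: "finite B" "B \<subseteq> vec ` L" "v = (\<Sum>b\<in>B. r b *\<^sub>R b)"
      using inspan unfolding span_explicit by auto
    obtain B' where B': "B' \<subseteq> L" "B = vec ` B'" "inj_on vec B'" using B(2) by (meson subset_image_inj)
    have fB': "finite B'" using B B' finite_imageD by blast
    define u where "u N k = (\<Sum>b\<in>B'. (of_nat N * r (vec b) - of_int \<lfloor>of_nat N * r (vec b)\<rfloor>) * of_int (b k))"
      for N k
    define z where "z N k = of_nat N * ((if k = i then 1 else 0) - (if k = j then 1 else 0))
       - (\<Sum>b\<in>B'. \<lfloor>of_nat N * r (vec b)\<rfloor> * b k)" for N :: nat and k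
    have vk: "v $ k = (\<Sum>b\<in>B'. r (vec b) * of_int (b k))" for k
      unfolding B(3) B'(2) sum.reindex[OF B'(3)] by (simp add: vec_def)
    have uz: "u N k = of_int (z N k)" for N k
    proof -
      have "u N k = of_nat N * v $ k - of_int (\<Sum>b\<in>B'. \<lfloor>of_nat N * r (vec b)\<rfloor> * b k)"
        unfolding u_def vk sum_distrib_left of_int_sum sum_subtractf[symmetric]
        by (intro sum.cong refl) (simp add: algebra_simps)
      then show ?thesis by (simp add: z_def v_def axis_def)
    qed
    define C where "C = (\<Sum>b\<in>B'. \<Sum>k\<in>UNIV. \<bar>b k\<bar>)"
    have "\<bar>z N k\<bar> \<le> C" for N k
    proof -
      have "\<bar>u N k\<bar> \<le> (\<Sum>b\<in>B'. of_int \<bar>b k\<bar>)"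
        unfolding u_def
      proof (intro order.trans[OF sum_abs] sum_mono)
        fix b :: "'n \<Rightarrow> int"
        have "\<bar>of_nat N * r (vec b) - of_int \<lfloor>of_nat N * r (vec b)\<rfloor>\<bar> \<le> 1" by linarith
        then show "\<bar>(of_nat N * r (vec b) - of_int \<lfloor>of_nat N * r (vec b)\<rfloor>) * of_int (b k)\<bar> \<le> of_int \<bar>b k\<bar>"
          by (simp add: abs_mult mult_left_le_one_le)
      qed
      also have "\<dots> \<le> (\<Sum>b\<in>B'. of_int (\<Sum>k\<in>UNIV. \<bar>b k\<bar>))"
        by (intro sum_mono of_int_le_iff[THEN iffD2] member_le_sum) auto
      finally have "of_int \<bar>z N k\<bar> \<le> (of_int C :: real)" unfolding uz C_def by simp
      then show ?thesis by simp
    qed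
    then have "range z \<subseteq> (\<Pi>\<^sub>E k\<in>UNIV. {-C..C})" by (auto simp: abs_le_iff) (smt (verit))
    moreover have "finite (\<Pi>\<^sub>E k\<in>(UNIV :: 'n set). {-C..C})" by (intro finite_PiE) auto
    ultimately have "finite (range z)" using finite_subset by blast
    then have "\<not> inj z" using finite_imageD infinite_UNIV_nat by blast
    then obtain N1 N2 where "N1 \<noteq> N2" "z N1 = z N2" by (auto simp: inj_on_def)
    then obtain N1 N2 where N: "N1 < N2" "z N1 = z N2" by (metis nat_neq_iff)
    define n where "n b = \<lfloor>of_nat N2 * r (vec b)\<rfloor> - \<lfloor>of_nat N1 * r (vec b)\<rfloor>" for b
    define K where "K = N2 - N1"
    have m: "int K * ((if k = i then 1 else 0) - (if k = j then 1 else 0)) = (\<Sum>b\<in>B'. n b * b k)" for k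
      using fun_cong[OF N(2), of k] N(1)
      by (simp add: z_def K_def n_def left_diff_distrib sum_subtractf of_nat_diff algebra_simps)
    have "ev P A i ^ K = ev P A j ^ K" if A: "A \<in> H" for A
    proof -
      have fl: "(\<Prod>k\<in>UNIV. ev P A k powi (n b * b k)) = 1" if "b \<in> B'" for b
      proof -
        have "(\<Prod>k\<in>UNIV. ev P A k powi (n b * b k)) = (\<Prod>k\<in>UNIV. (ev P A k powi b k) powi n b)"
          by (intro prod.cong) (simp_all add: power_int_mult mult.commute[of "n b"])
        also have "\<dots> = \<theta> b A powi n b"
          unfolding \<theta>_def by (induction rule: infinite_finite_induct) (simp_all add: power_int_mult_distrib)
        also have "\<theta> b A = 1" using that B'(1) A by (auto simp: L_def)
        finally show ?thesis by simp
      qed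
      have "(\<Prod>k\<in>UNIV. ev P A k powi (\<Sum>b\<in>B'. n b * b k)) = (\<Prod>k\<in>UNIV. \<Prod>b\<in>B'. ev P A k powi (n b * b k))"
      proof (intro prod.cong refl)
        fix k show "ev P A k powi (\<Sum>b\<in>B'. n b * b k) = (\<Prod>b\<in>B'. ev P A k powi (n b * b k))"
          using fB' by (induction rule: finite_induct) (simp_all add: power_int_add nz[OF A])
      qed
      also have "\<dots> = (\<Prod>b\<in>B'. \<Prod>k\<in>UNIV. ev P A k powi (n b * b k))" by (rule prod.swap)
      also have "\<dots> = 1" using fl by simp
      finally have one: "(\<Prod>k\<in>UNIV. ev P A k powi (\<Sum>b\<in>B'. n b * b k)) = 1" .
      have "(\<Prod>k\<in>UNIV. ev P A k powi (\<Sum>b\<in>B'. n b * b k))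
          = (\<Prod>k\<in>UNIV. ev P A k powi (int K * ((if k = i then 1 else 0) - (if k = j then 1 else 0))))"
        by (simp only: m)
      also have "\<dots> = ev P A i powi int K * ev P A j powi (- int K)"
        using ij by (subst prod.remove[of _ i], simp, simp, subst prod.remove[of _ j]) (auto intro!: prod.neutral)
      finally show ?thesis using one nz[OF A, of j] by (simp add: power_int_minus field_simps)
    qed
    then show ?thesis using that[of K] N(1) by (simp add: K_def)
  qed
  define q where "q A = (\<Sum>l<K. ev P A j ^ (K - Suc l) * ev P A i ^ l)" for A
  have pf: "(\<lambda>A. ev P A k) \<in> polynomial_functions UNIV" for k
    unfolding ev_def Ad_def by (rule polynomial_functions_translate[OF polynomial_functions.entry])
  have pow: "(\<lambda>A. ev P A k ^ l) \<in> polynomial_functions UNIV" for k l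
  proof (induction l)
    case (Suc l)
    show ?case using polynomial_functions.mult[OF pf Suc, of k] by simp
  qed (simp add: polynomial_functions.const)
  have qf: "q \<in> polynomial_functions UNIV"
    unfolding q_def by (intro polynomial_functions_sum polynomial_functions.mult pow)
  define p where "p A = ev P A i + (- 1) * ev P A j" for A
  have pp: "p \<in> polynomial_functions UNIV"
    unfolding p_def by (intro polynomial_functions.add polynomial_functions.mult pf polynomial_functions.const UNIV_I)
  have zc: "zariski_closed UNIV {A\<in>H. f A = 0}" if "f \<in> polynomial_functions UNIV" for f
  proof -
    have "zariski_closed UNIV {A. invertible A \<and> (\<forall>p\<in>{f}. p A = 0)}"
      unfolding zariski_closed_def using that by blast
    then have "zariski_closed UNIV (H \<inter> {A. invertible A \<and> (\<forall>p\<in>{f}. p A = 0)})"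
      by (rule zariski_closed_Int[OF zgroupD(1)[OF H(1)]])
    moreover have "H \<inter> {A. invertible A \<and> (\<forall>p\<in>{f}. p A = 0)} = {A\<in>H. f A = 0}"
      using zgroupD(5)[OF H(1)] by auto
    ultimately show ?thesis by (simp only:)
  qed
  have "connected_to_one H"
    using connected_to_one_zariski_connected zgroupD(1,2) H by blast
  moreover have "{A\<in>H. p A = 0} \<inter> {A\<in>H. q A = 0} = {}"
  proof -
    have "q A \<noteq> 0" if "A \<in> H" "p A = 0" for A
    proof -
      have "ev P A i = ev P A j" using that by (simp add: p_def)
      then have "q A = of_nat K * ev P A j ^ (K - 1)"
        by (simp add: q_def flip: power_add)
      then show ?thesis using K(1) nz[OF that(1)] by simp
    qed
    then show ?thesis by blast
  qed
  moreover have "H \<subseteq> {A\<in>H. p A = 0} \<union> {A\<in>H. q A = 0}"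
  proof
    fix A assume A: "A \<in> H"
    have "p A * q A = ev P A i ^ K - ev P A j ^ K"
      unfolding power_diff_sumr2 by (simp add: p_def q_def)
    then show "A \<in> {A\<in>H. p A = 0} \<union> {A\<in>H. q A = 0}" using A K(2)[OF A] by auto
  qed
  moreover have "mat 1 \<in> {A\<in>H. p A = 0}" using P H by (simp add: p_def ev_one zgroupD)
  ultimately have "H \<subseteq> {A\<in>H. p A = 0}"
    using zc[OF pp] zc[OF qf] unfolding connected_to_one_def by blast
  then show ?thesis using A by (auto simp: p_def)
qed simp

text \<open>
  Commuting with the Lie algebra means that a nonzero entry of \<open>X\<close> can only occur at a position
  \<open>(i, j)\<close> where the eigenvalues of all its elements agree, and then those of the elements of
  the torus agree as well.
\<close>

lemma torus_commute:
  fixes P :: "('n::finite) cmat"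
  assumes H: "zgroup H" "zariski_connected H" and P: "invertible P" "\<And>A. A \<in> H \<Longrightarrow> diag_by P A"
    and X: "\<And>h. h \<in> lie_algebra H \<Longrightarrow> h ** X = X ** h" and A: "A \<in> H"
  shows "A ** X = X ** A"
proof -
  have "ev P A i = ev P A j" if "Ad P X $ i $ j \<noteq> 0" for i j
  proof (rule torus_character_trivial[OF H P _ A])
    fix h assume h: "h \<in> lie_algebra H"
    have "diag_by P h" using lie_algebra_diag[OF H(1) P h] .
    then show "ev P h i = ev P h j" using X[OF h] that by (simp add: commute_diag_iff[OF P(1)])
  qed
  then show ?thesis using commute_diag_iff[OF P(1) P(2)[OF A]] by blast
qed

section \<open>Jordan decomposition relative to a maximal torus\<close>

text \<open>
  A spanning set of common eigenvectors contains a basis, whose elements become the columns of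
  the inverse of \<open>P\<close>.
\<close>

lemma joint_diagonalization:
  fixes V :: "(complex^'n::finite) set" and R :: "'n cmat set"
  assumes "vec.span V = UNIV" "\<And>v A. v \<in> V \<Longrightarrow> A \<in> R \<Longrightarrow> \<exists>c. A *v v = c *s v"
  obtains P where "invertible P" "\<And>A. A \<in> R \<Longrightarrow> diag_by P A"
proof -
  obtain B where B: "B \<subseteq> V" "vec.independent B" "V \<subseteq> vec.span B" "card B = vec.dim V"
    by (rule vec.basis_exists)
  have sp: "vec.span B = UNIV" using assms(1) B(3) by (metis top.extremum_uniqueI vec.span_mono vec.span_span)
  have "card B = CARD('n)" using B(4) assms(1) vec.dim_span[of V] vec_dim_card by metis
  then obtain f where f: "bij_betw f (UNIV :: 'n set) B"
    using finite_same_card_bij[of "UNIV :: 'n set" B] B(2) vec.finiteI_independent by auto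
  define Q :: "'n cmat" where "Q = (\<chi> r i. f i $ r)"
  have col: "column i Q = f i" for i by (simp add: column_def Q_def vec_eq_iff)
  then have "columns Q = B" using f by (auto simp: columns_def bij_betw_def)
  then obtain P where P: "Q ** P = mat 1" using sp matrix_right_invertible_span_columns by metis
  then have PQ: "P ** Q = mat 1" by (simp add: matrix_left_right_inverse)
  have "diag_by P A" if A: "A \<in> R" for A
  proof -
    have "\<exists>c. A *v f i = c *s f i" for i using f B(1) assms(2) A by (auto simp: bij_betw_def)
    then obtain c where c: "A *v f i = c i *s f i" for i by metis
    have "(A ** Q) $ r $ i = (Q ** dg c) $ r $ i" for r i
    proof -
      have "(A ** Q) $ r $ i = (A *v f i) $ r"
        by (simp add: matrix_matrix_mult_def matrix_vector_mult_def Q_def)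
      then show ?thesis by (simp add: c dg_mult_right Q_def mult.commute)
    qed
    then have "A ** Q = Q ** dg c" by (simp add: vec_eq_iff)
    then have "Ad P A = dg c"
      using PQ matrix_inv_unique[OF PQ] by (simp add: Ad_def) (metis matrix_mul_assoc matrix_mul_lid)
    then show ?thesis by (simp add: diag_by_def dg_nth)
  qed
  then show ?thesis using that PQ invertibleI by blast
qed

text \<open>The diagonal matrices form their own centralizer.\<close>

lemma zgroup_diag_by:
  fixes P :: "('n::finite) cmat"
  assumes "invertible P" shows "zgroup {A. invertible A \<and> diag_by P A}"
proof -
  have "{A. invertible A \<and> diag_by P A} = {A. invertible A \<and> (\<forall>B\<in>{B. diag_by P B}. A ** B = B ** A)}"
  proof (intro Collect_cong conj_cong refl iffI ballI)
    fix A B assume "diag_by P A" "B \<in> {B. diag_by P B}"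
    then show "A ** B = B ** A" using diag_by_commute assms by blast
  next
    fix A assume c: "\<forall>B\<in>{B. diag_by P B}. A ** B = B ** A"
    show "diag_by P A" unfolding diag_by_def
    proof (intro allI impI)
      fix i j :: 'n assume ij: "i \<noteq> j"
      define B where "B = Ad (matrix_inv P) (dg (\<lambda>k. if k = i then 1 else 0))"
      have PB: "Ad P B = dg (\<lambda>k. if k = i then 1 else 0)" using assms by (simp add: B_def Ad_inverse)
      then have "diag_by P B" by (simp add: diag_by_def dg_nth)
      then have "B ** A = A ** B" using c by simp
      then have "Ad P A $ i $ j \<noteq> 0 \<longrightarrow> ev P B i = ev P B j"
        using commute_diag_iff[OF assms \<open>diag_by P B\<close>] by blast
      then show "Ad P A $ i $ j = 0" using ij by (auto simp: ev_def PB dg_nth)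
    qed
  qed
  then show ?thesis using zgroup_centralizer[of "{B. diag_by P B}"] by simp
qed

text \<open>
  The semisimple part \<open>S\<close> of an element centralizing the torus can be diagonalized together with
  it, so the torus and the one-parameter group of \<open>S\<close> generate a larger torus; maximality puts
  \<open>S\<close> into the Lie algebra of the torus.
\<close>

lemma maximal_torus_jordan:
  fixes G H :: "('n::finite) cmat set"
  assumes G: "zgroup G" and H: "maximal_torus G H" and X: "X \<in> lie_algebra G"
    and comm: "\<And>h. h \<in> lie_algebra H \<Longrightarrow> h ** X = X ** h"
  obtains S N k where "X = S + N" "S \<in> lie_algebra H" "mpow N k = 0"
    "\<And>Y. X ** Y = Y ** X \<Longrightarrow> N ** Y = Y ** N"
proof -
  have tor: "alg_torus H" "H \<subseteq> G" using H by (auto simp: maximal_torus_def)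
  obtain P where P: "zgroup H" "zariski_connected H" "invertible P" "\<And>A. A \<in> H \<Longrightarrow> diag_by P A"
    using alg_torusE[OF tor(1)] by blast
  obtain \<Lambda> :: "complex set" and E S N k \<Psi> where sf:
    "finite \<Lambda>" "(\<Sum>l\<in>\<Lambda>. E l) = mat 1"
    "\<And>l. l \<in> \<Lambda> \<Longrightarrow> S ** E l = cscale l (E l)"
    "\<And>Y l. X ** Y = Y ** X \<Longrightarrow> E l ** Y = Y ** E l"
    "S = (\<Sum>l\<in>\<Lambda>. cscale l (E l))" "X = S + N" "mpow N k = 0"
    "\<And>z w. flow (cscale z S + cscale w N) (\<lambda>t. \<Psi> (of_real t * z) (of_real t * w))"
    "\<And>i j. exp_poly (\<lambda>z w. \<Psi> z w $ i $ j)"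
    by (rule spectral_flow[of X]) blast
  have commS: "S ** Y = Y ** S" if "X ** Y = Y ** X" for Y
    unfolding sf(5) mult_sum_left mult_sum_right using sf(4)[OF that] by (simp add: mult_distribs)
  have commN: "N ** Y = Y ** N" if "X ** Y = Y ** X" for Y
  proof -
    have "N = X - S" using sf(6) by simp
    then show ?thesis using commS[OF that] that by (simp add: mult_distribs)
  qed
  have "\<Psi> z w \<in> G" for z w
    using lie_algebra_spectral_flow[OF G X[unfolded sf(6)] sf(8,9)] .
  moreover have "mexp S t = \<Psi> (of_real t) 0" for t using mexp_eqI[OF sf(8)[of 1 0]] by simp
  ultimately have SG: "mexp S t \<in> G" for t by simp
  have commH: "X ** A = A ** X" if "A \<in> H" for A
    using torus_commute[OF P comm that] by simp
  define Q where "Q = matrix_inv P"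
  have QP: "Q ** P = mat 1" "P ** Q = mat 1" using P(3) by (simp_all add: Q_def invertible_mult_inv)
  define V where "V = {E l *v column j Q | l j. l \<in> \<Lambda>}"
  have span: "vec.span V = UNIV"
  proof -
    have "column j Q \<in> vec.span V" for j
    proof -
      have "column j Q = (\<Sum>l\<in>\<Lambda>. E l) *v column j Q" by (simp add: sf(2))
      also have "\<dots> = (\<Sum>l\<in>\<Lambda>. E l *v column j Q)"
        using sf(1) by (induction rule: finite_induct) (simp_all add: matrix_vector_mult_add_rdistrib)
      also have "\<dots> \<in> vec.span V" by (intro vec.span_sum vec.span_base) (auto simp: V_def)
      finally show ?thesis .
    qed
    then have "columns Q \<subseteq> vec.span V" by (auto simp: columns_def)
    moreover have "vec.span (columns Q) = UNIV" using QP matrix_right_invertible_span_columns by metis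
    ultimately show ?thesis by (metis top.extremum_uniqueI vec.span_mono vec.span_span)
  qed
  have eig: "\<exists>c. A *v v = c *s v" if vA: "v \<in> V" "A \<in> insert S H" for v A
  proof -
    obtain l j where v: "v = E l *v column j Q" "l \<in> \<Lambda>" using vA(1) unfolding V_def by blast
    show ?thesis
    proof (cases "A = S")
      case True
      have "cscale l B *v x = l *s (B *v x)" for B :: "'n cmat" and x
        by (simp add: vec_eq_iff matrix_vector_mult_def sum_distrib_left mult_ac)
      then have "A *v v = l *s v"
        using sf(3)[OF v(2)] by (simp add: True v(1) matrix_vector_mul_assoc)
      then show ?thesis by blast
    next
      case False
      then have A: "A \<in> H" using that by simp
      have "A ** Q = Q ** dg (ev P A)"
        using P(4)[OF A] QP unfolding diag_by_iff Ad_def Q_def[symmetric]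
        by (metis matrix_mul_assoc matrix_mul_lid)
      then have "(A ** Q) $ r $ j = ev P A j * Q $ r $ j" for r by (simp add: dg_mult_right)
      then have Aq: "A *v column j Q = ev P A j *s column j Q"
        by (simp add: vec_eq_iff matrix_vector_mult_def matrix_matrix_mult_def column_def)
      have "A *v v = E l *v (A *v column j Q)"
        unfolding v(1) matrix_vector_mul_assoc sf(4)[OF commH[OF A]] ..
      also have "\<dots> = ev P A j *s v"
        unfolding Aq v(1) by (simp add: vec_eq_iff matrix_vector_mult_def sum_distrib_left mult_ac)
      finally show ?thesis by blast
    qed
  qed
  obtain P' where P': "invertible P'" "\<And>A. A \<in> insert S H \<Longrightarrow> diag_by P' A"
    using joint_diagonalization[OF span eig] by blast
  have Sdiag: "diag_by P' (mexp S t)" for t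
  proof -
    have "Ad P' (mexp S t) = mexp (dg (ev P' S)) t"
      using mexp_conjugate[OF P'(1), of S t] P'(2)[of S] by (simp add: diag_by_iff)
    then show ?thesis by (simp add: diag_by_def mexp_dg dg_nth)
  qed
  define R where "R = H \<union> range (mexp S)"
  define T where "T = zariski_generated R"
  have R: "invertible A" if "A \<in> R" for A
    using that P(1) zgroupD(5) invertible_mexp by (auto simp: R_def)
  have T: "zgroup T" unfolding T_def by (rule zgroup_zariski_generated) (rule R)
  have RT: "R \<subseteq> T" unfolding T_def by (rule zariski_generated_superset)
  have TG: "T \<subseteq> G" unfolding T_def using tor(2) SG by (intro zariski_generated_least[OF G]) (auto simp: R_def)
  have TD: "T \<subseteq> {A. invertible A \<and> diag_by P' A}"
    unfolding T_def using R P'(2) Sdiag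
    by (intro zariski_generated_least zgroup_diag_by[OF P'(1)]) (auto simp: R_def)
  have "connected_to_one R"
  proof -
    have "connected_to_one H" using connected_to_one_zariski_connected zgroupD(1,2) P by blast
    moreover have "connected_to_one (range (mexp S))"
      by (rule connected_to_one_connected[OF connected_mexp])
         (auto intro: invertible_mexp range_eqI[of _ _ 0])
    ultimately show ?thesis unfolding R_def using connected_to_one_Union[of "{H, range (mexp S)}"] by auto
  qed
  then have "zariski_connected T" unfolding T_def by (intro zariski_generated_connected R)
  then have "alg_torus T"
    unfolding alg_torus_def using zgroup_imp_algebraic_group[OF T] P'(1) TD
    by (auto simp: diag_by_def Ad_def)
  then have "T = H" using H RT TG unfolding maximal_torus_def R_def by blast
  then have "S \<in> lie_algebra H"
    using RT lie_algebra_flow[OF flow_mexp, of S H] by (auto simp: R_def)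
  then show ?thesis using that sf(6,7) commN by blast
qed

section \<open>Weight vectors\<close>

lemma lie_bracket_simps:
  "lie_bracket (A + B) C = lie_bracket A C + lie_bracket B C"
  "lie_bracket A (B + C) = lie_bracket A B + lie_bracket A C"
  "lie_bracket (A - B) C = lie_bracket A C - lie_bracket B C"
  "lie_bracket A (B - C) = lie_bracket A B - lie_bracket A C"
  "lie_bracket (cscale c A) B = cscale c (lie_bracket A B)"
  "lie_bracket A (cscale c B) = cscale c (lie_bracket A B)"
  "lie_bracket 0 B = 0" "lie_bracket A 0 = 0" "lie_bracket A A = 0"
  "lie_bracket (- A) B = - lie_bracket A B" "lie_bracket A (- B) = - lie_bracket A B"
  "lie_bracket (r *\<^sub>R A) B = r *\<^sub>R lie_bracket A B"
  "lie_bracket A (r *\<^sub>R B) = r *\<^sub>R lie_bracket A B"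
  by (simp_all add: lie_bracket_def mult_distribs cmat.scale_right_diff_distrib scaleR_diff_right)

lemma lie_bracket_antisym: "lie_bracket A B = - lie_bracket B A"
  by (simp add: lie_bracket_def)

lemma lie_bracket_mconj: "mconj (lie_bracket A B) = lie_bracket (mconj A) (mconj B)"
  by (simp add: lie_bracket_def)

lemma jacobi: "lie_bracket A (lie_bracket B C) = lie_bracket (lie_bracket A B) C + lie_bracket B (lie_bracket A C)"
  by (simp add: lie_bracket_def mult_distribs matrix_mul_assoc)

lemma lie_bracket_eq_0_iff: "lie_bracket A B = 0 \<longleftrightarrow> A ** B = B ** A"
  by (simp add: lie_bracket_def)

lemma Ad_bracket_diag:
  assumes "invertible P" "diag_by P h"
  shows "Ad P (lie_bracket h Y) $ i $ j = (ev P h i - ev P h j) * Ad P Y $ i $ j"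
proof -
  have D: "Ad P h = dg (ev P h)" using assms(2) by (simp add: diag_by_iff)
  show ?thesis unfolding Ad_bracket[OF assms(1)] D
    by (simp add: lie_bracket_def dg_mult_left dg_mult_right algebra_simps)
qed

lemma subspace_support:
  assumes "cmat.subspace U"
  shows "cmat.subspace {Y\<in>U. \<forall>a b. Ad P Y $ a $ b \<noteq> 0 \<longrightarrow> R a b}" (is "cmat.subspace ?A")
proof (rule cmat.subspaceI)
  fix x y assume xy: "x \<in> ?A" "y \<in> ?A"
  have "R a b" if nz: "Ad P (x + y) $ a $ b \<noteq> 0" for a b
  proof -
    have "Ad P x $ a $ b \<noteq> 0 \<or> Ad P y $ a $ b \<noteq> 0" using nz by (auto simp: Ad_simps)
    then show ?thesis using xy by blast
  qed
  then show "x + y \<in> ?A" using xy assms by (simp add: cmat.subspace_add)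
qed (use assms in \<open>auto simp: Ad_simps cmat.subspace_0 cmat.subspace_scale\<close>)

text \<open>
  The operator \<open>ad h - \<beta> h\<close>, divided by \<open>\<alpha> h - \<beta> h\<close>, kills the component of
  weight \<open>\<beta>\<close> and fixes the one of weight \<open>\<alpha>\<close>, for an \<open>h\<close> that separates the two
  weights.
\<close>

lemma weight_components:
  fixes P :: "('n::finite) cmat"
  assumes P: "invertible P" "\<And>h. h \<in> hh \<Longrightarrow> diag_by P h"
    and U: "cmat.subspace U" "\<And>h Y. h \<in> hh \<Longrightarrow> Y \<in> U \<Longrightarrow> lie_bracket h Y \<in> U"
    and w: "w = (\<lambda>i j h. if h \<in> hh then ev P h i - ev P h j else 0)"
    and S: "finite S" "\<alpha> \<notin> S" "\<And>\<beta> h. \<beta> \<in> insert \<alpha> S \<Longrightarrow> h \<notin> hh \<Longrightarrow> \<beta> h = (0 :: complex)" and Y: "Y \<in> U"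
  shows "\<exists>Y'\<in>U. \<forall>i j. (w i j = \<alpha> \<longrightarrow> Ad P Y' $ i $ j = Ad P Y $ i $ j) \<and>
    (w i j \<in> S \<longrightarrow> Ad P Y' $ i $ j = 0) \<and> (Ad P Y $ i $ j = 0 \<longrightarrow> Ad P Y' $ i $ j = 0)"
  using S
proof (induction rule: finite_induct)
  case empty
  then show ?case using Y by auto
next
  case (insert \<beta> S)
  have "\<exists>Y'\<in>U. \<forall>i j. (w i j = \<alpha> \<longrightarrow> Ad P Y' $ i $ j = Ad P Y $ i $ j) \<and>
    (w i j \<in> S \<longrightarrow> Ad P Y' $ i $ j = 0) \<and> (Ad P Y $ i $ j = 0 \<longrightarrow> Ad P Y' $ i $ j = 0)"
    by (rule insert.IH) (use insert.prems in auto)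
  then obtain Y' where Y': "Y' \<in> U" "\<And>i j. w i j = \<alpha> \<Longrightarrow> Ad P Y' $ i $ j = Ad P Y $ i $ j"
    "\<And>i j. w i j \<in> S \<Longrightarrow> Ad P Y' $ i $ j = 0" "\<And>i j. Ad P Y $ i $ j = 0 \<Longrightarrow> Ad P Y' $ i $ j = 0" by blast
  have "\<alpha> \<noteq> \<beta>" using insert.prems by auto
  then obtain h where h: "\<alpha> h \<noteq> \<beta> h" by blast
  then have hh: "h \<in> hh" using insert.prems(2)[of \<alpha> h] insert.prems(2)[of \<beta> h] by (metis insertCI)
  define Z where "Z = cscale (1 / (\<alpha> h - \<beta> h)) (lie_bracket h Y' - cscale (\<beta> h) Y')"
  have "Z \<in> U" unfolding Z_def using U Y' hh by (intro cmat.subspace_scale cmat.subspace_diff) auto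
  moreover have Z: "Ad P Z $ i $ j = (w i j h - \<beta> h) / (\<alpha> h - \<beta> h) * Ad P Y' $ i $ j" for i j
    using hh by (simp add: Z_def Ad_simps Ad_bracket_diag[OF P(1) P(2)[OF hh]] w left_diff_distrib diff_divide_distrib)
  have "\<forall>i j. (w i j = \<alpha> \<longrightarrow> Ad P Z $ i $ j = Ad P Y $ i $ j) \<and>
    (w i j \<in> insert \<beta> S \<longrightarrow> Ad P Z $ i $ j = 0) \<and> (Ad P Y $ i $ j = 0 \<longrightarrow> Ad P Z $ i $ j = 0)"
    unfolding Z using h Y' by auto
  ultimately show ?case by blast
qed

text \<open>
  The projection onto a weight space is a polynomial in the commuting operators \<open>ad h\<close>, so a
  stable subspace contains the components of its elements. This serves as an induction
  principle: a property that defines a subspace only has to be verified for weight vectors.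
\<close>

lemma weight_vectors_span:
  fixes P :: "('n::finite) cmat"
  assumes P: "invertible P" "\<And>h. h \<in> hh \<Longrightarrow> diag_by P h"
    and U: "cmat.subspace U" "\<And>h Y. h \<in> hh \<Longrightarrow> Y \<in> U \<Longrightarrow> lie_bracket h Y \<in> U"
    and A: "cmat.subspace A"
    and wt: "\<And>Y \<alpha>. Y \<in> U \<Longrightarrow> (\<And>h. h \<notin> hh \<Longrightarrow> \<alpha> h = 0) \<Longrightarrow>
      (\<And>h. h \<in> hh \<Longrightarrow> lie_bracket h Y = cscale (\<alpha> h) Y) \<Longrightarrow> Y \<in> A"
  shows "U \<subseteq> A"
proof
  fix Y assume Y: "Y \<in> U"
  define w where "w = (\<lambda>i j h. if h \<in> hh then ev P h i - ev P h j else 0)"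
  define W where "W = range (\<lambda>(i, j). w i j)"
  have W: "finite W" by (simp add: W_def)
  have wW: "w i j \<in> W" for i j by (auto simp: W_def)
  have "\<exists>Z\<in>U. \<forall>i j. Ad P Z $ i $ j = (if w i j = \<alpha> then Ad P Y $ i $ j else 0)" if a: "\<alpha> \<in> W" for \<alpha>
  proof -
    have "\<exists>Y'\<in>U. \<forall>i j. (w i j = \<alpha> \<longrightarrow> Ad P Y' $ i $ j = Ad P Y $ i $ j) \<and>
      (w i j \<in> W - {\<alpha>} \<longrightarrow> Ad P Y' $ i $ j = 0) \<and> (Ad P Y $ i $ j = 0 \<longrightarrow> Ad P Y' $ i $ j = 0)"
      by (rule weight_components[OF P U w_def _ _ _ Y]) (use W a in \<open>auto simp: W_def w_def\<close>)
    then obtain Y' where Y': "Y' \<in> U" "\<And>i j. w i j = \<alpha> \<Longrightarrow> Ad P Y' $ i $ j = Ad P Y $ i $ j"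
      "\<And>i j. w i j \<in> W - {\<alpha>} \<Longrightarrow> Ad P Y' $ i $ j = 0" by blast
    then show ?thesis using wW by (intro bexI[of _ Y']) auto
  qed
  then obtain f where f: "\<And>\<alpha>. \<alpha> \<in> W \<Longrightarrow> f \<alpha> \<in> U"
    "\<And>\<alpha> i j. \<alpha> \<in> W \<Longrightarrow> Ad P (f \<alpha>) $ i $ j = (if w i j = \<alpha> then Ad P Y $ i $ j else 0)" by metis
  have fA: "f \<alpha> \<in> A" if a: "\<alpha> \<in> W" for \<alpha>
  proof (rule wt[of _ \<alpha>])
    show "f \<alpha> \<in> U" using f a by blast
    show "\<alpha> h = 0" if "h \<notin> hh" for h using that a by (auto simp: W_def w_def)
    show "lie_bracket h (f \<alpha>) = cscale (\<alpha> h) (f \<alpha>)" if "h \<in> hh" for h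
    proof -
      have "Ad P (lie_bracket h (f \<alpha>)) = Ad P (cscale (\<alpha> h) (f \<alpha>))"
        using that f(2)[OF a] by (auto simp: vec_eq_iff Ad_bracket_diag[OF P(1) P(2)] Ad_simps w_def)
      then show ?thesis by (simp add: Ad_eq_iff P)
    qed
  qed
  have "Ad P Y = Ad P (\<Sum>\<alpha>\<in>W. f \<alpha>)"
  proof -
    have "Ad P (\<Sum>\<alpha>\<in>W. f \<alpha>) $ i $ j = Ad P Y $ i $ j" for i j
    proof -
      have "Ad P (\<Sum>\<alpha>\<in>W. f \<alpha>) = (\<Sum>\<alpha>\<in>W. Ad P (f \<alpha>))"
        using linear_sum[OF bounded_linear.linear[OF bounded_linear_Ad]] .
      then have "Ad P (\<Sum>\<alpha>\<in>W. f \<alpha>) $ i $ j = (\<Sum>\<alpha>\<in>W. if w i j = \<alpha> then Ad P Y $ i $ j else 0)"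
        using f(2) by (simp add: sum_component)
      then show ?thesis using W wW by simp
    qed
    then show ?thesis by (simp add: vec_eq_iff)
  qed
  then have "Y = (\<Sum>\<alpha>\<in>W. f \<alpha>)" by (simp add: Ad_eq_iff P)
  then show "Y \<in> A" using fA A by (auto intro: cmat.subspace_sum)
qed

section \<open>Nilpotent matrices\<close>

lemma trace_zero: "trace (0 :: ('n::finite) cmat) = 0"
  by (simp add: trace_def)

text \<open>
  The image of \<open>N ** p (j + 1)\<close> lies in the kernel of the \<open>j\<close>-th power, where the projection
  \<open>p j\<close> is the identity. Cyclicity of the trace thus lowers the index, down to the zero
  projection.
\<close>

lemma trace_nilpotent:
  fixes N :: "('n::finite) cmat"
  assumes "mpow N k = 0" shows "trace N = 0"
proof -
  have "\<exists>G. A ** G ** A = A" for A :: "'n cmat"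
  proof -
    obtain g where g: "Vector_Spaces.linear (*s) (*s) g" "\<forall>v\<in>range ((*v) A). A *v g v = v"
      using vec.linear_exists_right_inverse_on[OF matrix_vector_mul_linear_gen[of A] vec.subspace_UNIV] by blast
    have "(A ** matrix g ** A) *v x = A *v x" for x
    proof -
      have "(A ** matrix g ** A) *v x = A *v (matrix g *v (A *v x))"
        by (simp add: matrix_vector_mul_assoc matrix_mul_assoc)
      then show ?thesis using g by (simp add: matrix_works)
    qed
    then show ?thesis by (auto simp: matrix_eq)
  qed
  then obtain g where g: "A ** g A ** A = A" for A :: "'n cmat" by metis
  \<comment> \<open>\<open>p j\<close> projects onto the kernel of the \<open>j\<close>-th power.\<close>
  define p where "p j = mat 1 - g (mpow N j) ** mpow N j" for j
  have kill: "mpow N j ** p j = 0" for j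
    using g[of "mpow N j"] by (simp add: p_def mult_distribs matrix_mul_assoc)
  have fixed: "p j ** X = X" if "mpow N j ** X = 0" for j and X :: "'n cmat"
  proof -
    have "g (mpow N j) ** mpow N j ** X = 0" using that by (simp add: mult_distribs flip: matrix_mul_assoc)
    then show ?thesis by (simp add: p_def mult_distribs)
  qed
  have step: "trace (N ** p (Suc j)) = trace (N ** p j)" for j
  proof -
    have "mpow N j ** (N ** p (Suc j)) = 0"
      using kill[of "Suc j"] by (simp only: mpow_Suc_right matrix_mul_assoc)
    then have "trace (N ** p (Suc j)) = trace (p j ** (N ** p (Suc j)))" by (simp add: fixed)
    also have "\<dots> = trace (N ** (p (Suc j) ** p j))" by (subst trace_mul_sym) (simp add: matrix_mul_assoc)
    also have "p (Suc j) ** p j = p j"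
      by (rule fixed) (simp add: kill mult_distribs flip: matrix_mul_assoc)
    finally show ?thesis .
  qed
  have "trace (N ** p j) = trace (N ** p 0)" for j
    by (induction j) (simp_all add: step)
  moreover have "p 0 = 0" using kill[of 0] by simp
  moreover have "p k = mat 1" using assms by (simp add: p_def mult_distribs)
  ultimately have "trace (N ** mat 1) = trace (N ** 0)" by metis
  then show ?thesis by (simp add: mult_distribs trace_zero)
qed

lemma nilpotent_mult:
  assumes "mpow N k = 0" "N ** S = S ** N" shows "mpow (N ** S) k = 0"
  using assms by (simp add: mpow_mult_commute mult_distribs)

text \<open>
  The powers of \<open>X\<close> have the weights \<open>k * c\<close>, and only finitely many numbers are differences of
  eigenvalues of \<open>h\<close>.
\<close>

lemma weight_vector_nilpotent:
  fixes P :: "('n::finite) cmat"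
  assumes P: "invertible P" "diag_by P h" and X: "lie_bracket h X = cscale c X" "c \<noteq> 0"
  shows "\<exists>k. mpow X k = 0"
proof (rule ccontr)
  assume nz: "\<nexists>k. mpow X k = 0"
  have br: "lie_bracket h (mpow X k) = cscale (of_nat k * c) (mpow X k)" for k
  proof (induction k)
    case 0
    then show ?case by (simp add: lie_bracket_def)
  next
    case (Suc k)
    have "lie_bracket h (X ** mpow X k) = lie_bracket h X ** mpow X k + X ** lie_bracket h (mpow X k)"
      by (simp add: lie_bracket_def mult_distribs matrix_mul_assoc)
    then show ?case by (simp add: Suc X mult_distribs algebra_simps flip: cmat.scale_left_distrib)
  qed
  have "of_nat k * c \<in> range (\<lambda>(i, j). ev P h i - ev P h j)" for k
  proof -
    have "Ad P (mpow X k) \<noteq> 0" using nz Ad_eq_iff[OF P(1), of "mpow X k" 0] by (simp add: Ad_simps)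
    then obtain i j where ij: "Ad P (mpow X k) $ i $ j \<noteq> 0" by (auto simp: vec_eq_iff)
    have "(ev P h i - ev P h j) * Ad P (mpow X k) $ i $ j = of_nat k * c * Ad P (mpow X k) $ i $ j"
      using Ad_bracket_diag[OF P, of "mpow X k" i j] by (auto simp: br Ad_simps)
    then have "of_nat k * c = ev P h i - ev P h j" using ij by auto
    then show ?thesis by auto
  qed
  then have "range (\<lambda>k. of_nat k * c) \<subseteq> range (\<lambda>(i, j). ev P h i - ev P h j)" by auto
  then have "finite (range (\<lambda>k. of_nat k * c))" by (rule finite_subset) simp
  moreover have "inj (\<lambda>k. of_nat k * c)" using X(2) by (auto simp: inj_on_def)
  ultimately show False using finite_imageD infinite_UNIV_nat by blast
qed

text \<open>
  The \<open>m\<close>-th iterate is a combination of the products of \<open>u\<close> with \<open>i\<close> factors \<open>X\<close> on the left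
  and \<open>j\<close> factors on the right, for \<open>i + j = m\<close>.
\<close>

lemma nilpotent_bracket:
  assumes "mpow X k = 0" shows "\<exists>m. (lie_bracket X ^^ m) u = 0"
proof -
  define Z where "Z m = cmat.span {mpow X i ** u ** mpow X j | i j. i + j = m}" for m
  have "lie_bracket X y \<in> Z (Suc m)" if "y \<in> Z m" for y m
    using that unfolding Z_def
  proof (induction rule: cmat.span_induct_alt)
    case base
    then show ?case by (simp add: lie_bracket_simps cmat.span_zero)
  next
    case (step c x y)
    then obtain i j where ij: "x = mpow X i ** u ** mpow X j" "i + j = m" by blast
    have "lie_bracket X x = mpow X (Suc i) ** u ** mpow X j - mpow X i ** u ** mpow X (Suc j)"
      unfolding ij(1) mpow_Suc_right[of X j] by (simp add: lie_bracket_def matrix_mul_assoc)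
    also have "\<dots> \<in> cmat.span {mpow X i ** u ** mpow X j | i j. i + j = Suc m}"
    proof (intro cmat.span_diff cmat.span_base CollectI)
      show "\<exists>i' j'. mpow X (Suc i) ** u ** mpow X j = mpow X i' ** u ** mpow X j' \<and> i' + j' = Suc m"
        using ij(2) by (intro exI[of _ "Suc i"] exI[of _ j]) simp
      show "\<exists>i' j'. mpow X i ** u ** mpow X (Suc j) = mpow X i' ** u ** mpow X j' \<and> i' + j' = Suc m"
        using ij(2) by (intro exI[of _ i] exI[of _ "Suc j"]) simp
    qed
    finally show ?case using step by (simp add: lie_bracket_simps cmat.span_add cmat.span_scale)
  qed
  then have "(lie_bracket X ^^ m) u \<in> Z m" for m
  proof (induction m)
    case 0
    have "u = mpow X 0 ** u ** mpow X 0" by simp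
    then show ?case unfolding Z_def by (intro cmat.span_base CollectI exI[of _ 0]) simp
  qed simp
  moreover have "Z (k + k) \<subseteq> {0}"
  proof -
    have "mpow X i = 0 \<or> mpow X j = 0" if "i + j = k + k" for i j
      using that assms mpow_zero_mono[of X k i] mpow_zero_mono[of X k j] by linarith
    then have "mpow X i ** u ** mpow X j = 0" if "i + j = k + k" for i j
      using that by (metis mult_zero_left mult_zero_right)
    then have "{mpow X i ** u ** mpow X j | i j. i + j = k + k} \<subseteq> {0}" by auto
    then show ?thesis unfolding Z_def by (intro cmat.span_minimal) (auto simp: cmat.subspace_def)
  qed
  ultimately show ?thesis by blast
qed

text \<open>
  Engel's theorem in the form of Jacobson: only the homogeneous elements of \<open>L\<close> for the grading
  by the weights of \<open>hh\<close> have to be nilpotent. A maximal proper graded subalgebra has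
  codimension one and a homogeneous complement, and one inducts on the dimension. The module is
  a quotient \<open>B / A\<close>, because the induction hypothesis for a subalgebra \<open>K\<close> is applied both to
  \<open>L / K\<close> and to the given module.
\<close>

lemma graded_engel:
  fixes P :: "('n::finite) cmat"
  assumes P: "invertible P" "\<And>h. h \<in> hh \<Longrightarrow> diag_by P h"
  shows "\<lbrakk>cmat.subspace L; \<And>x y. x \<in> L \<Longrightarrow> y \<in> L \<Longrightarrow> lie_bracket x y \<in> L;
    \<And>h x. h \<in> hh \<Longrightarrow> x \<in> L \<Longrightarrow> lie_bracket h x \<in> L;
    \<And>x \<alpha>. x \<in> L \<Longrightarrow> (\<And>h. h \<in> hh \<Longrightarrow> lie_bracket h x = cscale (\<alpha> h) x) \<Longrightarrow> \<exists>k. mpow x k = 0;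
    cmat.subspace A; cmat.subspace B; A \<subset> B;
    \<And>x y. x \<in> L \<union> hh \<Longrightarrow> y \<in> A \<Longrightarrow> lie_bracket x y \<in> A;
    \<And>x y. x \<in> L \<union> hh \<Longrightarrow> y \<in> B \<Longrightarrow> lie_bracket x y \<in> B\<rbrakk>
    \<Longrightarrow> \<exists>b\<in>B - A. \<forall>x\<in>L. lie_bracket x b \<in> A"
proof (induction "dim L" arbitrary: L A B rule: less_induct)
  case less
  note L = less.prems(1-3) and nil = less.prems(4) and AB = less.prems(5-9)
  show ?case
  proof (cases "L = {0}")
    case True
    then show ?thesis using AB(1,3) by (auto simp: lie_bracket_simps cmat.subspace_0)
  next
    case False
    \<comment> \<open>The proper graded subalgebras of \<open>L\<close>; let \<open>K\<close> be one of maximal dimension.\<close>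
    define good where "good K \<longleftrightarrow> cmat.subspace K \<and> (\<forall>x\<in>K. \<forall>y\<in>K. lie_bracket x y \<in> K) \<and>
      (\<forall>h\<in>hh. \<forall>x\<in>K. lie_bracket h x \<in> K) \<and> K \<subset> L" for K
    have "{0} \<subset> L" using False cmat.subspace_0[OF L(1)] by blast
    then have "good {0}" by (auto simp: good_def lie_bracket_simps cmat.subspace_single_0)
    moreover have lt: "dim K < dim L" if "good K" for K
    proof -
      have "K \<subset> L" "subspace K" "subspace L" using that L(1) by (auto simp: good_def intro: subspace_real_of_complex)
      then show ?thesis by (intro dim_psubset) (simp add: span_eq_iff[THEN iffD2])
    qed
    ultimately obtain K where K: "good K" "\<And>K'. good K' \<Longrightarrow> dim K' \<le> dim K"
      using ex_has_greatest_nat[of good "{0}" dim "dim L"] by blast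
    have Ksub: "cmat.subspace K" "K \<subseteq> L" and Kbr: "\<And>x y. x \<in> K \<Longrightarrow> y \<in> K \<Longrightarrow> lie_bracket x y \<in> K"
      and Kh: "\<And>h x. h \<in> hh \<Longrightarrow> x \<in> K \<Longrightarrow> lie_bracket h x \<in> K" and KL: "K \<subset> L"
      using K(1) by (auto simp: good_def)
    have nilK: "\<exists>k. mpow x k = 0" if "x \<in> K" "\<And>h. h \<in> hh \<Longrightarrow> lie_bracket h x = cscale (\<alpha> h) x" for x \<alpha>
      using nil[of x \<alpha>] that Ksub(2) by blast
    have IH: "\<exists>b\<in>B' - A'. \<forall>x\<in>K. lie_bracket x b \<in> A'"
      if "cmat.subspace A'" "cmat.subspace B'" "A' \<subset> B'"
        "\<And>x y. x \<in> K \<union> hh \<Longrightarrow> y \<in> A' \<Longrightarrow> lie_bracket x y \<in> A'"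
        "\<And>x y. x \<in> K \<union> hh \<Longrightarrow> y \<in> B' \<Longrightarrow> lie_bracket x y \<in> B'" for A' B'
      by (rule less.hyps[OF lt[OF K(1)] Ksub(1) Kbr Kh nilK that])
    have Kneg: "lie_bracket x y \<in> K" if "lie_bracket y x \<in> K" for x y
      using that Ksub(1) lie_bracket_antisym[of x y] by (simp add: cmat.subspace_neg)
    \<comment> \<open>The normalizer of \<open>K\<close>. It contains a homogeneous \<open>x\<close> outside \<open>K\<close>, and \<open>K + x\<close> is again a graded subalgebra.\<close>
    define U where "U = {x\<in>L. \<forall>k\<in>K. lie_bracket k x \<in> K}"
    have "\<exists>b\<in>L - K. \<forall>x\<in>K. lie_bracket x b \<in> K"
      using IH[OF Ksub(1) L(1) KL] Kbr Kh L Ksub by blast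
    then have UK: "\<not> U \<subseteq> K" by (auto simp: U_def)
    have Usub: "cmat.subspace U"
      using L(1) Ksub(1) unfolding U_def
      by (intro cmat.subspaceI) (auto simp: lie_bracket_simps intro: cmat.subspace_0 cmat.subspace_add cmat.subspace_scale)
    have "lie_bracket h x \<in> U" if "h \<in> hh" "x \<in> U" for h x
    proof -
      have "lie_bracket k (lie_bracket h x) \<in> K" if "k \<in> K" for k
        unfolding jacobi[of k h x]
        using that \<open>h \<in> hh\<close> \<open>x \<in> U\<close> Kneg Kh by (intro cmat.subspace_add[OF Ksub(1)]) (auto simp: U_def)
      then show ?thesis using that L(3) by (auto simp: U_def)
    qed
    note Ustable = this
    have "\<exists>x \<alpha>. x \<in> U \<and> x \<notin> K \<and> (\<forall>h\<in>hh. lie_bracket h x = cscale (\<alpha> h) x)"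
    proof (rule ccontr)
      assume no: "\<not> ?thesis"
      have "U \<subseteq> K" by (rule weight_vectors_span[OF P Usub Ustable Ksub(1)]) (use no in blast)+
      then show False using UK by blast
    qed
    then obtain x \<alpha> where x: "x \<in> U" "x \<notin> K" "\<And>h. h \<in> hh \<Longrightarrow> lie_bracket h x = cscale (\<alpha> h) x"
      by blast
    have xL: "x \<in> L" and xK: "\<And>k. k \<in> K \<Longrightarrow> lie_bracket k x \<in> K" using x by (auto simp: U_def)
    define K' where "K' = {k + cscale c x | k c. k \<in> K}"
    have K'sub: "cmat.subspace K'"
    proof (rule cmat.subspaceI)
      show "0 \<in> K'" unfolding K'_def using cmat.subspace_0[OF Ksub(1)]
        by (intro CollectI exI[of _ 0]) simp
      show "y + z \<in> K'" if yz: "y \<in> K'" "z \<in> K'" for y z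
      proof -
        obtain k c k' c' where "y = k + cscale c x" "z = k' + cscale c' x" "k \<in> K" "k' \<in> K"
          using yz unfolding K'_def by blast
        then have "y + z = (k + k') + cscale (c + c') x" "k + k' \<in> K"
          using cmat.subspace_add[OF Ksub(1)] by (auto simp: cmat.scale_left_distrib)
        then show ?thesis unfolding K'_def by blast
      qed
      show "cscale a y \<in> K'" if y: "y \<in> K'" for a y
      proof -
        obtain k c where "y = k + cscale c x" "k \<in> K" using y unfolding K'_def by blast
        then have "cscale a y = cscale a k + cscale (a * c) x" "cscale a k \<in> K"
          using cmat.subspace_scale[OF Ksub(1)] by (auto simp: cmat.scale_right_distrib)
        then show ?thesis unfolding K'_def by blast
      qed
    qed
    have K'I: "k + cscale c x \<in> K'" if "k \<in> K" for k c using that by (auto simp: K'_def)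
    have KK': "K \<subseteq> K'" using K'I[of _ 0] by auto
    have K'L: "K' \<subseteq> L" using L(1) xL Ksub(2)
      by (auto simp: K'_def intro!: cmat.subspace_add cmat.subspace_scale)
    have "x \<in> K'" using K'I[of 0 1] cmat.subspace_0[OF Ksub(1)] by simp
    then have "K \<subset> K'" using KK' x(2) by blast
    then have big: "dim K < dim K'"
      using subspace_real_of_complex[OF Ksub(1)] subspace_real_of_complex[OF K'sub]
      by (intro dim_psubset) (simp add: span_eq_iff[THEN iffD2])
    have K'K: "lie_bracket y z \<in> K" if yz: "y \<in> K'" "z \<in> K'" for y z
    proof -
      obtain k c k' c' where e: "y = k + cscale c x" "z = k' + cscale c' x" "k \<in> K" "k' \<in> K"
        using yz unfolding K'_def by blast
      have "lie_bracket y z = lie_bracket k k' + cscale c' (lie_bracket k x) + cscale c (lie_bracket x k')"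
        by (simp add: e lie_bracket_simps cmat.scale_right_distrib)
      then show ?thesis using e Kbr xK Kneg
        by (simp add: cmat.subspace_add[OF Ksub(1)] cmat.subspace_scale[OF Ksub(1)])
    qed
    have "\<not> K' \<subset> L"
    proof
      assume "K' \<subset> L"
      moreover have "lie_bracket h y \<in> K'" if hy: "h \<in> hh" "y \<in> K'" for h y
      proof -
        obtain k c where "y = k + cscale c x" "k \<in> K" using hy unfolding K'_def by blast
        then show ?thesis using hy K'I[OF Kh] by (simp add: lie_bracket_simps x(3))
      qed
      ultimately have "good K'" using K'sub K'K KK' by (auto simp: good_def)
      then show False using K(2) big by fastforce
    qed
    then have LK: "L = K'" using K'L by blast
    \<comment> \<open>The elements of \<open>B\<close> that \<open>K\<close> maps to \<open>A\<close>. They are stable under \<open>x\<close>, which acts nilpotently.\<close>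
    define U' where "U' = {b\<in>B. \<forall>k\<in>K. lie_bracket k b \<in> A}"
    obtain b0 where b0: "b0 \<in> B - A" "\<And>k. k \<in> K \<Longrightarrow> lie_bracket k b0 \<in> A"
      using IH[OF AB(1-3)] AB(4,5) Ksub(2) by blast
    obtain r where "mpow x r = 0" using nil[OF xL x(3)] by blast
    then obtain m0 where m0: "(lie_bracket x ^^ m0) b0 = 0" using nilpotent_bracket by blast
    have U': "(lie_bracket x ^^ m) b0 \<in> U'" for m
    proof (induction m)
      case 0
      then show ?case using b0 by (simp add: U'_def)
    next
      case (Suc m)
      let ?u = "(lie_bracket x ^^ m) b0"
      have "lie_bracket k (lie_bracket x ?u) \<in> A" if k: "k \<in> K" for k
        unfolding jacobi[of k x ?u] using Suc xK[OF k] AB(4) xL k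
        by (intro cmat.subspace_add[OF AB(1)]) (auto simp: U'_def)
      then show ?case using Suc AB(5) xL by (simp add: U'_def)
    qed
    define m where "m = (LEAST m. (lie_bracket x ^^ m) b0 \<in> A)"
    have mA: "(lie_bracket x ^^ m) b0 \<in> A"
      unfolding m_def by (rule LeastI[of _ m0]) (simp add: m0 cmat.subspace_0[OF AB(1)])
    then have "m \<noteq> 0" using b0(1) by (metis DiffE funpow_0)
    then obtain n where n: "m = Suc n" using not0_implies_Suc by blast
    let ?u = "(lie_bracket x ^^ n) b0"
    have uA: "?u \<notin> A" using not_less_Least[of n "\<lambda>m. (lie_bracket x ^^ m) b0 \<in> A"] n by (simp add: m_def)
    have xu: "lie_bracket x ?u \<in> A" using mA by (simp add: n)
    have "lie_bracket y ?u \<in> A" if y: "y \<in> L" for y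
    proof -
      obtain k c where "y = k + cscale c x" "k \<in> K" using y unfolding LK K'_def by blast
      then show ?thesis using U'[of n] xu
        by (simp add: lie_bracket_simps U'_def cmat.subspace_add[OF AB(1)] cmat.subspace_scale[OF AB(1)])
    qed
    then show ?thesis using U'[of n] uA by (auto simp: U'_def)
  qed
qed

section \<open>A compact maximal torus is its own centralizer\<close>

text \<open>
  The one-parameter group of \<open>A\<close> stays in a bounded set, so the exponentials of the real
  multiples of its eigenvalues are bounded.
\<close>

lemma compact_torus_ev_imaginary:
  fixes H :: "('n::finite) cmat set"
  assumes H: "zgroup H" and P: "invertible P" "\<And>A. A \<in> H \<Longrightarrow> diag_by P A"
    and c: "compact (real_points H)" and A: "A \<in> lie_algebra H" "mconj A = A"
  shows "Re (ev P A i) = 0"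
proof (rule ccontr)
  assume nz: "Re (ev P A i) \<noteq> 0"
  have D: "diag_by P A" using lie_algebra_diag[OF H P A(1)] .
  have "mexp A t \<in> real_points H" for t
    using lie_algebra_mexp[OF H A(1), of t] mexp_mconj[of A t] A(2) by (simp add: real_points_def)
  moreover have "bounded ((\<lambda>X. Ad P X $ i $ i) ` real_points H)"
  proof (rule bounded_linear_image[OF compact_imp_bounded[OF c]])
    show "bounded_linear (\<lambda>X. Ad P X $ i $ i)"
      by (rule bounded_linear_compose[OF bounded_linear_vec_nth
            bounded_linear_compose[OF bounded_linear_vec_nth bounded_linear_Ad]])
  qed
  then obtain C where C: "\<And>X. X \<in> real_points H \<Longrightarrow> cmod (Ad P X $ i $ i) \<le> C"
    unfolding bounded_iff by blast
  ultimately have "cmod (ev P (mexp A t) i) \<le> C" for t by (simp add: ev_def)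
  then have b: "exp (t * Re (ev P A i)) \<le> C" for t
    by (simp add: ev_mexp[OF P(1) D])
  have "1 + C \<le> exp C" by (rule exp_ge_add_one_self)
  also have "exp C \<le> C" using b[of "C / Re (ev P A i)"] nz by simp
  finally show False by simp
qed

text \<open>
  \<open>S\<close> is a complex combination of the real elements \<open>S + mconj S\<close> and \<open>\<i> (S - mconj S)\<close>,
  whose eigenvalues are imaginary.
\<close>

lemma compact_torus_ev_mconj:
  fixes H :: "('n::finite) cmat set"
  assumes H: "zgroup H" "\<And>A. A \<in> H \<Longrightarrow> mconj A \<in> H" and P: "invertible P" "\<And>A. A \<in> H \<Longrightarrow> diag_by P A"
    and c: "compact (real_points H)" and S: "S \<in> lie_algebra H"
  shows "ev P (mconj S) i = - cnj (ev P S i)"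
proof -
  define A where "A = S + mconj S"
  define B where "B = cscale \<i> (S - mconj S)"
  have sub: "cmat.subspace (lie_algebra H)" by (rule lie_algebra_subspace[OF H(1)])
  have "mconj S \<in> lie_algebra H" using lie_algebra_mconj[OF H S] .
  then have "A \<in> lie_algebra H" "B \<in> lie_algebra H"
    unfolding A_def B_def using S sub
    by (auto intro: cmat.subspace_add cmat.subspace_scale cmat.subspace_diff)
  moreover have "mconj A = A" by (simp add: A_def)
  moreover have "mconj B = B" by (simp add: B_def cmat.scale_right_diff_distrib)
  ultimately have "Re (ev P A i) = 0" "Re (ev P B i) = 0"
    using compact_torus_ev_imaginary[OF H(1) P c] by blast+
  moreover have "ev P A i = ev P S i + ev P (mconj S) i" "ev P B i = \<i> * (ev P S i - ev P (mconj S) i)"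
    by (simp_all add: A_def B_def ev_def Ad_simps)
  ultimately show ?thesis by (simp add: complex_eq_iff)
qed

lemma trace_ev:
  assumes "invertible P" "diag_by P S" "diag_by P S'"
  shows "trace (S ** S') = (\<Sum>i\<in>UNIV. ev P S i * ev P S' i)"
proof -
  have "trace (S ** S') = trace (Ad P (S ** S'))" using trace_Ad[OF assms(1)] by simp
  also have "Ad P (S ** S') = dg (ev P S) ** dg (ev P S')"
    using assms by (simp add: Ad_mult diag_by_iff)
  finally show ?thesis by (simp add: dg_mult trace_def dg_nth)
qed

lemma trace_bracket: "trace (lie_bracket Z X ** Y) = trace (X ** lie_bracket Y Z)"
  using trace_mul_sym[of Z "X ** Y"]
  by (simp add: lie_bracket_def mult_distribs trace_sub matrix_mul_assoc)

lemma trace_cscale: "trace (cscale c A) = c * trace A"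
  by (simp add: trace_def sum_distrib_left)

text \<open>
  Compactness makes the trace form nondegenerate on the Lie algebra of the torus. By the Jordan
  decomposition, an element of the centralizer that is orthogonal to this Lie algebra is
  nilpotent. Hence the homogeneous elements of the radical \<open>r\<close> of the trace form on the Lie
  algebra of \<open>G\<close> are nilpotent, and if \<open>r\<close> were nonzero, Engel's theorem would provide it with a
  nonzero centre, which is an abelian ideal. So \<open>r\<close> is zero. On the other hand, the sum of two
  nilpotent elements of the centralizer is still orthogonal to the torus, hence nilpotent, and
  polarization shows that the two are orthogonal to each other. So these nilpotents lie in \<open>r\<close>
  and vanish; the Jordan decomposition leaves only the Lie algebra of the torus.
\<close>

theorem compact_maximal_torus_centralizer:
  fixes G H :: "('n::finite) cmat set"
  assumes G: "zgroup G" "semisimple_group G" and H: "maximal_torus G H"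
    and real: "\<And>A. A \<in> H \<Longrightarrow> mconj A \<in> H" and c: "compact (real_points H)"
    and X: "X \<in> lie_algebra G" "\<And>h. h \<in> lie_algebra H \<Longrightarrow> lie_bracket h X = 0"
  shows "X \<in> lie_algebra H"
proof -
  define \<gg> where "\<gg> = lie_algebra G"
  define hh where "hh = lie_algebra H"
  have "alg_torus H" using H by (simp add: maximal_torus_def)
  then obtain P where P: "zgroup H" "zariski_connected H" "invertible P" "\<And>A. A \<in> H \<Longrightarrow> diag_by P A"
    using alg_torusE by blast
  have sub: "cmat.subspace \<gg>" "cmat.subspace hh"
    unfolding \<gg>_def hh_def using lie_algebra_subspace G P by blast+
  have hg: "hh \<subseteq> \<gg>" unfolding \<gg>_def hh_def using H lie_algebra_mono by (auto simp: maximal_torus_def)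
  have br: "lie_bracket x y \<in> \<gg>" if "x \<in> \<gg>" "y \<in> \<gg>" for x y
    using that lie_algebra_bracket[OF G(1)] by (simp add: \<gg>_def)
  have D: "diag_by P h" if "h \<in> hh" for h
    using lie_algebra_diag[OF P(1,3,4)] that by (simp add: hh_def)
  have hcomm: "h ** h' = h' ** h" if "h \<in> hh" "h' \<in> hh" for h h'
    using diag_by_commute[OF P(3) D D] that by blast
  define g0 where "g0 = {X\<in>\<gg>. \<forall>h\<in>hh. h ** X = X ** h}"
  have hg0: "hh \<subseteq> g0" using hg hcomm by (auto simp: g0_def)
  have g0_add: "x + y \<in> g0" if "x \<in> g0" "y \<in> g0" for x y
    using that sub(1) by (auto simp: g0_def mult_distribs cmat.subspace_add)
  have g0_diff: "x - y \<in> g0" if "x \<in> g0" "y \<in> g0" for x y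
    using that sub(1) by (auto simp: g0_def mult_distribs cmat.subspace_diff)
  have jordan: "\<exists>S\<in>hh. \<exists>N\<in>g0. x = S + N \<and> (\<exists>k. mpow N k = 0)" if x: "x \<in> g0" for x
  proof -
    have x': "x \<in> lie_algebra G" "h ** x = x ** h" if "h \<in> lie_algebra H" for h
      using x that by (auto simp: g0_def \<gg>_def hh_def)
    have xG: "x \<in> lie_algebra G" using x by (simp add: g0_def \<gg>_def)
    obtain S N k where SN: "x = S + N" "S \<in> lie_algebra H" "mpow N k = 0"
      by (rule maximal_torus_jordan[OF G(1) H xG x'(2)], assumption, rule that)
    then have "N = x - S" by simp
    then have "N \<in> g0" using g0_diff[OF x] SN(2) hg0 by (auto simp: hh_def)
    then show ?thesis using SN by (auto simp: hh_def)
  qed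
  have tr0: "trace (N ** S) = 0" if "mpow N k = 0" "N \<in> g0" "S \<in> hh" for N S k
  proof -
    have "N ** S = S ** N" using that by (auto simp: g0_def)
    then show ?thesis using trace_nilpotent nilpotent_mult that(1) by blast
  qed
  have nondeg: "S = 0" if S: "S \<in> hh" "\<And>S'. S' \<in> hh \<Longrightarrow> trace (S ** S') = 0" for S
  proof -
    have S': "mconj S \<in> hh" using lie_algebra_mconj[OF P(1) real] S by (simp add: hh_def)
    have "0 = trace (S ** mconj S)" using S S' by simp
    also have "\<dots> = (\<Sum>i\<in>UNIV. ev P S i * ev P (mconj S) i)"
      using trace_ev[OF P(3) D[OF S(1)] D[OF S']] .
    also have "\<dots> = (\<Sum>i\<in>UNIV. - of_real ((cmod (ev P S i))\<^sup>2))"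
      using compact_torus_ev_mconj[OF P(1) real P(3,4) c] S(1)
      by (intro sum.cong) (auto simp: hh_def complex_norm_square[symmetric])
    also have "\<dots> = of_real (- (\<Sum>i\<in>UNIV. (cmod (ev P S i))\<^sup>2))" by (simp add: sum_negf)
    finally have "(\<Sum>i\<in>UNIV. (cmod (ev P S i))\<^sup>2) = 0" by (metis neg_equal_0_iff_equal of_real_eq_0_iff)
    then have "ev P S i = 0" for i by (simp add: sum_nonneg_eq_0_iff)
    then have "Ad P S = 0" using D[OF S(1)] by (simp add: diag_by_iff dg_def vec_eq_iff)
    then show ?thesis using Ad_eq_iff[OF P(3), of S 0] by (simp add: Ad_simps)
  qed
  have nil: "\<exists>k. mpow x k = 0" if x: "x \<in> g0" "\<And>S. S \<in> hh \<Longrightarrow> trace (x ** S) = 0" for x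
  proof -
    obtain S N k where SN: "S \<in> hh" "N \<in> g0" "x = S + N" "mpow N k = 0" using jordan[OF x(1)] by blast
    have "trace (S ** S') = 0" if "S' \<in> hh" for S'
      using x(2)[OF that] tr0[OF SN(4,2) that] by (simp add: SN(3) mult_distribs trace_add)
    then have "S = 0" using nondeg SN(1) by blast
    then show ?thesis using SN by auto
  qed
  define r where "r = {x\<in>\<gg>. \<forall>y\<in>\<gg>. trace (x ** y) = 0}"
  have rsub: "cmat.subspace r"
    using sub(1) unfolding r_def
    by (intro cmat.subspaceI)
       (auto simp: mult_distribs trace_add trace_cscale cmat.subspace_0 cmat.subspace_add cmat.subspace_scale
         trace_zero)
  have rideal: "lie_bracket z x \<in> r" if "z \<in> \<gg>" "x \<in> r" for z x
    using that br by (auto simp: r_def trace_bracket)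
  have AdG: "Ad g x \<in> \<gg>" if "g \<in> G" "x \<in> \<gg>" for g x
    using lie_algebra_Ad[OF G(1)] that by (simp add: \<gg>_def)
  have rAd: "Ad g x \<in> r" if g: "g \<in> G" and x: "x \<in> r" for g x
  proof -
    have i: "invertible g" "matrix_inv g \<in> G" using zgroupD[OF G(1)] g by blast+
    have "trace (Ad g x ** y) = trace (x ** Ad (matrix_inv g) y)" for y
    proof -
      have "Ad g x ** y = Ad g (x ** Ad (matrix_inv g) y)"
        using i by (simp add: Ad_mult Ad_inverse)
      then show ?thesis using trace_Ad[OF i(1)] by simp
    qed
    then show ?thesis using x AdG g i by (auto simp: r_def)
  qed
  have "r = {0}"
  proof (rule ccontr)
    assume "r \<noteq> {0}"
    then have "{0} \<subset> r" using cmat.subspace_0[OF rsub] by blast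
    have "\<exists>b\<in>r - {0}. \<forall>x\<in>r. lie_bracket x b \<in> {0}"
    proof (rule graded_engel[OF P(3) D rsub])
      show "lie_bracket x y \<in> r" if "x \<in> r" "y \<in> r" for x y using that rideal by (auto simp: r_def)
      show "lie_bracket h x \<in> r" if "h \<in> hh" "x \<in> r" for h x using that rideal hg by blast
      show "\<exists>k. mpow x k = 0" if x: "x \<in> r" "\<And>h. h \<in> hh \<Longrightarrow> lie_bracket h x = cscale (\<alpha> h) x" for x \<alpha>
      proof (cases "\<exists>h\<in>hh. \<alpha> h \<noteq> 0")
        case True
        then show ?thesis using weight_vector_nilpotent[OF P(3) D] x(2) by blast
      next
        case False
        then have "x \<in> g0" using x by (auto simp: g0_def r_def simp flip: lie_bracket_eq_0_iff)
        then show ?thesis using nil x(1) hg by (auto simp: r_def)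
      qed
      show "lie_bracket x y \<in> r" if "x \<in> r \<union> hh" "y \<in> r" for x y
        using that rideal hg by (auto simp: r_def)
    qed (use \<open>{0} \<subset> r\<close> rsub in \<open>auto simp: lie_bracket_simps cmat.subspace_single_0\<close>)
    then obtain b where b: "b \<in> r" "b \<noteq> 0" "\<And>x. x \<in> r \<Longrightarrow> lie_bracket x b = 0" by blast
    define a where "a = {b\<in>r. \<forall>x\<in>r. lie_bracket x b = 0}"
    have "b = 0"
    proof (rule semisimple_no_abelian_ideal[OF G, of a])
      show "a \<subseteq> lie_algebra G" by (auto simp: a_def r_def \<gg>_def)
      show "Ad g x \<in> a" if g: "g \<in> G" and x: "x \<in> a" for g x
      proof -
        have i: "invertible g" "matrix_inv g \<in> G" using zgroupD[OF G(1)] g by blast+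
        have "lie_bracket y (Ad g x) = 0" if y: "y \<in> r" for y
        proof -
          have "lie_bracket y (Ad g x) = Ad g (lie_bracket (Ad (matrix_inv g) y) x)"
            using i by (simp add: Ad_bracket Ad_inverse)
          also have "lie_bracket (Ad (matrix_inv g) y) x = 0" using x rAd[OF i(2) y] by (simp add: a_def)
          finally show ?thesis by (simp add: Ad_simps)
        qed
        then show ?thesis using x rAd[OF g] by (simp add: a_def)
      qed
      show "x ** y = y ** x" if "x \<in> a" "y \<in> a" for x y
        using that by (auto simp: a_def simp flip: lie_bracket_eq_0_iff)
      show "b \<in> a" using b by (simp add: a_def)
    qed
    then show False using b by simp
  qed
  have trnil: "trace (x ** y) = 0" if x: "x \<in> g0" "mpow x k = 0" and y: "y \<in> g0" "mpow y l = 0" for x y k l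
  proof -
    have "trace ((x + y) ** S) = 0" if "S \<in> hh" for S
      using tr0[OF x(2,1) that] tr0[OF y(2,1) that] by (simp add: mult_distribs trace_add)
    then obtain m where m: "mpow (x + y) m = 0" using nil g0_add[OF x(1) y(1)] by blast
    have sq: "trace (z ** z) = 0" if "mpow z n = 0" for z n
      using trace_nilpotent nilpotent_mult[OF that] by blast
    have "trace ((x + y) ** (x + y)) = trace (x ** x) + trace (y ** y) + trace (x ** y) + trace (y ** x)"
      by (simp add: mult_distribs trace_add)
    then have "trace (x ** y) + trace (y ** x) = 0" using sq[OF m] sq[OF x(2)] sq[OF y(2)] by simp
    then show ?thesis using trace_mul_sym[of x y] by simp
  qed
  have nil0: "x = 0" if x: "x \<in> g0" "mpow x k = 0" for x k
  proof -
    have "\<gg> \<subseteq> {y. trace (x ** y) = 0}"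
    proof (rule weight_vectors_span[OF P(3) D sub(1)])
      show "lie_bracket h y \<in> \<gg>" if "h \<in> hh" "y \<in> \<gg>" for h y using that br hg by blast
      show "cmat.subspace {y. trace (x ** y) = 0}"
        by (rule cmat.subspaceI) (auto simp: mult_distribs trace_add trace_cscale trace_zero)
      show "y \<in> {y. trace (x ** y) = 0}"
        if y: "y \<in> \<gg>" "\<And>h. h \<in> hh \<Longrightarrow> lie_bracket h y = cscale (\<alpha> h) y" for y \<alpha>
      proof (cases "\<exists>h\<in>hh. \<alpha> h \<noteq> 0")
        case True
        then obtain h where h: "h \<in> hh" "\<alpha> h \<noteq> 0" by blast
        have "lie_bracket x h = 0" using x(1) h(1) by (auto simp: g0_def lie_bracket_eq_0_iff)
        then have "trace (lie_bracket x h ** y) = 0" by (simp add: mult_distribs trace_zero)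
        then have "trace (h ** lie_bracket y x) = 0" by (simp add: trace_bracket)
        then have "trace (lie_bracket y x ** h) = 0" by (metis trace_mul_sym)
        then have "trace (x ** lie_bracket h y) = 0" by (simp add: trace_bracket)
        then show ?thesis using y(2)[OF h(1)] h(2) by (simp add: mult_distribs trace_cscale)
      next
        case False
        then have "y \<in> g0" using y by (auto simp: g0_def simp flip: lie_bracket_eq_0_iff)
        then obtain S N l where "S \<in> hh" "N \<in> g0" "y = S + N" "mpow N l = 0" using jordan by blast
        then show ?thesis using tr0[OF x(2,1)] trnil[OF x] by (simp add: mult_distribs trace_add)
      qed
    qed
    then have "x \<in> r" using x(1) by (auto simp: r_def g0_def)
    then show ?thesis using \<open>r = {0}\<close> by simp
  qed
  have "X \<in> g0" using X by (auto simp: g0_def \<gg>_def hh_def simp flip: lie_bracket_eq_0_iff)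
  then obtain S N k where SN: "S \<in> hh" "N \<in> g0" "X = S + N" "mpow N k = 0" using jordan by blast
  then show ?thesis using nil0[OF SN(2,4)] by (simp add: hh_def)
qed

section \<open>Orthogonal projections and their velocities\<close>

lemma closest_point_subspace_eqI:
  fixes V :: "'a::euclidean_space set"
  assumes "subspace V" "y \<in> V" "\<And>w. w \<in> V \<Longrightarrow> (x - y) \<bullet> w = 0"
  shows "closest_point V x = y"
proof (rule closest_point_unique[symmetric])
  show "convex V" "closed V" using assms(1) by (auto intro: subspace_imp_convex closed_subspace)
  show "\<forall>z\<in>V. dist x y \<le> dist x z"
  proof
    fix z assume "z \<in> V"
    then have "(x - y) \<bullet> (y - z) = 0" using assms by (intro assms(3) subspace_diff)
    then have "orthogonal (x - y) (y - z)" by (simp add: orthogonal_def)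
    then have "(norm ((x - y) + (y - z)))\<^sup>2 = (norm (x - y))\<^sup>2 + (norm (y - z))\<^sup>2"
      by (rule norm_add_Pythagorean)
    then have "(norm (x - y))\<^sup>2 \<le> (norm (x - z))\<^sup>2" by simp
    then show "dist x y \<le> dist x z" by (simp add: dist_norm)
  qed
qed (fact assms)

lemma closest_point_subspace:
  fixes V :: "'a::euclidean_space set"
  assumes "subspace V"
  shows "closest_point V x \<in> V" "w \<in> V \<Longrightarrow> (x - closest_point V x) \<bullet> w = 0"
proof -
  obtain y z where yz: "y \<in> span V" "\<And>w. w \<in> span V \<Longrightarrow> orthogonal z w" "x = y + z"
    using orthogonal_subspace_decomp_exists[of V x] by blast
  have sp: "span V = V" using assms by (simp add: span_eq_iff)
  have "closest_point V x = y"
    using yz sp by (intro closest_point_subspace_eqI[OF assms]) (auto simp: orthogonal_def)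
  then show "closest_point V x \<in> V" "w \<in> V \<Longrightarrow> (x - closest_point V x) \<bullet> w = 0"
    using yz sp by (auto simp: orthogonal_def)
qed

lemma linear_closest_point:
  fixes V :: "'a::euclidean_space set"
  assumes V: "subspace V" shows "linear (closest_point V)"
proof (rule linearI)
  note c = closest_point_subspace[OF V]
  show "closest_point V (x + y) = closest_point V x + closest_point V y" for x y
  proof (rule closest_point_subspace_eqI[OF V])
    show "(x + y - (closest_point V x + closest_point V y)) \<bullet> w = 0" if "w \<in> V" for w
      using c(2)[OF that, of x] c(2)[OF that, of y] by (simp add: inner_diff_left inner_add_left)
  qed (intro subspace_add V c)
  show "closest_point V (r *\<^sub>R x) = r *\<^sub>R closest_point V x" for r x
  proof (rule closest_point_subspace_eqI[OF V])
    show "(r *\<^sub>R x - r *\<^sub>R closest_point V x) \<bullet> w = 0" if "w \<in> V" for w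
      using c(2)[OF that, of x] by (simp add: inner_diff_left)
  qed (intro subspace_scale V c)
qed

lemma closest_point_symmetric:
  fixes V :: "'a::euclidean_space set"
  assumes V: "subspace V" shows "closest_point V x \<bullet> y = x \<bullet> closest_point V y"
proof -
  note c = closest_point_subspace[OF V]
  have "closest_point V x \<bullet> (y - closest_point V y) = 0"
    using c(2)[OF c(1), of y x] by (simp add: inner_commute)
  moreover have "(x - closest_point V x) \<bullet> closest_point V y = 0" using c(2)[OF c(1)] .
  ultimately show ?thesis by (simp add: inner_diff_left inner_diff_right)
qed

lemma closest_point_subspace_self: "subspace V \<Longrightarrow> x \<in> V \<Longrightarrow> closest_point V x = x"
  for V :: "'a::euclidean_space set"
  by (rule closest_point_subspace_eqI) auto

lemma linear_family_expand:
  fixes f :: "'a::euclidean_space \<Rightarrow> 'b::real_vector"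
  assumes "linear f" shows "f x = (\<Sum>b\<in>Basis. (x \<bullet> b) *\<^sub>R f b)"
proof -
  have "f x = f (\<Sum>b\<in>Basis. (x \<bullet> b) *\<^sub>R b)" by (simp add: euclidean_representation)
  also have "\<dots> = (\<Sum>b\<in>Basis. (x \<bullet> b) *\<^sub>R f b)"
    by (simp add: linear_sum[OF assms] linear_scale[OF assms])
  finally show ?thesis .
qed

lemma linear_family_derivative:
  fixes P :: "real \<Rightarrow> 'a::euclidean_space \<Rightarrow> 'b::real_normed_vector"
  assumes P: "\<And>t. linear (P t)" "\<And>x. ((\<lambda>t. P t x) has_vector_derivative v x) (at s)"
    and z: "(z has_vector_derivative z') (at s)"
  shows "((\<lambda>t. P t (z t)) has_vector_derivative v (z s) + P s z') (at s)"
    and "linear v"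
proof -
  show lv: "linear v"
  proof (rule linearI)
    fix x y
    have "((\<lambda>t. P t (x + y)) has_vector_derivative v x + v y) (at s)"
      unfolding linear_add[OF P(1)] by (intro has_vector_derivative_add P(2))
    then show "v (x + y) = v x + v y" using P(2)[of "x + y"] vector_derivative_unique_at by blast
  next
    fix r x
    have "((\<lambda>t. P t (r *\<^sub>R x)) has_vector_derivative r *\<^sub>R v x) (at s)"
      unfolding linear_scale[OF P(1)]
      by (rule bounded_linear.has_vector_derivative[OF bounded_linear_scaleR_right P(2)])
    then show "v (r *\<^sub>R x) = r *\<^sub>R v x" using P(2)[of "r *\<^sub>R x"] vector_derivative_unique_at by blast
  qed
  have "((\<lambda>t. \<Sum>b\<in>Basis. (z t \<bullet> b) *\<^sub>R P t b) has_vector_derivative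
      (\<Sum>b\<in>Basis. (z s \<bullet> b) *\<^sub>R v b + (z' \<bullet> b) *\<^sub>R P s b)) (at s)"
    by (intro has_vector_derivative_sum bounded_bilinear.has_vector_derivative[OF bounded_bilinear_scaleR]
        bounded_linear.has_vector_derivative[OF bounded_linear_inner_left z] P(2))
  moreover have "(\<Sum>b\<in>Basis. (z s \<bullet> b) *\<^sub>R v b + (z' \<bullet> b) *\<^sub>R P s b) = v (z s) + P s z'"
    using linear_family_expand[OF lv, of "z s"] linear_family_expand[OF P(1), of s z']
    by (simp add: sum.distrib)
  moreover have "(\<lambda>t. P t (z t)) = (\<lambda>t. \<Sum>b\<in>Basis. (z t \<bullet> b) *\<^sub>R P t b)"
    by (intro ext linear_family_expand[OF P(1)])
  ultimately show "((\<lambda>t. P t (z t)) has_vector_derivative v (z s) + P s z') (at s)"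
    by (simp only:)
qed

text \<open>
  Differentiating \<open>P\<^sup>2 = P\<close> and the symmetry of \<open>P\<close> shows that the velocity \<open>v\<close> of a family of
  orthogonal projections exchanges \<open>V\<close> with its orthogonal complement and is symmetric. It is
  therefore determined by the map that it induces from \<open>V\<close> to the quotient by \<open>V\<close>.
\<close>

lemma projection_velocity:
  fixes V :: "real \<Rightarrow> 'a::euclidean_space set"
  assumes V: "\<And>t. subspace (V t)"
    and v: "\<And>x. ((\<lambda>t. closest_point (V t) x) has_vector_derivative v x) (at 0)"
    and A: "\<And>y. y \<in> V 0 \<Longrightarrow> v y - A y \<in> V 0"
  shows "v x = A (closest_point (V 0) x) - closest_point (V 0) (A (closest_point (V 0) x))
    + (\<Sum>b\<in>Basis. ((x - closest_point (V 0) x) \<bullet> A (closest_point (V 0) b)) *\<^sub>R b)"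
proof -
  define p where "p = closest_point (V 0)"
  note fam = linear_family_derivative[OF linear_closest_point[OF V] v v]
  have lv: "linear v" by (rule fam(2))
  have lp: "linear p" unfolding p_def by (rule linear_closest_point[OF V])
  have p: "p x \<in> V 0" "w \<in> V 0 \<Longrightarrow> p w = w" "w \<in> V 0 \<Longrightarrow> (x - p x) \<bullet> w = 0" for x w
    unfolding p_def using closest_point_subspace[OF V] closest_point_subspace_self[OF V] by blast+
  have "((\<lambda>t. closest_point (V t) (closest_point (V t) x)) has_vector_derivative v (p x) + p (v x)) (at 0)" for x
    using fam(1) by (simp add: p_def)
  then have "((\<lambda>t. closest_point (V t) x) has_vector_derivative v (p x) + p (v x)) (at 0)" for x
    using closest_point_subspace_self[OF V closest_point_subspace(1)[OF V]] by simp
  then have idem: "v x = v (p x) + p (v x)" for x using v vector_derivative_unique_at by blast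
  have sym: "v x \<bullet> y = x \<bullet> v y" for x y
  proof -
    have "((\<lambda>t. closest_point (V t) x \<bullet> y) has_vector_derivative v x \<bullet> y) (at 0)"
      by (rule bounded_linear.has_vector_derivative[OF bounded_linear_inner_left v])
    moreover have "((\<lambda>t. x \<bullet> closest_point (V t) y) has_vector_derivative x \<bullet> v y) (at 0)"
      by (rule bounded_linear.has_vector_derivative[OF bounded_linear_inner_right v])
    ultimately show ?thesis unfolding closest_point_symmetric[OF V, of _ x y]
      using vector_derivative_unique_at by blast
  qed
  have vV: "v y = A y - p (A y)" if "y \<in> V 0" for y
  proof -
    have "p (v y) = 0" using idem[of y] p(2)[OF that] by simp
    moreover have "p (v y - A y) = v y - A y" using p(2) A[OF that] by blast
    ultimately have "v y - A y = - p (A y)" by (simp add: linear_diff[OF lp])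
    then show ?thesis by (metis add.commute add_uminus_conv_diff diff_add_cancel)
  qed
  define z where "z = x - p x"
  have "p z = 0" using p(2)[OF p(1)] by (simp add: z_def linear_diff[OF lp])
  then have pz: "v z = p (v z)" using idem[of z] by (simp add: linear_0[OF lv])
  have "v z = (\<Sum>b\<in>Basis. (v z \<bullet> b) *\<^sub>R b)" by (simp add: euclidean_representation)
  also have "\<dots> = (\<Sum>b\<in>Basis. (z \<bullet> A (p b)) *\<^sub>R b)"
  proof (intro sum.cong refl)
    fix b
    have "v z \<bullet> b = v z \<bullet> p b"
      by (subst pz, subst (2) pz) (simp add: p_def closest_point_symmetric[OF V]
          closest_point_subspace_self[OF V closest_point_subspace(1)[OF V]])
    also have "\<dots> = z \<bullet> (A (p b) - p (A (p b)))" using sym vV[OF p(1)] by simp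
    also have "\<dots> = z \<bullet> A (p b)" using p(3)[OF p(1)] by (simp add: z_def inner_diff_right)
    finally show "(v z \<bullet> b) *\<^sub>R b = (z \<bullet> A (p b)) *\<^sub>R b" by simp
  qed
  finally have "v z = (\<Sum>b\<in>Basis. (z \<bullet> A (p b)) *\<^sub>R b)" .
  moreover have "v x = v (p x) + v z" by (simp add: z_def flip: linear_add[OF lv])
  ultimately show ?thesis using vV[OF p(1)] by (simp add: z_def p_def)
qed

section \<open>Moving subspaces\<close>

lemma C1_bilinear:
  assumes b: "bounded_bilinear h" and f: "f C1_differentiable_on S" and g: "g C1_differentiable_on S"
  shows "(\<lambda>t. h (f t) (g t)) C1_differentiable_on S"
proof -
  obtain f' g' where d: "\<And>x. x \<in> S \<Longrightarrow> (f has_vector_derivative f' x) (at x)"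
    "\<And>x. x \<in> S \<Longrightarrow> (g has_vector_derivative g' x) (at x)" "continuous_on S f'" "continuous_on S g'"
    using f g unfolding C1_differentiable_on_def by blast
  have "continuous_on S f" "continuous_on S g"
    using d(1,2) by (meson continuous_at_imp_continuous_on has_vector_derivative_continuous)+
  then have "continuous_on S (\<lambda>t. h (f t) (g' t) + h (f' t) (g t))"
    using d(3,4) by (intro continuous_on_add bounded_bilinear.continuous_on[OF b])
  then show ?thesis unfolding C1_differentiable_on_def
    using d(1,2) bounded_bilinear.has_vector_derivative[OF b]
    by (intro exI[of _ "\<lambda>t. h (f t) (g' t) + h (f' t) (g t)"]) blast
qed

lemma C1_transfer:
  assumes "f C1_differentiable_on UNIV" "\<And>t. f t = g t" shows "g C1_differentiable_on UNIV"
proof -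
  have "f = g" using assms(2) by blast
  then show ?thesis using assms(1) by simp
qed

lemma C1_sum:
  "(\<And>i. i \<in> I \<Longrightarrow> f i C1_differentiable_on S) \<Longrightarrow> (\<lambda>t. \<Sum>i\<in>I. f i t) C1_differentiable_on S"
  by (induction I rule: infinite_finite_induct) auto

lemma C1_inverse:
  fixes f :: "real \<Rightarrow> real"
  assumes f: "f C1_differentiable_on S" and nz: "\<And>t. t \<in> S \<Longrightarrow> f t \<noteq> 0"
  shows "(\<lambda>t. inverse (f t)) C1_differentiable_on S"
proof -
  obtain f' where d: "\<And>x. x \<in> S \<Longrightarrow> (f has_vector_derivative f' x) (at x)" "continuous_on S f'"
    using f unfolding C1_differentiable_on_def by blast
  have "continuous_on S f"
    using d(1) by (meson continuous_at_imp_continuous_on has_vector_derivative_continuous)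
  then have "continuous_on S (\<lambda>t. - (inverse (f t) * f' t * inverse (f t)))"
    using d(2) nz by (intro continuous_intros) auto
  moreover have "((\<lambda>t. inverse (f t)) has_vector_derivative - (inverse (f t) * f' t * inverse (f t))) (at t)"
    if "t \<in> S" for t
  proof -
    have "(f has_field_derivative f' t) (at t)"
      using d(1)[OF that] by (simp add: has_real_derivative_iff_has_vector_derivative)
    then have "((\<lambda>t. inverse (f t)) has_field_derivative - (inverse (f t) * f' t * inverse (f t))) (at t)"
      using nz[OF that] by (rule DERIV_inverse'[where f = f and D = "f' t" and x = t and s = UNIV])
    then show ?thesis unfolding has_real_derivative_iff_has_vector_derivative .
  qed
  ultimately show ?thesis unfolding C1_differentiable_on_def
    by (intro exI[of _ "\<lambda>t. - (inverse (f t) * f' t * inverse (f t))"] conjI ballI)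
qed

text \<open>One step of the Gram-Schmidt process.\<close>

lemma closest_point_span_insert:
  fixes S :: "'a::euclidean_space set"
  assumes "v \<notin> span S"
  defines "w \<equiv> v - closest_point (span S) v"
  shows "w \<bullet> w \<noteq> 0"
    "closest_point (span (insert v S)) x = closest_point (span S) x + ((x \<bullet> w) * inverse (w \<bullet> w)) *\<^sub>R w"
proof -
  note c = closest_point_subspace[OF subspace_span[of S]]
  have "w \<noteq> 0"
  proof
    assume "w = 0"
    then have "v = closest_point (span S) v" by (simp add: w_def)
    then show False using assms(1) c(1)[of v] by simp
  qed
  then show ww: "w \<bullet> w \<noteq> 0" by simp
  have sub: "span S \<subseteq> span (insert v S)" by (intro span_mono) blast
  have wS: "w \<bullet> u = 0" if "u \<in> span S" for u using c(2)[OF that] by (simp add: w_def)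
  show "closest_point (span (insert v S)) x = closest_point (span S) x + ((x \<bullet> w) * inverse (w \<bullet> w)) *\<^sub>R w"
  proof (rule closest_point_subspace_eqI[OF subspace_span])
    have "w \<in> span (insert v S)" unfolding w_def
      by (intro span_diff span_base[of v] insertI1 subsetD[OF sub c(1)])
    then show "closest_point (span S) x + ((x \<bullet> w) * inverse (w \<bullet> w)) *\<^sub>R w \<in> span (insert v S)"
      using c(1) sub by (intro span_add span_scale) auto
    fix u assume "u \<in> span (insert v S)"
    then obtain k where k: "u - k *\<^sub>R v \<in> span S" by (auto simp: span_insert)
    define u0 where "u0 = u - k *\<^sub>R v + k *\<^sub>R closest_point (span S) v"
    have u: "u = u0 + k *\<^sub>R w" by (simp add: u0_def w_def algebra_simps)
    have u0: "u0 \<in> span S" unfolding u0_def using k c(1) by (intro span_add span_scale) auto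
    have "closest_point (span S) x \<bullet> w = 0" using wS[OF c(1)] by (simp add: inner_commute)
    then have "(x - (closest_point (span S) x + ((x \<bullet> w) * inverse (w \<bullet> w)) *\<^sub>R w)) \<bullet> w = 0"
      using ww by (simp add: inner_diff_left inner_add_left)
    moreover have "(x - (closest_point (span S) x + ((x \<bullet> w) * inverse (w \<bullet> w)) *\<^sub>R w)) \<bullet> u0 = 0"
      using c(2)[OF u0, of x] wS[OF u0] by (simp add: inner_diff_left inner_add_left)
    ultimately show "(x - (closest_point (span S) x + ((x \<bullet> w) * inverse (w \<bullet> w)) *\<^sub>R w)) \<bullet> u = 0"
      by (simp add: u inner_add_right)
  qed
qed

text \<open>By Gram-Schmidt, adding one basis vector at a time.\<close>

lemma C1_projection_span:
  fixes u :: "'i \<Rightarrow> real \<Rightarrow> 'a::euclidean_space"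
  assumes "finite B" "\<And>b. b \<in> B \<Longrightarrow> u b C1_differentiable_on UNIV"
    and "\<And>t. inj_on (\<lambda>b. u b t) B" "\<And>t. independent ((\<lambda>b. u b t) ` B)"
  shows "(\<lambda>t. closest_point (span ((\<lambda>b. u b t) ` B)) x) C1_differentiable_on UNIV"
  using assms
proof (induction arbitrary: x rule: finite_induct)
  case empty
  have "closest_point {0 :: 'a} x = 0" by (rule closest_point_subspace_eqI) auto
  then show ?case by simp
next
  case (insert b B)
  define V where "V t = span ((\<lambda>b. u b t) ` B)" for t
  have IH: "(\<lambda>t. closest_point (V t) x) C1_differentiable_on UNIV" for x
    unfolding V_def
  proof (rule insert.IH)
    show "independent ((\<lambda>b. u b t) ` B)" for t
      using insert.prems(3)[of t] independent_mono by (metis image_mono subset_insertI)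
  qed (use insert.prems in \<open>auto simp: inj_on_def\<close>)
  have C1V: "(\<lambda>t. closest_point (V t) (y t)) C1_differentiable_on UNIV" if y: "y C1_differentiable_on UNIV" for y
  proof -
    have "closest_point (V t) (y t) = (\<Sum>e\<in>Basis. (y t \<bullet> e) *\<^sub>R closest_point (V t) e)" for t
      by (rule linear_family_expand[OF linear_closest_point]) (simp add: V_def)
    then show ?thesis
      by (simp only:) (intro C1_sum C1_differentiable_on_scaleR IH C1_bilinear[OF bounded_bilinear_inner] y C1_differentiable_on_const)
  qed
  define w where "w t = u b t - closest_point (V t) (u b t)" for t
  have ub: "u b C1_differentiable_on UNIV" using insert.prems by blast
  have w: "w C1_differentiable_on UNIV" unfolding w_def
    by (intro C1_differentiable_on_diff C1V ub)
  have notin: "u b t \<notin> V t" for t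
  proof -
    have "u b t \<notin> (\<lambda>b. u b t) ` B" using insert.prems(2)[of t] insert.hyps(2) by (auto simp: inj_on_def)
    moreover have "independent (insert (u b t) ((\<lambda>b. u b t) ` B))" using insert.prems(3)[of t] by simp
    ultimately show ?thesis unfolding V_def by (simp add: independent_insert)
  qed
  note ins = closest_point_span_insert[OF notin[unfolded V_def], folded V_def]
  have eq: "closest_point (span ((\<lambda>b. u b t) ` insert b B)) x
      = closest_point (V t) x + ((x \<bullet> w t) * inverse (w t \<bullet> w t)) *\<^sub>R w t" for t
    using ins(2) by (simp add: w_def)
  have ww: "w t \<bullet> w t \<noteq> 0" for t using ins(1) by (simp add: w_def)
  have "(\<lambda>t. closest_point (V t) x + ((x \<bullet> w t) * inverse (w t \<bullet> w t)) *\<^sub>R w t) C1_differentiable_on UNIV"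
    by (intro C1_differentiable_on_add IH C1_differentiable_on_scaleR C1_differentiable_on_mult
        C1_inverse C1_bilinear[OF bounded_bilinear_inner] w C1_differentiable_on_const ww)
  then show ?case
    by (rule C1_transfer) (use eq in auto)
qed

text \<open>
  The map that sends \<open>b\<close> to \<open>x b t\<close> extends to a linear map \<open>T t\<close>, which is close to the
  identity and therefore injective.
\<close>

lemma independent_perturb:
  fixes x :: "'a::euclidean_space \<Rightarrow> real \<Rightarrow> 'a"
  assumes B: "independent B" and x: "\<And>b. b \<in> B \<Longrightarrow> (x b \<longlongrightarrow> b) F"
  shows "\<forall>\<^sub>F t in F. inj_on (\<lambda>b. x b t) B \<and> independent ((\<lambda>b. x b t) ` B)"
proof -
  have fin: "finite B" using B by (rule independent_imp_finite)
  have "\<exists>\<phi> :: 'a \<Rightarrow> real. linear \<phi> \<and> (\<forall>c\<in>B. \<phi> c = (if c = b then 1 else 0))" for b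
    by (rule linear_independent_extend[OF B])
  then obtain \<phi> :: "'a \<Rightarrow> 'a \<Rightarrow> real" where \<phi>: "\<And>b. linear (\<phi> b)"
    "\<And>b c. c \<in> B \<Longrightarrow> \<phi> b c = (if c = b then 1 else 0)" by metis
  have "\<exists>K. \<forall>u. norm (\<phi> b u) \<le> norm u * K" for b
    using \<phi>(1) linear_conv_bounded_linear bounded_linear.bounded by blast
  then obtain K where K: "\<And>b u. norm (\<phi> b u) \<le> norm u * K b" by metis
  define T where "T t u = u + (\<Sum>b\<in>B. \<phi> b u *\<^sub>R (x b t - b))" for t u
  have lin: "linear (T t)" for t
    unfolding T_def
    by (rule linearI) (simp_all add: linear_add[OF \<phi>(1)] linear_scale[OF \<phi>(1)] scaleR_left_distrib
        sum.distrib scaleR_right_distrib scaleR_sum_right)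
  have Tb: "T t c = x c t" if "c \<in> B" for t c
    using that fin by (simp add: T_def \<phi>(2) if_distrib[of "\<lambda>r. r *\<^sub>R _"] cong: if_cong)
  have "((\<lambda>t. \<Sum>b\<in>B. K b * norm (x b t - b)) \<longlongrightarrow> (\<Sum>b\<in>B. K b * norm (b - b))) F"
    by (intro tendsto_intros x)
  then have "\<forall>\<^sub>F t in F. (\<Sum>b\<in>B. K b * norm (x b t - b)) < 1"
    by (rule order_tendstoD(2)) simp
  then show ?thesis
  proof (rule eventually_mono)
    fix t assume lt: "(\<Sum>b\<in>B. K b * norm (x b t - b)) < 1"
    have "u = 0" if "T t u = 0" for u
    proof (rule ccontr)
      assume "u \<noteq> 0"
      have "norm u = norm (\<Sum>b\<in>B. \<phi> b u *\<^sub>R (x b t - b))"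
        using that by (metis T_def add_eq_0_iff norm_minus_cancel)
      also have "\<dots> \<le> (\<Sum>b\<in>B. norm u * (K b * norm (x b t - b)))"
        by (intro sum_norm_le) (use K in \<open>simp add: mult.assoc[symmetric] mult_right_mono\<close>)
      also have "\<dots> < norm u" using lt \<open>u \<noteq> 0\<close> by (simp flip: sum_distrib_left)
      finally show False by simp
    qed
    then have inj: "inj (T t)" using linear_injective_0[OF lin] by blast
    have "inj_on (\<lambda>b. x b t) B"
    proof (rule inj_onI)
      fix a b assume "a \<in> B" "b \<in> B" "x a t = x b t"
      then have "T t a = T t b" by (simp add: Tb)
      then show "a = b" by (rule injD[OF inj])
    qed
    moreover have "(\<lambda>b. x b t) ` B = T t ` B" using Tb by simp
    moreover have "independent (T t ` B)"
      using linear_independent_injective_image[OF lin B] inj inj_on_subset by blast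
    ultimately show "inj_on (\<lambda>b. x b t) B \<and> independent ((\<lambda>b. x b t) ` B)" by simp
  qed
qed

lemma has_vector_derivative_quotient:
  assumes "(f has_vector_derivative D) (at 0)" "f 0 = 0"
  shows "((\<lambda>t. f t /\<^sub>R t) \<longlongrightarrow> D) (at 0)"
proof -
  have "((\<lambda>t. (f t - t *\<^sub>R D) /\<^sub>R norm t) \<longlongrightarrow> 0) (at 0)"
    using assms by (simp add: has_vector_derivative_def has_derivative_at_within)
  then have "((\<lambda>t. norm ((f t - t *\<^sub>R D) /\<^sub>R norm t)) \<longlongrightarrow> 0) (at 0)"
    by (rule tendsto_norm_zero)
  moreover have "\<forall>\<^sub>F t in at 0. norm ((f t - t *\<^sub>R D) /\<^sub>R norm t) = norm (f t /\<^sub>R t - D)"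
  proof (rule eventually_at_filter[THEN iffD2], intro always_eventually allI impI)
    fix t :: real assume "t \<noteq> 0"
    then have "f t /\<^sub>R t - D = (f t - t *\<^sub>R D) /\<^sub>R t" by (simp add: scaleR_diff_right)
    then show "norm ((f t - t *\<^sub>R D) /\<^sub>R norm t) = norm (f t /\<^sub>R t - D)" by simp
  qed
  ultimately have "((\<lambda>t. norm (f t /\<^sub>R t - D)) \<longlongrightarrow> 0) (at 0)"
    by (rule Lim_transform_eventually)
  then have "((\<lambda>t. f t /\<^sub>R t - D) \<longlongrightarrow> 0) (at 0)" by (rule tendsto_norm_zero_cancel)
  then show ?thesis by (rule LIM_zero_cancel)
qed

text \<open>
  If \<open>p v - q v\<close> were outside \<open>V 0 + W 0\<close>, the sum \<open>V t + W t\<close> would contain vectors close to a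
  basis of \<open>V 0 + W 0\<close> and, among the difference quotients of the projections of \<open>v\<close>, one close to
  \<open>p v - q v\<close>; its dimension would jump.
\<close>

lemma velocity_difference_in_sum:
  fixes V W :: "real \<Rightarrow> 'a::euclidean_space set"
  assumes V: "\<And>t. subspace (V t)" and W: "\<And>t. subspace (W t)"
    and p: "\<And>x. ((\<lambda>t. closest_point (V t) x) has_vector_derivative p x) (at 0)"
    and q: "\<And>x. ((\<lambda>t. closest_point (W t) x) has_vector_derivative q x) (at 0)"
    and dim: "\<forall>\<^sub>F t in at 0. dim (V t \<union> W t) \<le> dim (V 0 \<union> W 0)" and v: "v \<in> V 0" "v \<in> W 0"
  shows "p v - q v \<in> span (V 0 \<union> W 0)"
proof (rule ccontr)
  assume D: "p v - q v \<notin> span (V 0 \<union> W 0)"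
  obtain B where B: "B \<subseteq> V 0 \<union> W 0" "independent B" "V 0 \<union> W 0 \<subseteq> span B" "card B = dim (V 0 \<union> W 0)"
    by (rule basis_exists)
  have DB: "p v - q v \<notin> span B" using D B(1) span_mono by blast
  have ind: "independent (insert (p v - q v) B)" using B(2) DB by (simp add: independent_insert)
  define x where "x b t = (if b = p v - q v then (closest_point (V t) v - closest_point (W t) v) /\<^sub>R t
    else if b \<in> V 0 then closest_point (V t) b else closest_point (W t) b)" for b t
  have xin: "x b t \<in> span (V t \<union> W t)" for b t
    using closest_point_subspace(1)[OF V, of t] closest_point_subspace(1)[OF W, of t]
    by (auto simp: x_def intro!: span_scale span_diff intro: span_base)
  have lim: "(x b \<longlongrightarrow> b) (at 0)" if b: "b \<in> insert (p v - q v) B" for b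
  proof (cases "b = p v - q v")
    case True
    have "((\<lambda>t. closest_point (V t) v - closest_point (W t) v) has_vector_derivative p v - q v) (at 0)"
      by (intro has_vector_derivative_diff p q)
    then have "((\<lambda>t. (closest_point (V t) v - closest_point (W t) v) /\<^sub>R t) \<longlongrightarrow> p v - q v) (at 0)"
      by (rule has_vector_derivative_quotient)
         (simp add: closest_point_subspace_self[OF V v(1)] closest_point_subspace_self[OF W v(2)])
    moreover have "x b = (\<lambda>t. (closest_point (V t) v - closest_point (W t) v) /\<^sub>R t)"
      using True by (simp add: x_def fun_eq_iff)
    ultimately show ?thesis using True by simp
  next
    case False
    then have b: "b \<in> V 0 \<or> b \<in> W 0" using b B(1) by blast
    have "((\<lambda>t. closest_point (V t) b) \<longlongrightarrow> closest_point (V 0) b) (at 0)"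
      "((\<lambda>t. closest_point (W t) b) \<longlongrightarrow> closest_point (W 0) b) (at 0)"
      using has_vector_derivative_continuous[OF p] has_vector_derivative_continuous[OF q]
      by (simp_all add: isCont_def)
    moreover have "x b = (if b \<in> V 0 then (\<lambda>t. closest_point (V t) b) else (\<lambda>t. closest_point (W t) b))"
      using False by (simp add: x_def fun_eq_iff)
    ultimately show ?thesis
      using b closest_point_subspace_self[OF V] closest_point_subspace_self[OF W] by auto
  qed
  have "\<forall>\<^sub>F t in at 0. inj_on (\<lambda>b. x b t) (insert (p v - q v) B) \<and>
      independent ((\<lambda>b. x b t) ` insert (p v - q v) B)"
    by (rule independent_perturb[OF ind]) (rule lim)
  then have "\<forall>\<^sub>F t in at (0 :: real). False"
    using dim
  proof eventually_elim
    case (elim t)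
    let ?B = "insert (p v - q v) B"
    have "finite B" using B(2) by (rule independent_imp_finite)
    have "card ?B = card ((\<lambda>b. x b t) ` ?B)" using elim by (simp add: card_image del: image_insert)
    also have "\<dots> = dim ((\<lambda>b. x b t) ` ?B)" using elim by (simp add: dim_eq_card_independent del: image_insert)
    also have "\<dots> \<le> dim (span (V t \<union> W t))" by (intro dim_subset) (use xin in auto)
    also have "\<dots> \<le> card B" using elim B(4) by simp
    finally show False using DB \<open>finite B\<close> span_base by (metis card_insert_disjoint not_less_eq_eq order_refl)
  qed
  then show False by simp
qed

section \<open>Dimension of an image\<close>

interpretation mv: finite_dimensional_vector_space_pair_1
  "scaleR :: real \<Rightarrow> ('n::finite) cmat \<Rightarrow> 'n cmat" Basis
  "vscale :: real \<Rightarrow> (int \<Rightarrow> 'n cmat \<Rightarrow> 'n cmat) \<Rightarrow> _"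
  by unfold_locales

text \<open>
  Rank and nullity for a map into the space of velocities, which has infinite dimension: the map
  is injective on the orthogonal complement of its kernel.
\<close>

lemma velocity_dim_image:
  fixes f :: "('n::finite) cmat \<Rightarrow> (int \<Rightarrow> 'n cmat \<Rightarrow> 'n cmat)"
  assumes f: "Vector_Spaces.linear scaleR vscale f" and U: "subspace U"
  shows "velocity.dim (f ` U) + dim {x\<in>U. f x = 0} = dim U" "velocity.subspace (f ` U)"
proof -
  interpret f: Vector_Spaces.linear "scaleR" vscale f by fact
  show "velocity.subspace (f ` U)"
    using U f.subspace_image unfolding subspace_raw_def by blast
  define K where "K = {x\<in>U. f x = 0}"
  have K: "subspace K" unfolding K_def
    using U by (intro subspaceI) (auto simp: subspace_0 subspace_add subspace_scale f.zero f.add f.scale)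
  define C where "C = {y\<in>U. \<forall>x\<in>K. orthogonal x y}"
  have C: "subspace C" unfolding C_def
    using U by (intro subspaceI) (auto simp: subspace_0 subspace_add subspace_scale orthogonal_def inner_add_right)
  have dim: "dim C + dim K = dim U" unfolding C_def
    by (rule dim_subspace_orthogonal_to_vectors[OF K U]) (auto simp: K_def)
  have img: "f ` U = f ` C"
  proof
    show "f ` U \<subseteq> f ` C"
    proof
      fix y assume "y \<in> f ` U"
      then obtain u where u: "u \<in> U" "y = f u" by blast
      have c: "closest_point K u \<in> K" "\<And>w. w \<in> K \<Longrightarrow> (u - closest_point K u) \<bullet> w = 0"
        using closest_point_subspace[OF K] by blast+
      then have "u - closest_point K u \<in> C"
        using u U by (auto simp: C_def K_def orthogonal_def inner_commute intro: subspace_diff)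
      moreover have "f (u - closest_point K u) = y" using c(1) u by (simp add: f.diff K_def)
      ultimately show "y \<in> f ` C" by blast
    qed
  qed (auto simp: C_def)
  have "inj_on f (span C)"
  proof (rule inj_onI)
    fix a b assume ab: "a \<in> span C" "b \<in> span C" "f a = f b"
    then have "a - b \<in> C" using C by (metis span_diff span_eq_iff)
    moreover have "f (a - b) = 0" using ab by (simp add: f.diff)
    ultimately have "orthogonal (a - b) (a - b)" by (auto simp: C_def K_def)
    then show "a = b" by (simp add: orthogonal_self)
  qed
  then have "velocity.dim (f ` C) = dim C"
    using mv.dim_image_eq[OF f, of C] by (simp add: dim_raw_def span_raw_def)
  then show "velocity.dim (f ` U) + dim {x\<in>U. f x = 0} = dim U" using img dim by (simp add: K_def)
qed

section \<open>Tangent spaces of orbits of a graded filtration\<close>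

text \<open>
  Functional calculus: any function of the weights of \<open>ad e\<close> acts on a stable subspace.
\<close>

lemma weight_multiplier:
  fixes P :: "('n::finite) cmat"
  assumes P: "invertible P" "diag_by P e" and U: "cmat.subspace U" "\<And>Y. Y \<in> U \<Longrightarrow> lie_bracket e Y \<in> U"
    and Y: "Y \<in> U"
  shows "\<exists>Y'\<in>U. \<forall>a b. Ad P Y' $ a $ b = f (ev P e a - ev P e b) * Ad P Y $ a $ b"
proof -
  define A where "A = {Y\<in>U. \<exists>Y'\<in>U. \<forall>a b. Ad P Y' $ a $ b = f (ev P e a - ev P e b) * Ad P Y $ a $ b}"
  have "U \<subseteq> A"
  proof (rule weight_vectors_span[of P "{e}"])
    show "cmat.subspace A"
    proof (rule cmat.subspaceI)
      have "\<exists>Y'\<in>U. \<forall>a b. Ad P Y' $ a $ b = f (ev P e a - ev P e b) * Ad P 0 $ a $ b"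
        using cmat.subspace_0[OF U(1)] by (intro bexI[of _ 0]) (auto simp: Ad_simps)
      then show "0 \<in> A" using cmat.subspace_0[OF U(1)] by (simp add: A_def)
      fix x y assume "x \<in> A" "y \<in> A"
      then obtain x' y' where xy: "x \<in> U" "y \<in> U" "x' \<in> U" "y' \<in> U"
        "\<And>a b. Ad P x' $ a $ b = f (ev P e a - ev P e b) * Ad P x $ a $ b"
        "\<And>a b. Ad P y' $ a $ b = f (ev P e a - ev P e b) * Ad P y $ a $ b"
        unfolding A_def by blast
      then have "\<exists>Y'\<in>U. \<forall>a b. Ad P Y' $ a $ b = f (ev P e a - ev P e b) * Ad P (x + y) $ a $ b"
        using U(1) by (intro bexI[of _ "x' + y'"]) (auto simp: Ad_simps ring_distribs cmat.subspace_add)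
      then show "x + y \<in> A" using xy U(1) by (simp add: A_def cmat.subspace_add)
      fix c
      have "\<exists>Y'\<in>U. \<forall>a b. Ad P Y' $ a $ b = f (ev P e a - ev P e b) * Ad P (cscale c x) $ a $ b"
        using xy U(1) by (intro bexI[of _ "cscale c x'"]) (auto simp: Ad_simps cmat.subspace_scale)
      then show "cscale c x \<in> A" using xy U(1) by (simp add: A_def cmat.subspace_scale)
    qed
    fix Y \<alpha> assume Y: "Y \<in> U" "\<And>h. h \<in> {e} \<Longrightarrow> lie_bracket h Y = cscale (\<alpha> h) Y"
    have "f (\<alpha> e) * Ad P Y $ a $ b = f (ev P e a - ev P e b) * Ad P Y $ a $ b" for a b
      using Ad_bracket_diag[OF P, of Y a b] Y(2)[of e] by (auto simp: Ad_simps)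
    then have "\<exists>Y'\<in>U. \<forall>a b. Ad P Y' $ a $ b = f (ev P e a - ev P e b) * Ad P Y $ a $ b"
      using Y U(1) by (intro bexI[of _ "cscale (f (\<alpha> e)) Y"]) (auto simp: Ad_simps cmat.subspace_scale)
    then show "Y \<in> A" using Y(1) by (simp add: A_def)
  qed (use P U in auto)
  then show ?thesis using Y by (auto simp: A_def)
qed

lemma inner_cscale: "A \<bullet> cscale c B = cscale (cnj c) A \<bullet> B"
  by (simp add: inner_vec_def inner_complex_def algebra_simps)

lemma closest_point_cscale:
  assumes V: "cmat.subspace V" shows "closest_point V (cscale c x) = cscale c (closest_point V x)"
proof (rule closest_point_subspace_eqI)
  have sV: "subspace V" by (rule subspace_real_of_complex[OF V])
  then show "subspace V" .
  show "cscale c (closest_point V x) \<in> V"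
    by (intro cmat.subspace_scale V closest_point_subspace(1) sV)
  fix w assume "w \<in> V"
  then have "cscale (cnj c) w \<in> V" by (intro cmat.subspace_scale V)
  from closest_point_subspace(2)[OF sV this, of x]
  show "(cscale c x - cscale c (closest_point V x)) \<bullet> w = 0"
    by (simp add: inner_commute[of _ w] inner_cscale flip: cmat.scale_right_diff_distrib)
qed

lemma bounded_bilinear_lie_bracket: "bounded_bilinear (lie_bracket :: ('n::finite) cmat \<Rightarrow> 'n cmat \<Rightarrow> 'n cmat)"
  by (subst bilinear_conv_bounded_bilinear[symmetric])
     (auto simp: bilinear_def lie_bracket_simps intro!: linearI)

lemma C1_Ad_mexp: "(\<lambda>t. Ad (mexp X t) Y) C1_differentiable_on S"
  unfolding Ad_def matrix_inv_mexp
  by (intro C1_bilinear[OF bounded_bilinear_matrix_mult] C1_mexp C1_differentiable_on_const)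

lemma closest_point_mconj:
  assumes V: "subspace V" shows "closest_point (mconj ` V) x = mconj (closest_point V (mconj x))"
proof (rule closest_point_subspace_eqI)
  show "subspace (mconj ` V)" by (rule linear_subspace_image[OF linear_mconj V])
  show "mconj (closest_point V (mconj x)) \<in> mconj ` V" using closest_point_subspace(1)[OF V] by blast
  have inner: "mconj A \<bullet> mconj B = A \<bullet> B" for A B :: "'a cmat"
    by (simp add: inner_vec_def inner_complex_def)
  fix w assume "w \<in> mconj ` V"
  then obtain u where u: "u \<in> V" "w = mconj u" by blast
  have "(x - mconj (closest_point V (mconj x))) \<bullet> w = (mconj x - closest_point V (mconj x)) \<bullet> u"
    unfolding u(2) using inner[of "mconj x - closest_point V (mconj x)" u] by simp
  then show "(x - mconj (closest_point V (mconj x))) \<bullet> w = 0"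
    using closest_point_subspace(2)[OF V u(1)] by simp
qed

text \<open>
  The filtration by the weights of \<open>ad e\<close>, read off in a basis in which \<open>e\<close> is diagonal:
  \<open>Ad P Y $ a $ b\<close> has weight \<open>ev P e a - ev P e b\<close>.
\<close>

definition fil :: "('n::finite) cmat set \<Rightarrow> 'n cmat \<Rightarrow> 'n cmat \<Rightarrow> int \<Rightarrow> 'n cmat set" where
  "fil G P e i =
    {Y \<in> lie_algebra G. \<forall>a b. Ad P Y $ a $ b \<noteq> 0 \<longrightarrow> of_int i \<le> Re (ev P e a - ev P e b)}"

text \<open>
  The velocity of the filtration under the one-parameter group of \<open>X\<close>; the formula is that of
  \<open>projection_velocity\<close> for the operator \<open>ad X\<close>.
\<close>

definition vel :: "(int \<Rightarrow> ('n::finite) cmat set) \<Rightarrow> 'n cmat \<Rightarrow> int \<Rightarrow> 'n cmat \<Rightarrow> 'n cmat" where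
  "vel F X i x = lie_bracket X (closest_point (F i) x)
    - closest_point (F i) (lie_bracket X (closest_point (F i) x))
    + (\<Sum>b\<in>Basis. ((x - closest_point (F i) x) \<bullet> lie_bracket X (closest_point (F i) b)) *\<^sub>R b)"

lemma linear_vel:
  assumes "\<And>i. subspace (F i)" shows "Vector_Spaces.linear scaleR vscale (vel F)"
proof -
  interpret vector_space_pair "scaleR :: real \<Rightarrow> 'a cmat \<Rightarrow> 'a cmat"
    "vscale :: real \<Rightarrow> (int \<Rightarrow> 'a cmat \<Rightarrow> 'a cmat) \<Rightarrow> _" by unfold_locales
  note l = linear_closest_point[OF assms]
  have "vel F (X + Y) = vel F X + vel F Y" for X Y
    by (auto simp: fun_eq_iff vel_def lie_bracket_simps linear_add[OF l] inner_add_right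
        scaleR_left_distrib sum.distrib)
  moreover have "vel F (r *\<^sub>R X) = vscale r (vel F X)" for r X
    by (auto simp: fun_eq_iff vel_def vscale_def lie_bracket_simps linear_scale[OF l]
        scaleR_sum_right scaleR_right_distrib scaleR_right_diff_distrib)
  ultimately show ?thesis by unfold_locales
qed

text \<open>
  Everything about the filtration that matters is contained in its grading element \<open>e\<close>, which is
  diagonal in the basis given by \<open>P\<close>; a step of the filtration consists of the matrices whose
  nonzero entries in this basis have large enough weight.
\<close>

locale graded_lie_algebra =
  fixes G :: "('n::finite) cmat set" and P e :: "'n cmat"
  assumes zgroup_G: "zgroup G" and real_G: "\<And>A. A \<in> G \<Longrightarrow> mconj A \<in> G"
    and P: "invertible P"
    and e: "e \<in> lie_algebra G" "diag_by P e" "diag_by P (mconj e)"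
    and integral: "\<And>Y a b. Y \<in> lie_algebra G \<Longrightarrow> Ad P Y $ a $ b \<noteq> 0 \<Longrightarrow> ev P e a - ev P e b \<in> \<int>"
begin

abbreviation "\<gg> \<equiv> lie_algebra G"
abbreviation "F \<equiv> fil G P e"

lemma \<gg>: "cmat.subspace \<gg>" "subspace \<gg>" "X \<in> \<gg> \<Longrightarrow> Y \<in> \<gg> \<Longrightarrow> lie_bracket X Y \<in> \<gg>"
    "X \<in> \<gg> \<Longrightarrow> mconj X \<in> \<gg>"
  using lie_algebra_subspace[OF zgroup_G] subspace_real_of_complex lie_algebra_bracket[OF zgroup_G]
    lie_algebra_mconj[OF zgroup_G real_G] by blast+

lemma F_subset: "F i \<subseteq> \<gg>"
  by (auto simp: fil_def)

lemma F_subspace: "cmat.subspace (F i)" "subspace (F i)"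
proof -
  show "cmat.subspace (F i)" unfolding fil_def by (rule subspace_support[OF \<gg>(1)])
  then show "subspace (F i)" by (rule subspace_real_of_complex)
qed

lemma F_bracket:
  assumes X: "X \<in> F i" and Y: "Y \<in> F j" shows "lie_bracket X Y \<in> F (i + j)"
proof -
  have FX: "Ad P X $ a $ b \<noteq> 0 \<Longrightarrow> of_int i \<le> Re (ev P e a - ev P e b)"
    and FY: "Ad P Y $ a $ b \<noteq> 0 \<Longrightarrow> of_int j \<le> Re (ev P e a - ev P e b)" for a b
    using X Y by (simp_all add: fil_def)
  have "of_int (i + j) \<le> Re (ev P e a - ev P e b)" if nz: "Ad P (lie_bracket X Y) $ a $ b \<noteq> 0" for a b
  proof -
    have "Ad P (lie_bracket X Y) $ a $ b
        = (\<Sum>c\<in>UNIV. Ad P X $ a $ c * Ad P Y $ c $ b - Ad P Y $ a $ c * Ad P X $ c $ b)"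
      unfolding Ad_bracket[OF P] by (simp add: lie_bracket_def matrix_matrix_mult_def sum_subtractf)
    moreover have "(\<Sum>c\<in>UNIV. Ad P X $ a $ c * Ad P Y $ c $ b - Ad P Y $ a $ c * Ad P X $ c $ b) = 0"
      if "\<And>c. Ad P X $ a $ c * Ad P Y $ c $ b - Ad P Y $ a $ c * Ad P X $ c $ b = 0"
      using that by (intro sum.neutral) blast
    ultimately obtain c where "Ad P X $ a $ c * Ad P Y $ c $ b - Ad P Y $ a $ c * Ad P X $ c $ b \<noteq> 0"
      using nz by fastforce
    then have "(Ad P X $ a $ c \<noteq> 0 \<and> Ad P Y $ c $ b \<noteq> 0) \<or> (Ad P Y $ a $ c \<noteq> 0 \<and> Ad P X $ c $ b \<noteq> 0)"
      by auto
    then have "of_int i \<le> Re (ev P e a - ev P e c) \<and> of_int j \<le> Re (ev P e c - ev P e b) \<or>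
      of_int j \<le> Re (ev P e a - ev P e c) \<and> of_int i \<le> Re (ev P e c - ev P e b)"
      using FX FY by blast
    then show ?thesis by auto
  qed
  moreover have "lie_bracket X Y \<in> \<gg>" using \<gg>(3) X Y F_subset by blast
  ultimately show ?thesis by (simp add: fil_def)
qed

lemma diagonal_in_F0:
  assumes "X \<in> \<gg>" "diag_by P X" shows "X \<in> F 0"
proof -
  have "a = b" if "Ad P X $ a $ b \<noteq> 0" for a b using that assms(2) by (auto simp: diag_by_def)
  then show ?thesis using assms(1) by (fastforce simp: fil_def)
qed

lemma e_in_F0: "e \<in> F 0" "mconj e \<in> F 0"
  using diagonal_in_F0 e \<gg>(4) by blast+

lemma F_stable: "Y \<in> F i \<Longrightarrow> lie_bracket e Y \<in> F i"
  using F_bracket[OF e_in_F0(1)] by fastforce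

text \<open>
  A component of \<open>D\<close> of weight \<open>w\<close> is multiplied by \<open>w - c\<close>, so every one except that of weight
  \<open>c\<close> can be recovered.
\<close>

lemma in_F_if_bracket:
  assumes D: "D \<in> \<gg>" "lie_bracket e D - cscale c D \<in> F i" "of_int i \<le> Re c"
  shows "D \<in> F i"
proof -
  have "of_int i \<le> Re (ev P e a - ev P e b)" if nz: "Ad P D $ a $ b \<noteq> 0" for a b
  proof (cases "ev P e a - ev P e b = c")
    case False
    have "Ad P (lie_bracket e D - cscale c D) $ a $ b = (ev P e a - ev P e b - c) * Ad P D $ a $ b"
      by (simp add: Ad_simps Ad_bracket_diag[OF P e(2)] left_diff_distrib)
    then have "Ad P (lie_bracket e D - cscale c D) $ a $ b \<noteq> 0" using False nz by simp
    then show ?thesis using D(2) by (simp add: fil_def)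
  qed (use D(3) in simp)
  then show ?thesis using D(1) by (simp add: fil_def)
qed

lemma normalizer_F0:
  assumes "X \<in> \<gg>" "lie_bracket X e \<in> F 0" shows "X \<in> F 0"
proof (rule in_F_if_bracket[OF assms(1), of 0])
  show "lie_bracket e X - cscale 0 X \<in> F 0"
    using assms(2) F_subspace(1)[of 0] lie_bracket_antisym[of e X] by (simp add: cmat.subspace_neg)
qed simp

text \<open>
  The stabilizer of the filtration is \<open>F\<^sup>0\<close>: an element that stabilizes it maps \<open>e\<close> into \<open>F\<^sup>0\<close>,
  so its components outside \<open>F\<^sup>0\<close>, whose weights are nonzero, vanish.
\<close>

lemma vel_eq_0_iff:
  assumes X: "X \<in> \<gg>" shows "vel F X = 0 \<longleftrightarrow> X \<in> F 0"
proof
  assume "vel F X = 0"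
  then have "vel F X 0 e = 0" by simp
  then have "lie_bracket X e = closest_point (F 0) (lie_bracket X e)"
    using closest_point_subspace_self[OF F_subspace(2) e_in_F0(1)] by (simp add: vel_def)
  then have "lie_bracket X e \<in> F 0" by (metis closest_point_subspace(1) F_subspace(2))
  then show "X \<in> F 0" using normalizer_F0 X by blast
next
  assume X0: "X \<in> F 0"
  have "lie_bracket X (closest_point (F i) x) \<in> F i" for i x
    using F_bracket[OF X0 closest_point_subspace(1)[OF F_subspace(2)], of i x] by simp
  then show "vel F X = 0"
    using closest_point_subspace_self[OF F_subspace(2)] closest_point_subspace(2)[OF F_subspace(2)]
    by (simp add: fun_eq_iff vel_def)
qed

lemma Ad_F_subspace: "subspace (Ad k ` F i)"
  by (rule linear_subspace_image[OF linear_Ad F_subspace(2)])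

text \<open>
  The one-parameter group of \<open>X\<close> moves a basis of each step of the filtration smoothly, and with
  it the orthogonal projection onto the step.
\<close>

lemma vel_in_tangent_space:
  assumes X: "X \<in> \<gg>" and S: "\<And>t. (\<lambda>i. Ad (mexp X t) ` F i) \<in> S"
  shows "vel F X \<in> tangent_space S F"
proof -
  define \<Phi> where "\<Phi> t i = Ad (mexp X t) ` F i" for t i
  have \<Phi>0: "\<Phi> 0 i = F i" for i
    by (simp add: \<Phi>_def Ad_identity)
  have C1: "(\<lambda>t. closest_point (\<Phi> t i) x) C1_differentiable_on UNIV" for i x
  proof -
    obtain B where B: "B \<subseteq> F i" "independent B" "F i \<subseteq> span B" "card B = dim (F i)"
      by (rule basis_exists)
    have "span B = F i" using B F_subspace(2) by (simp add: span_minimal subset_antisym)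
    then have "\<Phi> t i = span ((\<lambda>b. Ad (mexp X t) b) ` B)" for t
      by (simp add: \<Phi>_def linear_span_image[OF linear_Ad])
    moreover have "(\<lambda>t. closest_point (span ((\<lambda>b. Ad (mexp X t) b) ` B)) x) C1_differentiable_on UNIV"
    proof (rule C1_projection_span)
      show "finite B" using B(2) by (rule independent_imp_finite)
      show "inj_on (Ad (mexp X t)) B" for t
        using inj_Ad[OF invertible_mexp] by (rule inj_on_subset) simp
      show "independent (Ad (mexp X t) ` B)" for t
        by (rule linear_independent_injective_image[OF linear_Ad B(2)])
           (rule inj_on_subset[OF inj_Ad[OF invertible_mexp]], simp)
    qed (rule C1_Ad_mexp)
    ultimately show ?thesis by simp
  qed
  define v where "v i x = vector_derivative (\<lambda>t. closest_point (\<Phi> t i) x) (at 0)" for i x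
  have v: "((\<lambda>t. closest_point (\<Phi> t i) x) has_vector_derivative v i x) (at 0)" for i x
    using C1[of i x] unfolding v_def C1_differentiable_on_eq by (simp add: vector_derivative_works)
  have sub: "subspace (\<Phi> t i)" for t i unfolding \<Phi>_def by (rule Ad_F_subspace)
  have "v i x = vel F X i x" for i x
    unfolding vel_def \<Phi>0[symmetric]
  proof (rule projection_velocity[OF sub v])
    fix Y assume Y: "Y \<in> \<Phi> 0 i"
    have "((\<lambda>t. closest_point (\<Phi> t i) (Ad (mexp X t) Y)) has_vector_derivative
        v i (Ad (mexp X 0) Y) + closest_point (\<Phi> 0 i) (lie_bracket X Y)) (at 0)"
      by (rule linear_family_derivative(1)[OF linear_closest_point[OF sub] v Ad_mexp_derivative])
    moreover have "closest_point (\<Phi> t i) (Ad (mexp X t) Y) = Ad (mexp X t) Y" for t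
      using Y by (intro closest_point_subspace_self[OF sub]) (simp add: \<Phi>0, simp add: \<Phi>_def)
    moreover have "Ad (mexp X 0) Y = Y" by (simp add: Ad_identity)
    ultimately have "v i Y + closest_point (\<Phi> 0 i) (lie_bracket X Y) = lie_bracket X Y"
      using Ad_mexp_derivative[of X Y] vector_derivative_unique_at by fastforce
    then have "v i Y - lie_bracket X Y = - closest_point (\<Phi> 0 i) (lie_bracket X Y)"
      by (simp add: algebra_simps)
    then show "v i Y - lie_bracket X Y \<in> \<Phi> 0 i"
      using closest_point_subspace(1)[OF sub] by (simp add: subspace_neg[OF sub])
  qed
  then have "((\<lambda>t. closest_point (\<Phi> t i) x) has_vector_derivative vel F X i x) (at 0)" for i x
    using v by simp
  moreover have "\<Phi> t \<in> S" for t using S[of t] by (simp add: \<Phi>_def[abs_def])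
  moreover have "\<Phi> 0 = F" using \<Phi>0 by blast
  moreover have "(\<lambda>t. closest_point (\<Phi> t i) x) C1_differentiable_on {-1<..<1}" for i x
    by (rule C1_differentiable_on_subset[OF C1]) simp
  ultimately show ?thesis unfolding tangent_space_def
    by (intro CollectI exI[of _ \<Phi>] exI[of _ "1 :: real"]) auto
qed

text \<open>
  Only the derivative at the origin is kept, so the curve may jump to the constant \<open>F\<close> away from
  the origin.
\<close>

lemma tangent_space_global_curve:
  assumes "v \<in> tangent_space S F" "F \<in> S"
  obtains \<Psi> where "\<Psi> 0 = F" "\<And>t. \<Psi> t \<in> S"
    "\<And>i x. ((\<lambda>t. closest_point (\<Psi> t i) x) has_vector_derivative v i x) (at 0)"
proof -
  obtain \<Phi> \<epsilon> where \<Phi>: "\<epsilon> > 0" "\<Phi> 0 = F" "\<And>t. t \<in> {-\<epsilon><..<\<epsilon>} \<Longrightarrow> \<Phi> t \<in> S"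
    "\<And>i x. ((\<lambda>t. closest_point (\<Phi> t i) x) has_vector_derivative v i x) (at 0)"
    using assms(1) unfolding tangent_space_def by blast
  define \<Psi> where "\<Psi> t = (if t \<in> {-\<epsilon><..<\<epsilon>} then \<Phi> t else F)" for t
  have "((\<lambda>t. closest_point (\<Psi> t i) x) has_vector_derivative v i x) (at 0)" for i x
    by (rule has_vector_derivative_transform_within_open[OF \<Phi>(4), of "{-\<epsilon><..<\<epsilon>}"])
       (use \<Phi>(1) in \<open>auto simp: \<Psi>_def\<close>)
  then show ?thesis using that[of \<Psi>] \<Phi> assms(2) by (auto simp: \<Psi>_def)
qed

text \<open>
  Along a curve in the orbit of \<open>F\<close> the relation \<open>[F\<^sup>0, F\<^sup>i] \<subseteq> F\<^sup>i\<close> persists; its derivative says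
  that the velocity is a derivation modulo the filtration. Subtracting an inner derivation, one
  may assume that it kills \<open>e\<close> modulo \<open>F\<^sup>0\<close>. Then it commutes with \<open>ad e\<close>, so it preserves weights,
  which forces it to vanish because the weights of \<open>F\<^sup>i\<close> and of the quotient are disjoint.
\<close>

lemma tangent_vector_is_vel:
  assumes v: "v \<in> tangent_space M F" and M: "F \<in> M" "\<And>\<Phi>. \<Phi> \<in> M \<Longrightarrow> \<exists>k\<in>G. \<Phi> = (\<lambda>i. Ad k ` F i)"
  obtains X where "X \<in> \<gg>" "v = vel F X" "\<And>i Y. Y \<in> F i \<Longrightarrow> v i Y - lie_bracket X Y \<in> F i"
proof -
  obtain \<Psi> where \<Psi>: "\<Psi> 0 = F" "\<And>t. \<Psi> t \<in> M"
    and d: "\<And>i x. ((\<lambda>t. closest_point (\<Psi> t i) x) has_vector_derivative v i x) (at 0)"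
    using tangent_space_global_curve[OF v M(1)] by blast
  have "\<exists>k\<in>G. \<Psi> t = (\<lambda>i. Ad k ` F i)" for t using \<Psi>(2) M(2) by blast
  then obtain k where k: "\<And>t. k t \<in> G" "\<And>t. \<Psi> t = (\<lambda>i. Ad (k t) ` F i)" by metis
  have inv: "invertible (k t)" for t using k(1) zgroupD(5)[OF zgroup_G] by blast
  have Ad\<gg>: "Ad (k t) Y \<in> \<gg>" if "Y \<in> \<gg>" for t Y using lie_algebra_Ad[OF zgroup_G k(1) that] .
  have sub: "subspace (\<Psi> t i)" "cmat.subspace (\<Psi> t i)" and \<Psi>\<gg>: "\<Psi> t i \<subseteq> \<gg>" for t i
  proof -
    show "subspace (\<Psi> t i)" by (simp add: k(2) Ad_F_subspace)
    show "\<Psi> t i \<subseteq> \<gg>" using Ad\<gg> F_subset by (auto simp: k(2))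
    show "cmat.subspace (\<Psi> t i)"
    proof (rule cmat.subspaceI)
      show "cscale c x \<in> \<Psi> t i" if "x \<in> \<Psi> t i" for c x
        using that F_subspace(1)[of i] by (auto simp: k(2) Ad_simps(3)[symmetric] intro: cmat.subspace_scale)
    qed (use \<open>subspace (\<Psi> t i)\<close> in \<open>auto simp: subspace_0 subspace_add\<close>)
  qed
  have \<Psi>br: "lie_bracket A B \<in> \<Psi> t i" if "A \<in> \<Psi> t 0" "B \<in> \<Psi> t i" for A B t i
  proof -
    obtain A' B' where AB: "A' \<in> F 0" "B' \<in> F i" "A = Ad (k t) A'" "B = Ad (k t) B'"
      using \<open>A \<in> \<Psi> t 0\<close> \<open>B \<in> \<Psi> t i\<close> unfolding k(2) by blast
    have "lie_bracket A' B' \<in> F i" using F_bracket[OF AB(1,2)] by simp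
    moreover have "lie_bracket A B = Ad (k t) (lie_bracket A' B')" by (simp add: AB(3,4) Ad_bracket[OF inv])
    ultimately show ?thesis unfolding k(2) by blast
  qed
  define p where "p i = closest_point (F i)" for i
  have p: "p i x \<in> F i" "y \<in> F i \<Longrightarrow> p i y = y" for i x y
    unfolding p_def using closest_point_subspace(1)[OF F_subspace(2)] closest_point_subspace_self[OF F_subspace(2)] by blast+
  have lv: "linear (v i)" for i
    by (rule linear_family_derivative(2)[OF linear_closest_point[OF sub(1)] d d])
  have lvc: "v i (cscale c x) = cscale c (v i x)" for i c x
  proof -
    have "((\<lambda>t. closest_point (\<Psi> t i) (cscale c x)) has_vector_derivative cscale c (v i x)) (at 0)"
      unfolding closest_point_cscale[OF sub(2)]
      by (rule bounded_linear.has_vector_derivative[OF bounded_linear_cscale d])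
    then show ?thesis using d vector_derivative_unique_at by blast
  qed
  have v\<gg>: "v i x \<in> \<gg>" for i x
    by (rule derivative_in_subspace[OF \<gg>(2) zero_less_one _ d])
       (use closest_point_subspace(1)[OF sub(1)] \<Psi>\<gg> in blast)
  have key: "lie_bracket (v 0 e) Y + lie_bracket e (v i Y) - v i (lie_bracket e Y) \<in> F i"
    if Y: "Y \<in> F i" for i Y
  proof -
    define z where "z t = lie_bracket (closest_point (\<Psi> t 0) e) (closest_point (\<Psi> t i) Y)" for t
    have z0: "z 0 = lie_bracket e Y" using p(2)[OF e_in_F0(1)] p(2)[OF Y] by (simp add: z_def \<Psi>(1) p_def)
    define z' where "z' = lie_bracket e (v i Y) + lie_bracket (v 0 e) Y"
    have dz: "(z has_vector_derivative z') (at 0)"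
      using bounded_bilinear.has_vector_derivative[OF bounded_bilinear_lie_bracket d[of 0 e] d[of i Y]]
        p(2)[OF e_in_F0(1)] p(2)[OF Y] by (simp add: z_def[abs_def] z'_def \<Psi>(1) p_def)
    have "((\<lambda>t. closest_point (\<Psi> t i) (z t)) has_vector_derivative
        v i (z 0) + closest_point (\<Psi> 0 i) z') (at 0)"
      by (rule linear_family_derivative(1)[OF linear_closest_point[OF sub(1)] d dz])
    moreover have "closest_point (\<Psi> t i) (z t) = z t" for t
      unfolding z_def
      by (intro closest_point_subspace_self[OF sub(1)] \<Psi>br closest_point_subspace(1)[OF sub(1)])
    ultimately have "v i (z 0) + p i z' = z'"
      using dz vector_derivative_unique_at by (fastforce simp: \<Psi>(1) p_def)
    then have "z' - v i (z 0) = p i z'" by (metis add_diff_cancel_left')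
    then show ?thesis using p(1)[of i z'] by (simp add: z'_def z0 add.commute)
  qed
  \<comment> \<open>The inner derivation to be subtracted: on negative weights \<open>ad e\<close> is invertible, and \<open>F\<^sup>0\<close> contains the others.\<close>
  define f where "f w = (if Re w < 0 then - (1 / w) else 0)" for w
  obtain X where X: "X \<in> \<gg>" "\<And>a b. Ad P X $ a $ b = f (ev P e a - ev P e b) * Ad P (v 0 e) $ a $ b"
    using weight_multiplier[OF P e(2) \<gg>(1) _ v\<gg>[of 0 e], of f] \<gg>(3) e(1) by blast
  have Xe: "lie_bracket X e - v 0 e \<in> F 0"
  proof -
    have "Ad P (lie_bracket X e - v 0 e) $ a $ b = 0" if "Re (ev P e a - ev P e b) < 0" for a b
    proof -
      have "Ad P (lie_bracket X e) $ a $ b = - ((ev P e a - ev P e b) * Ad P X $ a $ b)"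
        using lie_bracket_antisym[of X e] by (simp add: Ad_simps Ad_bracket_diag[OF P e(2)])
      moreover have "ev P e a - ev P e b \<noteq> 0" using that by auto
      ultimately show ?thesis using that by (simp add: Ad_simps X(2) f_def)
    qed
    moreover have "lie_bracket X e - v 0 e \<in> \<gg>" using X(1) e(1) \<gg> v\<gg> by (intro cmat.subspace_diff) auto
    ultimately show ?thesis unfolding fil_def by (auto simp: not_le) (smt (verit))
  qed
  have main: "F i \<subseteq> {Y\<in>F i. v i Y - lie_bracket X Y \<in> F i}" for i
  proof (rule weight_vectors_span[of P "{e}"])
    note s = F_subspace(1)[of i]
    show "cmat.subspace {Y\<in>F i. v i Y - lie_bracket X Y \<in> F i}"
    proof (rule cmat.subspaceI)
      show "0 \<in> {Y\<in>F i. v i Y - lie_bracket X Y \<in> F i}"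
        using cmat.subspace_0[OF s] by (simp add: linear_0[OF lv] lie_bracket_simps)
      fix x y assume xy: "x \<in> {Y\<in>F i. v i Y - lie_bracket X Y \<in> F i}" "y \<in> {Y\<in>F i. v i Y - lie_bracket X Y \<in> F i}"
      have "v i (x + y) - lie_bracket X (x + y) = (v i x - lie_bracket X x) + (v i y - lie_bracket X y)"
        by (simp add: linear_add[OF lv] lie_bracket_simps)
      then show "x + y \<in> {Y\<in>F i. v i Y - lie_bracket X Y \<in> F i}"
        using xy cmat.subspace_add[OF s] by simp
      fix c
      have "v i (cscale c x) - lie_bracket X (cscale c x) = cscale c (v i x - lie_bracket X x)"
        by (simp add: lvc lie_bracket_simps cmat.scale_right_diff_distrib)
      then show "cscale c x \<in> {Y\<in>F i. v i Y - lie_bracket X Y \<in> F i}"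
        using xy cmat.subspace_scale[OF s] by simp
    qed
    fix Y \<alpha> assume Y: "Y \<in> F i" "\<And>h. h \<in> {e} \<Longrightarrow> lie_bracket h Y = cscale (\<alpha> h) Y"
    define c where "c = \<alpha> e"
    have eY: "lie_bracket e Y = cscale c Y" using Y(2) by (simp add: c_def)
    define D where "D = v i Y - lie_bracket X Y"
    have "D \<in> F i"
    proof (cases "Y = 0")
      case True
      then show ?thesis using cmat.subspace_0[OF s] by (simp add: D_def linear_0[OF lv] lie_bracket_simps)
    next
      case False
      then obtain a b where ab: "Ad P Y $ a $ b \<noteq> 0" by (rule Ad_nonzero_entry[OF P])
      then have "ev P e a - ev P e b = c"
        using Ad_bracket_diag[OF P e(2), of Y a b] by (auto simp: eY Ad_simps)
      then have c: "of_int i \<le> Re c" using Y(1) ab unfolding fil_def by blast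
      have "Y \<in> \<gg>" using Y(1) F_subset by blast
      then have D\<gg>: "D \<in> \<gg>" unfolding D_def by (intro cmat.subspace_diff[OF \<gg>(1)] v\<gg> \<gg>(3) X(1))
      have "lie_bracket e (lie_bracket X Y) = cscale c (lie_bracket X Y) - lie_bracket (lie_bracket X e) Y"
        using jacobi[of e X Y] lie_bracket_antisym[of e X] by (simp add: eY lie_bracket_simps)
      then have "lie_bracket e D - cscale c D
          = (lie_bracket (v 0 e) Y + lie_bracket e (v i Y) - v i (lie_bracket e Y))
            + lie_bracket (lie_bracket X e - v 0 e) Y"
        by (simp add: D_def lie_bracket_simps cmat.scale_right_diff_distrib eY lvc)
      moreover have "lie_bracket (lie_bracket X e - v 0 e) Y \<in> F i" using F_bracket[OF Xe Y(1)] by simp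
      ultimately have "lie_bracket e D - cscale c D \<in> F i"
        using key[OF Y(1)] cmat.subspace_add[OF s] by simp
      then show ?thesis using in_F_if_bracket[OF D\<gg> _ c] by blast
    qed
    then show "Y \<in> {Y\<in>F i. v i Y - lie_bracket X Y \<in> F i}" using Y(1) by (simp add: D_def)
  qed (use P e F_subspace F_stable in auto)
  have "v i x = vel F X i x" for i x
    unfolding vel_def \<Psi>(1)[symmetric]
    by (rule projection_velocity[OF sub(1) d]) (use main[of i] in \<open>auto simp: \<Psi>(1)\<close>)
  then have "v = vel F X" by blast
  then show ?thesis using that X(1) main by blast
qed

text \<open>
  The complex codimension of this subspace in \<open>\<gg>\<close> is the codimension of the real orbit.
\<close>

definition Q :: "'n cmat set" where "Q = span (F 0 \<union> mconj ` F 0)"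

lemma Q_eq: "Q = {x + mconj y | x y. x \<in> F 0 \<and> y \<in> F 0}"
proof -
  have "subspace (mconj ` F 0)" by (rule linear_subspace_image[OF linear_mconj F_subspace(2)])
  then have "Q = {x + y | x y. x \<in> F 0 \<and> y \<in> mconj ` F 0}"
    unfolding Q_def span_Un using F_subspace(2)[of 0] by (simp add: span_eq_iff[THEN iffD2])
  then show ?thesis by blast
qed

lemma Q_subspace: "cmat.subspace Q" "F 0 \<subseteq> Q" "Q \<subseteq> \<gg>"
  and Q_stable: "Y \<in> Q \<Longrightarrow> lie_bracket e Y \<in> Q"
proof -
  show "cmat.subspace Q"
  proof (rule cmat.subspaceI)
    show "cscale c x \<in> Q" if x: "x \<in> Q" for c x
    proof -
      obtain a b where ab: "x = a + mconj b" "a \<in> F 0" "b \<in> F 0" using x unfolding Q_eq by blast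
      have "cscale c x = cscale c a + mconj (cscale (cnj c) b)"
        by (simp add: ab cmat.scale_right_distrib)
      then show ?thesis using ab F_subspace(1)[of 0] unfolding Q_eq by (blast intro: cmat.subspace_scale)
    qed
  qed (auto simp: Q_def span_zero span_add)
  show "F 0 \<subseteq> Q" unfolding Q_def by (auto intro: span_base)
  show "Q \<subseteq> \<gg>" unfolding Q_eq using F_subset[of 0] \<gg>(1,4) by (auto intro!: cmat.subspace_add)
  assume "Y \<in> Q"
  then obtain a b where ab: "Y = a + mconj b" "a \<in> F 0" "b \<in> F 0" unfolding Q_eq by blast
  have "lie_bracket e Y = lie_bracket e a + mconj (lie_bracket (mconj e) b)"
    by (simp add: ab lie_bracket_simps lie_bracket_mconj)
  moreover have "lie_bracket e a \<in> F 0" using F_stable ab by blast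
  moreover have "lie_bracket (mconj e) b \<in> F 0" using F_bracket[OF e_in_F0(2) ab(3)] by simp
  ultimately show "lie_bracket e Y \<in> Q" unfolding Q_eq by blast
qed

text \<open>
  Along the orbit of a real group the dimension of \<open>F\<^sup>0 + mconj F\<^sup>0\<close> is constant. Applied to
  \<open>e\<close>, which lies in both summands, this makes \<open>X - mconj X\<close> an element of this sum, and then
  \<open>X\<close> can be corrected by an element of \<open>F\<^sup>0\<close> to a real one.
\<close>

lemma real_tangent_vector_is_vel:
  assumes v: "v \<in> tangent_space S F"
    and S: "F \<in> S" "\<And>\<Phi>. \<Phi> \<in> S \<Longrightarrow> \<exists>k\<in>G. mconj k = k \<and> \<Phi> = (\<lambda>i. Ad k ` F i)"
  obtains R where "R \<in> \<gg>" "mconj R = R" "v = vel F R"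
proof -
  obtain X where X: "X \<in> \<gg>" "v = vel F X" "\<And>i Y. Y \<in> F i \<Longrightarrow> v i Y - lie_bracket X Y \<in> F i"
    using tangent_vector_is_vel[OF v S(1)] S(2) by blast
  obtain \<Psi> where \<Psi>: "\<Psi> 0 = F" "\<And>t. \<Psi> t \<in> S"
    and d: "\<And>i x. ((\<lambda>t. closest_point (\<Psi> t i) x) has_vector_derivative v i x) (at 0)"
    using tangent_space_global_curve[OF v S(1)] by blast
  have "\<exists>k\<in>G. mconj k = k \<and> \<Psi> t = (\<lambda>i. Ad k ` F i)" for t using \<Psi>(2) S(2) by blast
  then obtain k where k: "\<And>t. k t \<in> G" "\<And>t. mconj (k t) = k t" "\<And>t. \<Psi> t = (\<lambda>i. Ad (k t) ` F i)" by metis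
  have inv: "invertible (k t)" for t using k(1) zgroupD(5)[OF zgroup_G] by blast
  have Adconj: "mconj (Ad (k t) Y) = Ad (k t) (mconj Y)" for t Y using mconj_Ad[OF inv] k(2) by simp
  define W where "W t = mconj ` \<Psi> t 0" for t
  have sub: "subspace (\<Psi> t i)" for t i by (simp add: k(3) Ad_F_subspace)
  have subW: "subspace (W t)" for t unfolding W_def by (rule linear_subspace_image[OF linear_mconj sub])
  have dW: "((\<lambda>t. closest_point (W t) x) has_vector_derivative mconj (v 0 (mconj x))) (at 0)" for x
    unfolding W_def closest_point_mconj[OF sub]
    by (rule bounded_linear.has_vector_derivative[OF bounded_linear_mconj d])
  have "\<Psi> t 0 \<union> W t = Ad (k t) ` (F 0 \<union> mconj ` F 0)" for t
    by (simp add: W_def k(3) image_Un image_image Adconj)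
  then have "dim (\<Psi> t 0 \<union> W t) = dim (F 0 \<union> mconj ` F 0)" for t
    using dim_image_eq[OF linear_Ad inj_on_subset[OF inj_Ad[OF inv]]] by simp
  then have dim: "\<forall>\<^sub>F t in at 0. dim (\<Psi> t 0 \<union> W t) \<le> dim (\<Psi> 0 0 \<union> W 0)" by simp
  have eW: "e \<in> W 0" using e_in_F0(2) by (auto simp: W_def \<Psi>(1) intro: image_eqI[of _ _ "mconj e"])
  have "v 0 e - mconj (v 0 (mconj e)) \<in> span (\<Psi> 0 0 \<union> W 0)"
    by (rule velocity_difference_in_sum[OF sub subW d dW dim _ eW]) (simp add: \<Psi>(1) e_in_F0)
  then have 1: "v 0 e - mconj (v 0 (mconj e)) \<in> Q" by (simp add: Q_def W_def \<Psi>(1))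
  define D where "D = X - mconj X"
  have eq: "lie_bracket D e = (v 0 e - mconj (v 0 (mconj e))) - (v 0 e - lie_bracket X e)
      + mconj (v 0 (mconj e) - lie_bracket X (mconj e))"
    by (simp add: D_def lie_bracket_simps lie_bracket_mconj)
  have 2: "v 0 e - lie_bracket X e \<in> Q" using X(3)[OF e_in_F0(1)] Q_subspace(2) by blast
  have 3: "mconj (v 0 (mconj e) - lie_bracket X (mconj e)) \<in> Q"
    using X(3)[OF e_in_F0(2)] unfolding Q_def by (blast intro: span_base)
  have "lie_bracket D e \<in> Q" unfolding eq
    by (intro cmat.subspace_add[OF Q_subspace(1)] cmat.subspace_diff[OF Q_subspace(1)] 1 2 3)
  then have eD: "lie_bracket e D \<in> Q"
    using lie_bracket_antisym[of e D] Q_subspace(1) by (simp add: cmat.subspace_neg)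
  have D\<gg>: "D \<in> \<gg>" using X(1) \<gg>(1,4) by (simp add: D_def cmat.subspace_diff)
  \<comment> \<open>Inverting \<open>ad e\<close> on the nonzero weights inside \<open>Q\<close> recovers \<open>D\<close> up to its component of weight zero, which lies in \<open>F\<^sup>0\<close>.\<close>
  define f where "f w = (if w = 0 then 0 else 1 / w)" for w :: complex
  obtain D' where D': "D' \<in> Q"
    "\<And>a b. Ad P D' $ a $ b = f (ev P e a - ev P e b) * Ad P (lie_bracket e D) $ a $ b"
    using weight_multiplier[OF P e(2) Q_subspace(1) Q_stable eD, of f] by blast
  have "Ad P (D - D') $ a $ b = 0" if "ev P e a - ev P e b \<noteq> 0" for a b
    using that by (simp add: Ad_simps D'(2) f_def Ad_bracket_diag[OF P e(2)])
  moreover have "D - D' \<in> \<gg>" using D\<gg> D'(1) Q_subspace(3) \<gg>(1) by (auto intro: cmat.subspace_diff)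
  ultimately have "D - D' \<in> F 0" unfolding fil_def by (auto, metis order_refl zero_complex.sel(1) minus_complex.sel(1))
  then have "D - D' + D' \<in> Q" using D'(1) Q_subspace(1,2) by (blast intro: cmat.subspace_add)
  then obtain a b where ab: "D = a + mconj b" "a \<in> F 0" "b \<in> F 0" unfolding Q_eq by auto
  define R where "R = (1 / 2) *\<^sub>R ((X - a) + mconj (X - a))"
  have Ra: "X - a = mconj X + mconj b" using ab(1) by (simp add: D_def algebra_simps)
  have "X - R = (1 / 2) *\<^sub>R (a - b)"
  proof -
    have "mconj (X - a) = X + b" by (simp add: Ra)
    then have "R = (1 / 2) *\<^sub>R (2 *\<^sub>R X - (a - b))" by (simp add: R_def scaleR_2)
    then show ?thesis by (simp add: scaleR_right_diff_distrib)
  qed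
  then have XR: "X - R \<in> F 0" using ab F_subspace(2)[of 0] by (simp add: subspace_scale subspace_diff)
  have R\<gg>: "R \<in> \<gg>" unfolding R_def using X(1) ab F_subset \<gg>
    by (intro subspace_scale[OF \<gg>(2)] subspace_add[OF \<gg>(2)] \<gg>(4) subspace_diff[OF \<gg>(2)]) auto
  interpret lv: Vector_Spaces.linear scaleR vscale "vel F" by (rule linear_vel[OF F_subspace(2)])
  have "vel F (X - R) = 0" using vel_eq_0_iff[of "X - R"] XR F_subset by blast
  then have "vel F X = vel F R" by (simp add: lv.diff)
  moreover have "mconj R = R" by (simp add: R_def add.commute)
  ultimately show ?thesis using that R\<gg> X(2) by blast
qed

text \<open>
  \<open>U\<close> is the direct sum of its real form and \<open>\<i>\<close> times the latter.
\<close>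

lemma dim_real_form:
  assumes U: "cmat.subspace U" "\<And>X. X \<in> U \<Longrightarrow> mconj X \<in> U"
  shows "dim U = 2 * dim {X\<in>U. mconj X = X}"
proof -
  define R where "R = {X\<in>U. mconj X = X}"
  define J where "J = cscale \<i> ` R"
  have R: "subspace R" unfolding R_def using subspace_real_of_complex[OF U(1)]
    by (intro subspaceI) (auto simp: subspace_0 subspace_add subspace_scale)
  have li: "linear (cscale \<i>)" by (rule bounded_linear.linear[OF bounded_linear_cscale])
  have inj: "inj (cscale \<i>)" by (auto simp: inj_on_def)
  have J: "subspace J" unfolding J_def by (rule linear_subspace_image[OF li R])
  have "dim J = dim R" unfolding J_def by (rule dim_image_eq[OF li inj_on_subset[OF inj]]) simp
  moreover have "R \<inter> J = {0}"
  proof -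
    have "x = 0" if x: "x \<in> R" "x \<in> J" for x
    proof -
      obtain y where y: "x = cscale \<i> y" "mconj y = y" using x(2) by (auto simp: J_def R_def)
      then have "x = - x" using x(1) by (simp add: R_def)
      then show ?thesis by (simp add: vec_eq_iff)
    qed
    then show ?thesis using subspace_0[OF R] subspace_0[OF J] by blast
  qed
  moreover have "{x + y | x y. x \<in> R \<and> y \<in> J} = U"
  proof
    show "{x + y | x y. x \<in> R \<and> y \<in> J} \<subseteq> U"
      using U(1) by (auto simp: R_def J_def intro!: cmat.subspace_add cmat.subspace_scale)
    show "U \<subseteq> {x + y | x y. x \<in> R \<and> y \<in> J}"
    proof
      fix X assume X: "X \<in> U"
      define x where "x = cscale (1 / 2) (X + mconj X)"
      define y where "y = cscale (- \<i> / 2) (X - mconj X)"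
      have "x \<in> R" "y \<in> R"
        using X U by (auto simp: x_def y_def R_def cmat.scale_right_diff_distrib add.commute
            intro!: cmat.subspace_add cmat.subspace_scale cmat.subspace_diff)
      moreover have "X = x + cscale \<i> y" by (simp add: x_def y_def vec_eq_iff field_simps)
      ultimately show "X \<in> {x + y | x y. x \<in> R \<and> y \<in> J}" by (auto simp: J_def)
    qed
  qed
  ultimately show ?thesis using dim_sums_Int[OF R J] by (simp add: R_def)
qed

text \<open>
  The tangent spaces are \<open>\<gg> / F\<^sup>0\<close> and the quotient of the real form of \<open>\<gg>\<close> by the real form of
  \<open>F\<^sup>0 \<inter> mconj F\<^sup>0\<close>; the dimension of this intersection is determined by that of the sum
  \<open>Q\<close>.
\<close>

theorem orbit_tangent_dimensions:
  assumes M: "F \<in> M" "\<And>\<Phi>. \<Phi> \<in> M \<Longrightarrow> \<exists>k\<in>G. \<Phi> = (\<lambda>i. Ad k ` F i)"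
      "\<And>X t. X \<in> \<gg> \<Longrightarrow> (\<lambda>i. Ad (mexp X t) ` F i) \<in> M"
    and S: "F \<in> S" "\<And>\<Phi>. \<Phi> \<in> S \<Longrightarrow> \<exists>k\<in>G. mconj k = k \<and> \<Phi> = (\<lambda>i. Ad k ` F i)"
      "\<And>X t. X \<in> \<gg> \<Longrightarrow> mconj X = X \<Longrightarrow> (\<lambda>i. Ad (mexp X t) ` F i) \<in> S"
  shows "velocity.subspace (tangent_space M F)" "velocity.subspace (tangent_space S F)"
    "2 * velocity.dim (tangent_space M F) + dim Q = 2 * velocity.dim (tangent_space S F) + dim \<gg>"
proof -
  define \<gg>R where "\<gg>R = {X\<in>\<gg>. mconj X = X}"
  have TM: "tangent_space M F = vel F ` \<gg>"
    using vel_in_tangent_space M(3) tangent_vector_is_vel[OF _ M(1,2)] by blast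
  have TS: "tangent_space S F = vel F ` \<gg>R"
    using vel_in_tangent_space S(3) real_tangent_vector_is_vel[OF _ S(1,2)] unfolding \<gg>R_def by blast
  have sR: "subspace \<gg>R" unfolding \<gg>R_def using \<gg>(2)
    by (intro subspaceI) (auto simp: subspace_0 subspace_add subspace_scale)
  note lin = linear_vel[of F, OF F_subspace(2)]
  show "velocity.subspace (tangent_space M F)" unfolding TM by (rule velocity_dim_image(2)[OF lin \<gg>(2)])
  show "velocity.subspace (tangent_space S F)" unfolding TS by (rule velocity_dim_image(2)[OF lin sR])
  have kM: "{X\<in>\<gg>. vel F X = 0} = F 0" using vel_eq_0_iff F_subset by blast
  define I where "I = F 0 \<inter> mconj ` F 0"
  have kS: "{X\<in>\<gg>R. vel F X = 0} = {X\<in>I. mconj X = X}"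
  proof -
    have "X \<in> mconj ` F 0" if "X \<in> F 0" "mconj X = X" for X using that by (metis imageI)
    then show ?thesis using vel_eq_0_iff F_subset unfolding I_def \<gg>R_def by blast
  qed
  have Isub: "cmat.subspace I"
  proof (rule cmat.subspaceI)
    have s: "subspace I" unfolding I_def
      by (intro subspace_inter F_subspace(2) linear_subspace_image[OF linear_mconj])
    show "0 \<in> I" "x \<in> I \<Longrightarrow> y \<in> I \<Longrightarrow> x + y \<in> I" for x y using s by (auto simp: subspace_0 subspace_add)
    fix c x assume x: "x \<in> I"
    then obtain y where y: "y \<in> F 0" "x = mconj y" by (auto simp: I_def)
    then have "cscale c x = mconj (cscale (cnj c) y)" by simp
    then show "cscale c x \<in> I" unfolding I_def using x y F_subspace(1)[of 0]
      by (metis I_def IntD1 IntI cmat.subspace_scale imageI)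
  qed
  have "mconj X \<in> I" if "X \<in> I" for X using that by (auto simp: I_def)
  then have dI: "dim I = 2 * dim {X\<in>\<gg>R. vel F X = 0}" unfolding kS by (rule dim_real_form[OF Isub])
  have d\<gg>: "dim \<gg> = 2 * dim \<gg>R" unfolding \<gg>R_def by (rule dim_real_form[OF \<gg>(1,4)])
  have sc: "subspace (mconj ` F 0)" by (rule linear_subspace_image[OF linear_mconj F_subspace(2)])
  have "Q = {x + y | x y. x \<in> F 0 \<and> y \<in> mconj ` F 0}" unfolding Q_eq by blast
  then have "dim Q + dim I = dim (F 0) + dim (mconj ` F 0)"
    using dim_sums_Int[OF F_subspace(2) sc] by (simp add: I_def)
  moreover have "dim (mconj ` F 0) = dim (F 0)"
  proof (rule dim_image_eq[OF linear_mconj])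
    show "inj_on mconj (span (F 0))" by (metis inj_onI mconj_simps(1))
  qed
  moreover have "velocity.dim (tangent_space M F) + dim (F 0) = dim \<gg>"
    using velocity_dim_image(1)[OF lin \<gg>(2)] unfolding TM kM .
  moreover have "velocity.dim (tangent_space S F) + dim {X\<in>\<gg>R. vel F X = 0} = dim \<gg>R"
    using velocity_dim_image(1)[OF lin sR] unfolding TS .
  ultimately show "2 * velocity.dim (tangent_space M F) + dim Q = 2 * velocity.dim (tangent_space S F) + dim \<gg>"
    using dI d\<gg> by linarith
qed

end

section \<open>Counting dimensions\<close>

lemma dim_complex_span:
  assumes "finite B" "cmat.independent B" shows "dim (cmat.span B) = 2 * card B"
  using assms
proof (induction rule: finite_induct)
  case empty
  have "dim {0 :: 'a cmat} = 0" by simp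
  then show ?case by simp
next
  case (insert b B)
  define T where "T = range (\<lambda>c. cscale c b)"
  have b: "b \<notin> cmat.span B" "cmat.independent B"
    using insert.prems insert.hyps by (auto simp: cmat.independent_insert)
  have bl: "linear (\<lambda>c. cscale c b)"
    by (rule bounded_linear.linear[OF cscale.bounded_linear_left])
  have S: "subspace (cmat.span B)" by (intro subspace_real_of_complex cmat.subspace_span)
  have T: "subspace T" unfolding T_def by (rule linear_subspace_image[OF bl subspace_UNIV])
  have "b \<noteq> 0" using b(1) cmat.span_zero by auto
  then have "inj (\<lambda>c. cscale c b)" by (auto simp: inj_on_def)
  then have "dim T = dim (UNIV :: complex set)" unfolding T_def
    by (intro dim_image_eq[OF bl]) (auto intro: inj_on_subset)
  then have dT: "dim T = 2" by simp
  have "x = 0" if x: "x \<in> cmat.span B" "x \<in> T" for x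
  proof (rule ccontr)
    assume "x \<noteq> 0"
    obtain c where c: "x = cscale c b" using x(2) by (auto simp: T_def)
    then have "c \<noteq> 0" using \<open>x \<noteq> 0\<close> by auto
    then have "b = cscale (1 / c) x" by (simp add: c)
    then show False using cmat.span_scale[OF x(1)] b(1) by metis
  qed
  then have "cmat.span B \<inter> T = {0}" using subspace_0[OF S] subspace_0[OF T] by blast
  moreover have "cmat.span (insert b B) = {x + y | x y. x \<in> cmat.span B \<and> y \<in> T}"
  proof
    show "cmat.span (insert b B) \<subseteq> {x + y | x y. x \<in> cmat.span B \<and> y \<in> T}"
    proof
      fix u assume "u \<in> cmat.span (insert b B)"
      then obtain c where "u - cscale c b \<in> cmat.span B" by (auto simp: cmat.span_insert)
      moreover have "u = (u - cscale c b) + cscale c b" by simp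
      ultimately show "u \<in> {x + y | x y. x \<in> cmat.span B \<and> y \<in> T}" unfolding T_def by blast
    qed
    show "{x + y | x y. x \<in> cmat.span B \<and> y \<in> T} \<subseteq> cmat.span (insert b B)"
    proof
      fix u assume "u \<in> {x + y | x y. x \<in> cmat.span B \<and> y \<in> T}"
      then obtain x c where u: "u = x + cscale c b" "x \<in> cmat.span B" by (auto simp: T_def)
      have "x \<in> cmat.span (insert b B)" using u(2) cmat.span_mono[of B "insert b B"] by blast
      then show "u \<in> cmat.span (insert b B)" unfolding u(1)
        by (rule cmat.span_add) (intro cmat.span_scale cmat.span_base insertI1)
    qed
  qed
  ultimately have "dim (cmat.span (insert b B)) + dim {0 :: 'a cmat} = dim (cmat.span B) + dim T"
    using dim_sums_Int[OF S T] by simp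
  then show ?case using insert.IH[OF b(2)] dT insert.hyps by simp
qed

lemma dim_complex:
  assumes V: "cmat.subspace V" shows "dim V = 2 * cmat.dim V"
proof -
  obtain B where B: "B \<subseteq> V" "cmat.independent B" "V \<subseteq> cmat.span B" "card B = cmat.dim V"
    by (rule cmat.basis_exists)
  have "independent B"
  proof
    assume "dependent B"
    then obtain b where b: "b \<in> B" "b \<in> span (B - {b})" by (auto simp: dependent_def)
    have "span (B - {b}) \<subseteq> cmat.span (B - {b})"
      by (intro span_minimal subspace_real_of_complex cmat.subspace_span cmat.span_superset)
    then show False using b B(2) by (auto simp: cmat.dependent_def)
  qed
  then have "finite B" by (rule independent_imp_finite)
  then have "dim (cmat.span B) = 2 * card B" using dim_complex_span B(2) by blast
  moreover have "cmat.span B = V" using B(1,3) cmat.span_minimal[OF B(1) V] by blast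
  ultimately show ?thesis using B(4) by simp
qed

context graded_lie_algebra
begin

text \<open>
  If \<open>e\<close> has weight \<open>c\<close> on a matrix, then \<open>mconj e\<close> has weight \<open>cnj c\<close> on the conjugate matrix.
\<close>

lemma integral_conj:
  assumes Y: "Y \<in> \<gg>" "Ad P Y $ a $ b \<noteq> 0" shows "ev P (mconj e) a - ev P (mconj e) b \<in> \<int>"
proof -
  let ?A = "{Y\<in>\<gg>. \<forall>a b. Ad P Y $ a $ b \<noteq> 0 \<longrightarrow> ev P (mconj e) a - ev P (mconj e) b \<in> \<int>}"
  have "\<gg> \<subseteq> ?A"
  proof (rule weight_vectors_span[of P "{mconj e}"])
    show "cmat.subspace ?A" by (rule subspace_support[OF \<gg>(1)])
    fix Y \<alpha> assume Y: "Y \<in> \<gg>" "\<And>h. h \<in> {mconj e} \<Longrightarrow> lie_bracket h Y = cscale (\<alpha> h) Y"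
    define c where "c = \<alpha> (mconj e)"
    have eY: "lie_bracket (mconj e) Y = cscale c Y" using Y(2) by (simp add: c_def)
    have "ev P (mconj e) a - ev P (mconj e) b \<in> \<int>" if ab: "Ad P Y $ a $ b \<noteq> 0" for a b
    proof -
      have c: "ev P (mconj e) a - ev P (mconj e) b = c"
        using Ad_bracket_diag[OF P e(3), of Y a b] ab by (auto simp: eY Ad_simps)
      have "mconj Y \<noteq> 0" using ab by (metis Ad_simps(5) mconj_simps(1) mconj_simps(5) zero_index)
      then have "Ad P (mconj Y) \<noteq> 0" using Ad_eq_iff[OF P, of "mconj Y" 0] by (simp add: Ad_simps)
      then obtain i j where ij: "Ad P (mconj Y) $ i $ j \<noteq> 0" by (auto simp: vec_eq_iff)
      have "lie_bracket e (mconj Y) = cscale (cnj c) (mconj Y)"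
        using arg_cong[OF eY, of mconj] by (simp add: lie_bracket_mconj)
      then have "ev P e i - ev P e j = cnj c"
        using Ad_bracket_diag[OF P e(2), of "mconj Y" i j] ij by (auto simp: Ad_simps)
      then have "cnj c \<in> \<int>" using integral[OF \<gg>(4)[OF Y(1)] ij] by simp
      then have "c \<in> \<int>" by (metis Ints_cases Ints_of_int complex_cnj_cnj complex_cnj_of_int)
      then show ?thesis using c by simp
    qed
    then show "Y \<in> ?A" using Y(1) by simp
  qed (use P e \<gg> in auto)
  then show ?thesis using Y by blast
qed

lemma conjugate_grading: "graded_lie_algebra G P (mconj e)"
proof unfold_locales
  show "mconj e \<in> \<gg>" using e(1) \<gg>(4) by blast
  show "diag_by P (mconj (mconj e))" using e(2) by simp
qed (fact zgroup_G P real_G e(3) integral_conj)+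

lemma mconj_F: assumes Y: "Y \<in> F i" shows "mconj Y \<in> fil G P (mconj e) i"
proof -
  interpret c: graded_lie_algebra G P "mconj e" by (rule conjugate_grading)
  let ?A = "{Y\<in>F i. mconj Y \<in> c.F i}"
  have "F i \<subseteq> ?A"
  proof (rule weight_vectors_span[of P "{e}"])
    show "cmat.subspace ?A"
      using F_subspace(1)[of i] c.F_subspace(1)[of i]
      by (intro cmat.subspaceI) (auto simp: cmat.subspace_0 cmat.subspace_add cmat.subspace_scale)
    fix Y \<alpha> assume Y: "Y \<in> F i" "\<And>h. h \<in> {e} \<Longrightarrow> lie_bracket h Y = cscale (\<alpha> h) Y"
    define c where "c = \<alpha> e"
    have eY: "lie_bracket e Y = cscale c Y" using Y(2) by (simp add: c_def)
    have "of_int i \<le> Re (ev P (mconj e) a - ev P (mconj e) b)" if ab: "Ad P (mconj Y) $ a $ b \<noteq> 0" for a b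
    proof -
      have "lie_bracket (mconj e) (mconj Y) = cscale (cnj c) (mconj Y)"
        using arg_cong[OF eY, of mconj] by (simp add: lie_bracket_mconj)
      then have c: "ev P (mconj e) a - ev P (mconj e) b = cnj c"
        using Ad_bracket_diag[OF P e(3), of "mconj Y" a b] ab by (auto simp: Ad_simps)
      have "Y \<noteq> 0" using ab by (metis Ad_simps(5) mconj_simps(5) zero_index)
      then obtain j k where jk: "Ad P Y $ j $ k \<noteq> 0" by (rule Ad_nonzero_entry[OF P])
      then have "ev P e j - ev P e k = c"
        using Ad_bracket_diag[OF P e(2), of Y j k] by (auto simp: eY Ad_simps)
      then have "of_int i \<le> Re c" using Y(1) jk unfolding fil_def by blast
      then show ?thesis using c by simp
    qed
    moreover have "mconj Y \<in> \<gg>" using Y(1) F_subset \<gg>(4) by blast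
    ultimately have "mconj Y \<in> c.F i" by (simp add: fil_def)
    then show "Y \<in> ?A" using Y(1) by simp
  qed (use P e F_subspace F_stable in auto)
  then show ?thesis using Y by blast
qed

lemma mconj_image_F: "mconj ` F i = fil G P (mconj e) i"
proof
  show "mconj ` F i \<subseteq> fil G P (mconj e) i" using mconj_F by blast
  interpret c: graded_lie_algebra G P "mconj e" by (rule conjugate_grading)
  show "c.F i \<subseteq> mconj ` F i"
  proof
    fix Y assume "Y \<in> c.F i"
    then have "mconj Y \<in> F i" using c.mconj_F by simp
    then show "Y \<in> mconj ` F i" by (metis imageI mconj_simps(1))
  qed
qed

text \<open>
  A matrix position carries a pair of weights, under \<open>e\<close> and under its conjugate; the bigraded
  piece of bidegree \<open>(p, q)\<close> will be \<open>piece {(p, q)}\<close>.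
\<close>

definition wt :: "'n \<Rightarrow> 'n \<Rightarrow> complex \<times> complex" where
  "wt a b = (ev P e a - ev P e b, ev P (mconj e) a - ev P (mconj e) b)"

definition piece :: "(complex \<times> complex) set \<Rightarrow> 'n cmat set" where
  "piece I = {Y\<in>\<gg>. \<forall>a b. Ad P Y $ a $ b \<noteq> 0 \<longrightarrow> wt a b \<in> I}"

lemma piece_subspace: "cmat.subspace (piece I)"
  unfolding piece_def by (rule subspace_support[OF \<gg>(1)])

lemma piece_subspace_real: "subspace (piece I)"
  by (rule subspace_real_of_complex[OF piece_subspace])

lemma bigraded_component:
  assumes Y: "Y \<in> \<gg>"
  shows "\<exists>Y'\<in>\<gg>. \<forall>a b. Ad P Y' $ a $ b = (if wt a b = z then Ad P Y $ a $ b else 0)"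
proof -
  have st: "lie_bracket e Y \<in> \<gg>" "lie_bracket (mconj e) Y \<in> \<gg>" if "Y \<in> \<gg>" for Y
    using that e(1) \<gg>(3,4) by blast+
  obtain Y1 where Y1: "Y1 \<in> \<gg>"
    "\<And>a b. Ad P Y1 $ a $ b = (if ev P e a - ev P e b = fst z then 1 else 0) * Ad P Y $ a $ b"
    using weight_multiplier[OF P e(2) \<gg>(1) st(1) Y, of "\<lambda>w. if w = fst z then 1 else 0"] by blast
  obtain Y2 where Y2: "Y2 \<in> \<gg>"
    "\<And>a b. Ad P Y2 $ a $ b = (if ev P (mconj e) a - ev P (mconj e) b = snd z then 1 else 0) * Ad P Y1 $ a $ b"
    using weight_multiplier[OF P e(3) \<gg>(1) st(2) Y1(1), of "\<lambda>w. if w = snd z then 1 else 0"] by blast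
  have "Ad P Y2 $ a $ b = (if wt a b = z then Ad P Y $ a $ b else 0)" for a b
    by (cases z) (simp add: Y1(2) Y2(2) wt_def)
  then show ?thesis using Y2(1) by blast
qed

lemma zero_if_Ad_zero: "(\<And>a b. Ad P Y $ a $ b = 0) \<Longrightarrow> Y = 0"
  using Ad_eq_iff[OF P, of Y 0] by (simp add: Ad_simps vec_eq_iff)

lemma dim_piece:
  assumes "finite I" shows "dim (piece I) = (\<Sum>z\<in>I. dim (piece {z}))"
  using assms
proof (induction rule: finite_induct)
  case empty
  have "piece {} = {0}"
    using zero_if_Ad_zero cmat.subspace_0[OF piece_subspace] by (auto simp: piece_def)
  then show ?case by simp
next
  case (insert z I)
  have "x = 0" if x: "x \<in> piece {z}" "x \<in> piece I" for x
    using x insert.hyps(2) by (intro zero_if_Ad_zero) (auto simp: piece_def)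
  then have int: "piece {z} \<inter> piece I = {0}"
    using cmat.subspace_0[OF piece_subspace] by blast
  have "piece (insert z I) = {x + y | x y. x \<in> piece {z} \<and> y \<in> piece I}"
  proof
    show "piece (insert z I) \<subseteq> {x + y | x y. x \<in> piece {z} \<and> y \<in> piece I}"
    proof
      fix Y assume Y: "Y \<in> piece (insert z I)"
      then have "Y \<in> \<gg>" by (simp add: piece_def)
      then obtain Y' where Y': "Y' \<in> \<gg>"
        "\<And>a b. Ad P Y' $ a $ b = (if wt a b = z then Ad P Y $ a $ b else 0)"
        using bigraded_component by blast
      have "Y' \<in> piece {z}" using Y' by (auto simp: piece_def)
      moreover have "Y - Y' \<in> piece I"
        using Y Y' \<gg>(1) by (auto simp: piece_def Ad_simps cmat.subspace_diff split: if_splits)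
      moreover have "Y = Y' + (Y - Y')" by simp
      ultimately show "Y \<in> {x + y | x y. x \<in> piece {z} \<and> y \<in> piece I}" by blast
    qed
    have "piece {z} \<subseteq> piece (insert z I)" "piece I \<subseteq> piece (insert z I)" by (auto simp: piece_def)
    then show "{x + y | x y. x \<in> piece {z} \<and> y \<in> piece I} \<subseteq> piece (insert z I)"
      using cmat.subspace_add[OF piece_subspace] by blast
  qed
  then have "dim (piece (insert z I)) + dim {0 :: 'n cmat} = dim (piece {z}) + dim (piece I)"
    using dim_sums_Int[OF piece_subspace_real piece_subspace_real, of "{z}" I] int by simp
  then show ?case using insert by simp
qed

text \<open>
  The projection onto the nonnegative weights of \<open>e\<close> splits an element of the right-hand side
  into one of \<open>F\<^sup>0\<close> and one of the conjugate of \<open>F\<^sup>0\<close>.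
\<close>

lemma Q_piece: "Q = piece {z. 0 \<le> Re (fst z) \<or> 0 \<le> Re (snd z)}" (is "Q = piece ?J")
proof
  show "Q \<subseteq> piece ?J"
  proof
    fix Y assume "Y \<in> Q"
    then obtain x y where xy: "Y = x + mconj y" "x \<in> F 0" "y \<in> F 0" unfolding Q_eq by blast
    have "x \<in> piece ?J" using xy(2) by (auto simp: piece_def fil_def wt_def)
    moreover have "mconj y \<in> piece ?J" using mconj_F[OF xy(3)] by (auto simp: piece_def fil_def wt_def)
    ultimately show "Y \<in> piece ?J" using xy(1) cmat.subspace_add[OF piece_subspace] by blast
  qed
  show "piece ?J \<subseteq> Q"
  proof
    fix Y assume Y: "Y \<in> piece ?J"
    then have Yg: "Y \<in> \<gg>" by (simp add: piece_def)
    have st: "lie_bracket e Y \<in> \<gg>" if "Y \<in> \<gg>" for Y using that e(1) \<gg>(3) by blast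
    obtain Y1 where Y1: "Y1 \<in> \<gg>"
      "\<And>a b. Ad P Y1 $ a $ b = (if 0 \<le> Re (ev P e a - ev P e b) then 1 else 0) * Ad P Y $ a $ b"
      using weight_multiplier[OF P e(2) \<gg>(1) st Yg, of "\<lambda>w. if 0 \<le> Re w then 1 else 0"] by blast
    have "Y1 \<in> F 0" using Y1 by (auto simp: fil_def split: if_splits)
    moreover have "Y - Y1 \<in> fil G P (mconj e) 0"
      using Y Y1 \<gg>(1) by (auto simp: fil_def piece_def wt_def Ad_simps cmat.subspace_diff split: if_splits)
    then obtain y where "y \<in> F 0" "Y - Y1 = mconj y" unfolding mconj_image_F[symmetric] by blast
    then have "Y = Y1 + mconj y" by (simp add: algebra_simps)
    ultimately show "Y \<in> Q" unfolding Q_eq using \<open>y \<in> F 0\<close> by blast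
  qed
qed

lemma piece_integral:
  assumes "piece {(p, q)} \<noteq> {0}" shows "p \<in> \<int>" "q \<in> \<int>"
proof -
  obtain Y where Y: "Y \<in> piece {(p, q)}" "Y \<noteq> 0"
    using assms cmat.subspace_0[OF piece_subspace] by blast
  then obtain a b where ab: "Ad P Y $ a $ b \<noteq> 0" using zero_if_Ad_zero by blast
  have "wt a b = (p, q)" "Y \<in> \<gg>" using Y(1) ab by (auto simp: piece_def)
  then show "p \<in> \<int>" "q \<in> \<int>" using integral[OF _ ab] integral_conj[OF _ ab] by (auto simp: wt_def)
qed

text \<open>
  The complement of \<open>F\<^sup>0 + mconj F\<^sup>0\<close> is the sum of the pieces with both weights negative; the
  symmetry of the weights turns them into positive ones. The factor two passes from complex to
  real dimensions.
\<close>

lemma codim_Q: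
  assumes sym: "\<And>z. dim (piece {z}) \<le> dim (piece {- z})"
    and V: "\<And>p q. V p q = piece {(of_int p, of_int q)}"
  shows "dim \<gg> = dim Q + 2 * (\<Sum>\<^sub>\<infinity>(p, q)\<in>{0<..} \<times> {0<..}. cmat.dim (V p q))"
proof -
  have sym: "dim (piece {- z}) = dim (piece {z})" for z
    using assms(1)[of z] assms(1)[of "- z"] by simp
  define W where "W = range (\<lambda>(a, b). wt a b)"
  have W: "finite W" "\<And>a b. wt a b \<in> W" by (auto simp: W_def)
  define J where "J = {z :: complex \<times> complex. 0 \<le> Re (fst z) \<or> 0 \<le> Re (snd z)}"
  have gW: "\<gg> = piece W" using W(2) by (auto simp: piece_def)
  have QW: "Q = piece (W \<inter> J)" unfolding Q_piece using W(2) by (auto simp: piece_def J_def)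
  have "dim \<gg> = (\<Sum>z\<in>W. dim (piece {z}))" by (subst gW) (rule dim_piece[OF W(1)])
  also have "\<dots> = (\<Sum>z\<in>W \<inter> J. dim (piece {z})) + (\<Sum>z\<in>W - J. dim (piece {z}))"
    by (rule sum.Int_Diff[OF W(1)])
  also have "(\<Sum>z\<in>W \<inter> J. dim (piece {z})) = dim Q"
    unfolding QW by (rule dim_piece[symmetric]) (use W(1) in simp)
  finally have 1: "dim \<gg> = dim Q + (\<Sum>z\<in>W - J. dim (piece {z}))" .
  have zero: "dim (piece {z}) = 0" if "z \<notin> W" for z
  proof -
    have "piece {z} = {0}"
    proof -
      have "Y = 0" if Y: "Y \<in> piece {z}" for Y
        using Y W(2) \<open>z \<notin> W\<close> by (intro zero_if_Ad_zero) (auto simp: piece_def)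
      then show ?thesis using cmat.subspace_0[OF piece_subspace] by blast
    qed
    then show ?thesis by simp
  qed
  define \<iota> :: "int \<times> int \<Rightarrow> complex \<times> complex" where "\<iota> = (\<lambda>(p, q). (- of_int p, - of_int q))"
  have inj: "inj \<iota>" by (auto simp: inj_on_def \<iota>_def)
  define K where "K = {pq \<in> {0<..} \<times> {0<..}. \<iota> pq \<in> W}"
  have fK: "finite K"
    by (rule finite_subset[OF _ finite_vimageI[OF W(1) inj]]) (auto simp: K_def)
  have dV: "2 * cmat.dim (V p q) = dim (piece {\<iota> (p, q)})" for p q
    using dim_complex[OF piece_subspace, of "{(of_int p, of_int q)}"] sym[of "(of_int p, of_int q)"]
    by (simp add: V \<iota>_def)
  have dV0: "cmat.dim (V p q) = 0" if "\<iota> (p, q) \<notin> W" for p q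
    using dV[of p q] zero[OF that] by simp
  have "(\<Sum>\<^sub>\<infinity>(p, q)\<in>{0<..} \<times> {0<..}. cmat.dim (V p q)) = (\<Sum>\<^sub>\<infinity>(p, q)\<in>K. cmat.dim (V p q))"
    by (rule infsum_cong_neutral) (auto simp: K_def dV0)
  also have "\<dots> = (\<Sum>(p, q)\<in>K. cmat.dim (V p q))" by (rule infsum_finite[OF fK])
  finally have "2 * (\<Sum>\<^sub>\<infinity>(p, q)\<in>{0<..} \<times> {0<..}. cmat.dim (V p q)) = (\<Sum>pq\<in>K. dim (piece {\<iota> pq}))"
    by (simp add: sum_distrib_left case_prod_unfold dV)
  also have "\<dots> = (\<Sum>z\<in>\<iota> ` K. dim (piece {z}))"
    using inj by (subst sum.reindex) (auto intro: inj_on_subset)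
  also have "\<dots> = (\<Sum>z\<in>W - J. dim (piece {z}))"
  proof (rule sum.mono_neutral_left)
    show "\<iota> ` K \<subseteq> W - J" by (auto simp: K_def J_def \<iota>_def)
    show "\<forall>z\<in>W - J - \<iota> ` K. dim (piece {z}) = 0"
    proof
      fix z assume z: "z \<in> W - J - \<iota> ` K"
      obtain p q where pq: "z = (p, q)" by (cases z)
      have "piece {z} = {0}"
      proof (rule ccontr)
        assume "piece {z} \<noteq> {0}"
        then have "p \<in> \<int>" "q \<in> \<int>" using piece_integral pq by auto
        then obtain m n where mn: "p = of_int m" "q = of_int n" by (auto elim!: Ints_cases)
        have "m < 0" "n < 0" using z by (auto simp: pq mn J_def)
        then have "z = \<iota> (- m, - n)" "(- m, - n) \<in> K" using z by (auto simp: pq mn \<iota>_def K_def)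
        then show False using z by blast
      qed
      then show "dim (piece {z}) = 0" by simp
    qed
  qed (use W(1) in auto)
  finally show ?thesis using 1 by simp
qed

lemma mem_piece_iff:
  "X \<in> piece {(p, q)} \<longleftrightarrow>
    X \<in> \<gg> \<and> lie_bracket e X = cscale p X \<and> lie_bracket (mconj e) X = cscale q X"
proof -
  have 1: "lie_bracket h X = cscale c X \<longleftrightarrow> (\<forall>a b. Ad P X $ a $ b \<noteq> 0 \<longrightarrow> ev P h a - ev P h b = c)"
    if h: "diag_by P h" for h c
  proof -
    have "lie_bracket h X = cscale c X \<longleftrightarrow> Ad P (lie_bracket h X) = Ad P (cscale c X)"
      by (simp add: Ad_eq_iff P)
    also have "\<dots> \<longleftrightarrow> (\<forall>a b. Ad P X $ a $ b \<noteq> 0 \<longrightarrow> ev P h a - ev P h b = c)"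
      by (auto simp: vec_eq_iff Ad_bracket_diag[OF P h] Ad_simps)
    finally show ?thesis .
  qed
  show ?thesis unfolding 1[OF e(2)] 1[OF e(3)] by (auto simp: piece_def wt_def)
qed

text \<open>
  Transport of structure, where a real \<open>k\<close> is compatible with complex conjugation.
\<close>

lemma conjugate_by_real:
  assumes k: "k \<in> G" "mconj k = k"
  shows "graded_lie_algebra G (P ** matrix_inv k) (Ad k e)"
    and "fil G (P ** matrix_inv k) (Ad k e) i = Ad k ` F i"
    and "dim (graded_lie_algebra.Q G (P ** matrix_inv k) (Ad k e)) = dim Q"
proof -
  let ?P = "P ** matrix_inv k"
  have ik: "invertible k" "matrix_inv k \<in> G" using zgroupD[OF zgroup_G] k by blast+
  have AdP: "Ad ?P (Ad k X) = Ad P X" for X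
    using ik P by (simp add: Ad_Ad[symmetric] invertible_matrix_inv Ad_inverse)
  have evP: "ev ?P (Ad k X) = ev P X" for X by (simp add: ev_def AdP fun_eq_iff)
  have diagP: "diag_by ?P (Ad k X) \<longleftrightarrow> diag_by P X" for X by (simp add: diag_by_def AdP)
  have conj: "mconj (Ad k X) = Ad k (mconj X)" for X using mconj_Ad[OF ik(1)] k(2) by simp
  have Adg: "Ad k X \<in> \<gg>" "Ad (matrix_inv k) X \<in> \<gg>" if "X \<in> \<gg>" for X
    using lie_algebra_Ad[OF zgroup_G _ that] k ik by blast+
  have surj: "\<exists>X\<in>\<gg>. Y = Ad k X" if "Y \<in> \<gg>" for Y
    using Adg(2)[OF that] Ad_inverse(1)[OF ik(1), of Y] by metis
  show g: "graded_lie_algebra G ?P (Ad k e)"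
  proof unfold_locales
    show "invertible ?P" using P ik by (intro invertible_mult invertible_matrix_inv)
    show "Ad k e \<in> \<gg>" using Adg e by blast
    show "diag_by ?P (Ad k e)" "diag_by ?P (mconj (Ad k e))" using e by (simp_all add: diagP conj)
    show "ev ?P (Ad k e) a - ev ?P (Ad k e) b \<in> \<int>" if Y: "Y \<in> \<gg>" "Ad ?P Y $ a $ b \<noteq> 0" for Y a b
      using surj[OF Y(1)] Y(2) integral by (auto simp: AdP evP)
  qed (fact zgroup_G real_G)+
  show fil: "fil G ?P (Ad k e) i = Ad k ` F i" for i
  proof
    show "fil G ?P (Ad k e) i \<subseteq> Ad k ` F i"
    proof
      fix Y assume Y: "Y \<in> fil G ?P (Ad k e) i"
      then have "Y \<in> \<gg>" by (simp add: fil_def)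
      then obtain X where X: "X \<in> \<gg>" "Y = Ad k X" using surj by blast
      then have "X \<in> F i" using Y by (simp add: fil_def AdP evP)
      then show "Y \<in> Ad k ` F i" using X by blast
    qed
    show "Ad k ` F i \<subseteq> fil G ?P (Ad k e) i" using Adg by (auto simp: fil_def AdP evP)
  qed
  have "graded_lie_algebra.Q G ?P (Ad k e) = Ad k ` Q"
    unfolding graded_lie_algebra.Q_def[OF g] Q_def fil
    by (simp add: linear_span_image[OF linear_Ad, symmetric] image_Un image_image conj)
  then show "dim (graded_lie_algebra.Q G ?P (Ad k e)) = dim Q"
    using dim_image_eq[OF linear_Ad inj_on_subset[OF inj_Ad[OF ik(1)]]] by simp
qed

end

section \<open>Real structures and cocharacters\<close>

lemma Rats_subset_Reals_complex: "(\<rat> :: complex set) \<subseteq> \<real>"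
proof
  fix x :: complex assume "x \<in> \<rat>"
  then obtain a b :: int where "x = of_int a / of_int b" by (rule Rats_cases')
  then show "x \<in> \<real>" by (simp add: Reals_divide)
qed

lemma polynomial_function_mconj:
  assumes "p \<in> polynomial_functions K" "K \<subseteq> \<real>" shows "p (mconj A) = cnj (p A)"
  using assms(1)
proof induction
  case (const c)
  then show ?case using assms(2) by (auto simp: Reals_cnj_iff)
qed simp_all

lemma zariski_closed_mconj:
  assumes "zariski_closed K X" "K \<subseteq> \<real>" "A \<in> X" shows "mconj A \<in> X"
proof -
  obtain P where P: "P \<subseteq> polynomial_functions K" "X = {A. invertible A \<and> (\<forall>p\<in>P. p A = 0)}"
    using assms(1) unfolding zariski_closed_def by blast
  have "mconj A ** mconj (matrix_inv A) = mconj (A ** matrix_inv A)" by simp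
  also have "\<dots> = mat 1" using assms(3) P by (simp add: invertible_mult_inv)
  finally have "invertible (mconj A)" by (rule invertibleI)
  moreover have "p (mconj A) = 0" if "p \<in> P" for p
  proof -
    have "p (mconj A) = cnj (p A)" using polynomial_function_mconj[OF _ assms(2)] P(1) that by blast
    then show ?thesis using assms(3) P(2) that by simp
  qed
  ultimately show ?thesis using P(2) by blast
qed

lemma cocharacter_derivative:
  assumes "cocharacter H \<xi>"
  shows "((\<lambda>z. \<xi> z $ i $ j) has_field_derivative cochar_deriv \<xi> $ i $ j) (at 1)"
proof -
  obtain p :: "complex poly" and k where pk: "\<And>z. z \<noteq> 0 \<Longrightarrow> \<xi> z $ i $ j = poly p z / z ^ k"
    using assms unfolding cocharacter_def by blast
  have "(\<lambda>z. poly p z / z ^ k) field_differentiable (at 1)"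
    by (intro derivative_intros) (auto intro!: field_differentiable_within_subset simp: field_differentiable_def intro: poly_DERIV)
  then obtain D where D: "((\<lambda>z. poly p z / z ^ k) has_field_derivative D) (at 1)"
    unfolding field_differentiable_def by blast
  have "((\<lambda>z. \<xi> z $ i $ j) has_field_derivative D) (at 1)"
    by (rule has_field_derivative_transform_within_open[OF D, of "- {0}"]) (auto simp: pk)
  then show ?thesis by (simp add: cochar_deriv_def DERIV_imp_deriv)
qed

lemma cocharacter_flow:
  assumes H: "zgroup H" and c: "cocharacter H \<xi>"
  shows "flow (cscale u (cochar_deriv \<xi>)) (\<lambda>t. \<xi> (exp (of_real t * u)))"
proof -
  have mult: "\<xi> (z * w) = \<xi> z ** \<xi> w" if "z \<noteq> 0" "w \<noteq> 0" for z w
    using c that by (simp add: cocharacter_def)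
  have inv: "invertible (\<xi> z)" if "z \<noteq> 0" for z
    using c that zgroupD(5)[OF H] by (simp add: cocharacter_def)
  have "\<xi> 1 ** \<xi> 1 = \<xi> 1" using mult[of 1 1] by simp
  then have one: "\<xi> 1 = mat 1" using mult_inv_cancel(1)[OF inv[of 1], of "\<xi> 1"] invertible_mult_inv[OF inv[of 1]] by simp
  have "((\<lambda>t. \<xi> (exp (of_real t * u))) has_vector_derivative
      \<xi> (exp (of_real s * u)) ** cscale u (cochar_deriv \<xi>)) (at s)" for s
  proof -
    have "((\<lambda>t. \<xi> (exp ((of_real t - of_real s) * u))) has_vector_derivative cscale u (cochar_deriv \<xi>)) (at s)"
    proof (rule has_vector_derivative_matrix)
      fix i j
      have "((\<lambda>z. exp ((z - of_real s) * u)) has_field_derivative u) (at (of_real s))"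
        by (auto intro!: derivative_eq_intros)
      moreover have "((\<lambda>z. \<xi> z $ i $ j) has_field_derivative cochar_deriv \<xi> $ i $ j)
          (at (exp ((of_real s - of_real s) * u)))"
        using cocharacter_derivative[OF c, of i j] by simp
      ultimately have "((\<lambda>z. \<xi> (exp ((z - of_real s) * u)) $ i $ j) has_field_derivative
          cochar_deriv \<xi> $ i $ j * u) (at (of_real s))"
        by (rule DERIV_chain2[rotated])
      from has_vector_derivative_real_field[OF this]
      show "((\<lambda>t. \<xi> (exp ((of_real t - of_real s) * u)) $ i $ j) has_vector_derivative
          cscale u (cochar_deriv \<xi>) $ i $ j) (at s)" by (simp add: mult.commute)
    qed
    from bounded_linear.has_vector_derivative[OF matmul.bounded_linear_right this, of "\<xi> (exp (of_real s * u))"]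
    show ?thesis by (simp add: algebra_simps flip: mult exp_add)
  qed
  then show ?thesis by (simp add: flow_def one)
qed

lemma cocharacter_exp:
  assumes "zgroup H" "cocharacter H \<xi>"
  shows "\<xi> (exp u) = mexp (cscale u (cochar_deriv \<xi>)) 1"
  using mexp_eqI[OF cocharacter_flow[OF assms, of u]] by simp

lemma cochar_deriv_in_lie_algebra:
  assumes "zgroup H" "cocharacter H \<xi>" shows "cochar_deriv \<xi> \<in> lie_algebra H"
proof (rule lie_algebra_flow)
  show "flow (cochar_deriv \<xi>) (\<lambda>t. \<xi> (exp (of_real t * 1)))" using cocharacter_flow[OF assms, of 1] by simp
  show "\<xi> (exp (of_real t * 1)) \<in> H" for t using assms(2) by (simp add: cocharacter_def)
qed

text \<open>
  Both conditions say that a nonzero entry of \<open>X\<close>, in the basis given by \<open>P\<close>, can only occur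
  where the difference of the eigenvalues of \<open>E\<close> is \<open>n\<close>.
\<close>

lemma weight_space_of_exponential:
  fixes P :: "('n::finite) cmat"
  assumes P: "invertible P" "diag_by P E" and \<zeta>: "\<And>u. \<zeta> (exp u) = mexp (cscale u E) 1"
  shows "(\<forall>z. z \<noteq> 0 \<longrightarrow> Ad (\<zeta> z) X = cscale (z powi n) X) \<longleftrightarrow> lie_bracket E X = cscale (of_int n) X"
proof -
  have D: "diag_by P (cscale u E)" for u using P(2) by (simp add: diag_by_def Ad_simps)
  have evm: "ev P (mexp (cscale u E) 1) a = exp (u * ev P E a)" for u a
    by (simp add: ev_mexp[OF P(1) D]) (simp add: ev_def Ad_simps)
  have Dm: "diag_by P (mexp (cscale u E) 1)" for u
  proof -
    have "Ad P (mexp (cscale u E) 1) = mexp (dg (ev P (cscale u E))) 1"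
      using mexp_conjugate[OF P(1), of "cscale u E" 1] D[of u] by (simp add: diag_by_iff)
    then show ?thesis by (simp add: diag_by_def mexp_dg dg_nth)
  qed
  have mult: "Ad m X = Y \<longleftrightarrow> m ** X = Y ** m" if "invertible m" for m Y :: "'n cmat"
  proof
    assume "Ad m X = Y"
    then show "m ** X = Y ** m" using that by (auto simp: Ad_def invertible_mult_inv simp flip: matrix_mul_assoc)
  next
    assume "m ** X = Y ** m"
    then show "Ad m X = Y" using that by (simp add: Ad_def invertible_mult_inv flip: matrix_mul_assoc)
  qed
  have "(\<forall>z. z \<noteq> 0 \<longrightarrow> Ad (\<zeta> z) X = cscale (z powi n) X) \<longleftrightarrow>
      (\<forall>u. Ad (\<zeta> (exp u)) X = cscale (exp u powi n) X)"
    by (metis exp_Ln exp_not_eq_zero)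
  also have "\<dots> \<longleftrightarrow> (\<forall>u a b. exp (u * ev P E a) * Ad P X $ a $ b
      = exp (of_int n * u) * (Ad P X $ a $ b * exp (u * ev P E b)))"
  proof -
    have "Ad (\<zeta> (exp u)) X = cscale (exp u powi n) X \<longleftrightarrow>
      (\<forall>a b. exp (u * ev P E a) * Ad P X $ a $ b = exp (of_int n * u) * (Ad P X $ a $ b * exp (u * ev P E b)))" for u
    proof -
      have d: "Ad P (mexp (cscale u E) 1) = dg (\<lambda>a. exp (u * ev P E a))"
      proof -
        have "ev P (mexp (cscale u E) 1) = (\<lambda>a. exp (u * ev P E a))" using evm by blast
        then show ?thesis using Dm[of u] unfolding diag_by_iff by simp
      qed
      have "Ad P (mexp (cscale u E) 1 ** X) = Ad P (cscale (exp u powi n) X ** mexp (cscale u E) 1) \<longleftrightarrow>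
        (\<forall>a b. exp (u * ev P E a) * Ad P X $ a $ b = exp (of_int n * u) * (Ad P X $ a $ b * exp (u * ev P E b)))"
        unfolding vec_eq_iff
        by (simp add: d Ad_mult[OF P(1)] Ad_simps mult_distribs dg_mult_left dg_mult_right exp_power_int)
      then show ?thesis unfolding \<zeta> mult[OF invertible_mexp] Ad_eq_iff[OF P(1)] .
    qed
    then show ?thesis by simp
  qed
  also have "\<dots> \<longleftrightarrow> (\<forall>a b. Ad P X $ a $ b \<noteq> 0 \<longrightarrow> ev P E a - ev P E b = of_int n)"
  proof (intro iffI allI impI)
    fix a b assume h: "\<forall>u a b. exp (u * ev P E a) * Ad P X $ a $ b
        = exp (of_int n * u) * (Ad P X $ a $ b * exp (u * ev P E b))" and nz: "Ad P X $ a $ b \<noteq> 0"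
    show "ev P E a - ev P E b = of_int n"
    proof (rule ccontr)
      define \<delta> where "\<delta> = ev P E a - ev P E b - of_int n"
      assume "ev P E a - ev P E b \<noteq> of_int n"
      then have \<delta>: "\<delta> \<noteq> 0" by (simp add: \<delta>_def)
      \<comment> \<open>The time at which the two sides differ by the factor \<open>exp 1\<close>.\<close>
      define u where "u = 1 / \<delta>"
      have "exp (u * ev P E a) = exp (of_int n * u) * exp (u * ev P E b)" using spec[OF spec[OF spec[OF h, of u], of a], of b] nz by simp
      also have "\<dots> = exp (of_int n * u + u * ev P E b)" by (simp add: exp_add)
      finally have "exp (u * ev P E a - (of_int n * u + u * ev P E b)) = 1" by (simp add: exp_diff)
      moreover have "u * ev P E a - (of_int n * u + u * ev P E b) = u * \<delta>" by (simp add: \<delta>_def algebra_simps)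
      ultimately have "exp (1 :: complex) = 1" using \<delta> by (simp add: u_def)
      then have "exp (1 :: real) = 1" by (metis exp_of_real of_real_1 of_real_eq_1_iff)
      then show False by simp
    qed
  next
    fix u a b assume h: "\<forall>a b. Ad P X $ a $ b \<noteq> 0 \<longrightarrow> ev P E a - ev P E b = of_int n"
    show "exp (u * ev P E a) * Ad P X $ a $ b = exp (of_int n * u) * (Ad P X $ a $ b * exp (u * ev P E b))"
    proof (cases "Ad P X $ a $ b = 0")
      case False
      then have "ev P E a = of_int n + ev P E b" using h by (simp add: diff_eq_eq)
      then show ?thesis by (simp add: algebra_simps flip: exp_add)
    qed simp
  qed
  also have "\<dots> \<longleftrightarrow> Ad P (lie_bracket E X) = Ad P (cscale (of_int n) X)"
    by (auto simp: vec_eq_iff Ad_bracket_diag[OF P] Ad_simps)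
  also have "\<dots> \<longleftrightarrow> lie_bracket E X = cscale (of_int n) X" by (rule Ad_eq_iff[OF P(1)])
  finally show ?thesis .
qed

lemma cochar_deriv_conjugate:
  assumes c: "cocharacter H0 \<xi>0" and \<xi>: "\<And>z. z \<noteq> 0 \<Longrightarrow> \<xi> z = Ad g (\<xi>0 z)"
  shows "cochar_deriv \<xi> = Ad g (cochar_deriv \<xi>0)"
proof -
  have "((\<lambda>z. \<xi> z $ i $ j) has_field_derivative Ad g (cochar_deriv \<xi>0) $ i $ j) (at 1)" for i j
  proof (rule has_field_derivative_transform_within_open[of _ _ _ "- {0}"])
    have Ad: "Ad g A $ i $ j = (\<Sum>k\<in>UNIV. (\<Sum>l\<in>UNIV. g $ i $ l * A $ l $ k) * matrix_inv g $ k $ j)" for A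
      by (simp add: Ad_def matrix_matrix_mult_def)
    show "((\<lambda>z. Ad g (\<xi>0 z) $ i $ j) has_field_derivative Ad g (cochar_deriv \<xi>0) $ i $ j) (at 1)"
      unfolding Ad by (intro DERIV_sum DERIV_cmult_right DERIV_cmult cocharacter_derivative[OF c])
  qed (auto simp: \<xi>)
  then show ?thesis by (simp add: vec_eq_iff cochar_deriv_def DERIV_imp_deriv)
qed

lemma lie_algebra_conjugate:
  assumes "zgroup H0" "zgroup H" "invertible g" "H = Ad g ` H0"
  shows "lie_algebra H = Ad g ` lie_algebra H0"
proof
  have conj: "Ad k X \<in> lie_algebra K'" if "zgroup K" "invertible k" "Ad k ` K \<subseteq> K'" "X \<in> lie_algebra K" for k K K' X
  proof (rule lie_algebra_flow[OF flow_mexp])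
    show "mexp (Ad k X) t \<in> K'" for t
      using mexp_conjugate[OF that(2), of X t] lie_algebra_mexp[OF that(1,4)] that(3) by auto
  qed
  show "Ad g ` lie_algebra H0 \<subseteq> lie_algebra H" using conj[OF assms(1,3)] assms(4) by blast
  have "Ad (matrix_inv g) ` H \<subseteq> H0" using assms(3,4) by (auto simp: Ad_inverse)
  then have "Ad (matrix_inv g) X \<in> lie_algebra H0" if "X \<in> lie_algebra H" for X
    using conj[OF assms(2) invertible_matrix_inv[OF assms(3)]] that by blast
  then show "lie_algebra H \<subseteq> Ad g ` lie_algebra H0"
    using assms(3) by (metis Ad_inverse(1) imageI subsetI)
qed

section \<open>The filtration of a torus and a cocharacter\<close>

lemma weight_vector_root:
  assumes "Y \<in> root_space G H \<alpha>" "Y \<noteq> 0" "\<And>h. h \<notin> lie_algebra H \<Longrightarrow> \<alpha> h = 0" "\<alpha> \<noteq> 0"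
  shows "\<alpha> \<in> roots G H"
  using assms by (auto simp: roots_def)

lemma positive_system_weight_integral:
  assumes "positive_system \<Delta> \<Delta>p" "\<forall>\<alpha>\<in>\<Delta>p. pi_weight \<xi> \<alpha> \<in> \<nat>" "\<alpha> \<in> \<Delta>"
  shows "pi_weight \<xi> \<alpha> \<in> \<int>"
proof (cases "\<alpha> \<in> \<Delta>p")
  case True
  then show ?thesis using assms(2) Nats_subset_Ints by blast
next
  case False
  then have "- \<alpha> \<in> \<Delta>p" using assms(1,3) by (auto simp: positive_system_def)
  then have "pi_weight \<xi> (- \<alpha>) \<in> \<int>" using assms(2) Nats_subset_Ints by blast
  moreover have "pi_weight \<xi> (- \<alpha>) = - pi_weight \<xi> \<alpha>" by (simp add: pi_weight_def)
  ultimately show ?thesis by (simp add: minus_in_Ints_iff)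
qed

text \<open>
  It suffices to consider weight vectors of the torus, whose weight under \<open>e\<close> is zero or
  \<open>pi_weight \<xi> \<alpha>\<close> for a root \<open>\<alpha>\<close>.
\<close>

lemma weight_integral:
  fixes P :: "('n::finite) cmat"
  assumes G: "zgroup G" and H: "zgroup H" "H \<subseteq> G" and P: "invertible P" "\<And>A. A \<in> H \<Longrightarrow> diag_by P A"
    and E: "cochar_deriv \<xi> \<in> lie_algebra H"
    and int: "\<And>\<alpha>. \<alpha> \<in> roots G H \<Longrightarrow> pi_weight \<xi> \<alpha> \<in> \<int>"
    and Y: "Y \<in> lie_algebra G" "Ad P Y $ a $ b \<noteq> 0" and e: "e = cscale (1 / 2) (cochar_deriv \<xi>)"
  shows "ev P e a - ev P e b \<in> \<int>"
proof -
  have D: "diag_by P h" if "h \<in> lie_algebra H" for h using lie_algebra_diag[OF H(1) P that] .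
  have sub: "cmat.subspace (lie_algebra G)" by (rule lie_algebra_subspace[OF G])
  have eh: "e \<in> lie_algebra H" unfolding e by (rule lie_algebra_cscale[OF H(1) E])
  let ?A = "{Y\<in>lie_algebra G. \<forall>a b. Ad P Y $ a $ b \<noteq> 0 \<longrightarrow> ev P e a - ev P e b \<in> \<int>}"
  have "lie_algebra G \<subseteq> ?A"
  proof (rule weight_vectors_span[OF P(1) D sub])
    show "lie_bracket h Y \<in> lie_algebra G" if "h \<in> lie_algebra H" "Y \<in> lie_algebra G" for h Y
      using that lie_algebra_mono[OF H(2)] by (intro lie_algebra_bracket[OF G]) auto
    show "cmat.subspace ?A" by (rule subspace_support[OF sub])
    fix Y \<alpha> assume Y: "Y \<in> lie_algebra G" "\<And>h. h \<notin> lie_algebra H \<Longrightarrow> \<alpha> h = 0"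
      "\<And>h. h \<in> lie_algebra H \<Longrightarrow> lie_bracket h Y = cscale (\<alpha> h) Y"
    have "ev P e a - ev P e b \<in> \<int>" if ab: "Ad P Y $ a $ b \<noteq> 0" for a b
    proof -
      have w: "ev P e a - ev P e b = pi_weight \<xi> \<alpha>"
      proof -
        have "ev P (cochar_deriv \<xi>) a - ev P (cochar_deriv \<xi>) b = \<alpha> (cochar_deriv \<xi>)"
          using Ad_bracket_diag[OF P(1) D[OF E], of Y a b] Y(3)[OF E] ab by (auto simp: Ad_simps)
        then show ?thesis by (simp add: e ev_def Ad_simps pi_weight_def flip: diff_divide_distrib)
      qed
      have "Y \<noteq> 0" using ab by (metis Ad_simps(5) zero_index)
      moreover have "Y \<in> root_space G H \<alpha>" using Y by (simp add: root_space_def)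
      ultimately have "\<alpha> = 0 \<or> \<alpha> \<in> roots G H" using weight_vector_root Y(2) by blast
      then show ?thesis
        unfolding w using int[of \<alpha>] by (auto simp: pi_weight_def)
    qed
    then show "Y \<in> ?A" using Y(1) by simp
  qed
  then show ?thesis using Y by blast
qed

text \<open>
  Both filtrations are spanned by weight vectors of the torus. Those of weight zero lie in its
  Lie algebra, because this is its own centralizer; the others are root vectors.
\<close>

lemma filtration_eq_fil:
  fixes P :: "('n::finite) cmat"
  assumes G: "zgroup G" and H: "zgroup H" "H \<subseteq> G" and PH: "invertible P" "\<And>A. A \<in> H \<Longrightarrow> diag_by P A"
    and E: "cochar_deriv \<xi> \<in> lie_algebra H"
    and cent: "\<And>X. X \<in> lie_algebra G \<Longrightarrow> (\<And>h. h \<in> lie_algebra H \<Longrightarrow> lie_bracket h X = 0) \<Longrightarrow> X \<in> lie_algebra H"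
    and g: "graded_lie_algebra G P e" and eE: "e = cscale (1 / 2) (cochar_deriv \<xi>)"
  shows "filtration G H \<xi> i = fil G P e i"
proof -
  interpret graded_lie_algebra G P e by (rule g)
  have D: "diag_by P h" if "h \<in> lie_algebra H" for h using lie_algebra_diag[OF H(1) PH that] .
  have hg: "lie_algebra H \<subseteq> \<gg>" by (rule lie_algebra_mono[OF H(2)])
  have w: "ev P e a - ev P e b = pi_weight \<xi> \<alpha>"
    if Y: "lie_bracket (cochar_deriv \<xi>) Y = cscale (\<alpha> (cochar_deriv \<xi>)) Y" "Ad P Y $ a $ b \<noteq> 0" for Y \<alpha> a b
  proof -
    have "ev P (cochar_deriv \<xi>) a - ev P (cochar_deriv \<xi>) b = \<alpha> (cochar_deriv \<xi>)"
      using Ad_bracket_diag[OF PH(1) D[OF E], of Y a b] Y by (auto simp: Ad_simps)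
    then show ?thesis by (simp add: eE ev_def Ad_simps pi_weight_def flip: diff_divide_distrib)
  qed
  define R where "R = (if i > 0 then {} else lie_algebra H) \<union>
      (\<Union>\<alpha>\<in>{\<alpha>\<in>roots G H. Re (pi_weight \<xi> \<alpha>) \<ge> of_int i}. root_space G H \<alpha>)"
  have "cmat.span R \<subseteq> F i"
  proof (rule cmat.span_minimal[OF _ F_subspace(1)])
    have "Y \<in> F i" if Y: "Y \<in> lie_algebra H" "i \<le> 0" for Y
    proof -
      have "a = b" if "Ad P Y $ a $ b \<noteq> 0" for a b using that D[OF Y(1)] by (auto simp: diag_by_def)
      then show ?thesis using Y hg by (fastforce simp: fil_def)
    qed
    moreover have "Y \<in> F i" if "Re (pi_weight \<xi> \<alpha>) \<ge> of_int i" "Y \<in> root_space G H \<alpha>" for Y \<alpha>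
    proof -
      have "Y \<in> \<gg>" "lie_bracket (cochar_deriv \<xi>) Y = cscale (\<alpha> (cochar_deriv \<xi>)) Y"
        using that(2) E by (auto simp: root_space_def)
      then show ?thesis using that(1) w by (auto simp: fil_def simp del: minus_complex.sel)
    qed
    ultimately show "R \<subseteq> F i" by (auto simp: R_def split: if_splits)
  qed
  moreover have "F i \<subseteq> cmat.span R"
  proof (rule weight_vectors_span[OF PH(1) D F_subspace(1)])
    show "lie_bracket h Y \<in> F i" if "h \<in> lie_algebra H" "Y \<in> F i" for h Y
    proof -
      have "h \<in> F 0" using that(1) hg D diagonal_in_F0 by blast
      then show ?thesis using F_bracket[OF _ that(2)] by fastforce
    qed
    show "cmat.subspace (cmat.span R)" by (rule cmat.subspace_span)
    fix Y \<alpha> assume Y: "Y \<in> F i" "\<And>h. h \<notin> lie_algebra H \<Longrightarrow> \<alpha> h = 0"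
      "\<And>h. h \<in> lie_algebra H \<Longrightarrow> lie_bracket h Y = cscale (\<alpha> h) Y"
    show "Y \<in> cmat.span R"
    proof (cases "Y = 0")
      case True
      then show ?thesis by (simp add: cmat.span_zero)
    next
      case False
      then obtain a b where ab: "Ad P Y $ a $ b \<noteq> 0" by (rule Ad_nonzero_entry[OF PH(1)])
      have wab: "ev P e a - ev P e b = pi_weight \<xi> \<alpha>" by (rule w[of Y \<alpha> a b, OF Y(3)[OF E] ab])
      have i: "of_int i \<le> Re (pi_weight \<xi> \<alpha>)" using Y(1) ab unfolding fil_def wab[symmetric] by blast
      have Yg: "Y \<in> \<gg>" using Y(1) F_subset by blast
      show ?thesis
      proof (cases "\<alpha> = 0")
        case True
        then have "Y \<in> lie_algebra H" using cent[OF Yg] Y(3) by simp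
        moreover have "i \<le> 0" using i True by (simp add: pi_weight_def)
        ultimately have "Y \<in> R" by (simp add: R_def)
        then show ?thesis by (rule cmat.span_base)
      next
        case \<alpha>: False
        have "Y \<in> root_space G H \<alpha>" using Yg Y(3) by (simp add: root_space_def)
        moreover from this have "\<alpha> \<in> roots G H" using weight_vector_root False Y(2) \<alpha> by blast
        ultimately have "Y \<in> R" using i unfolding R_def by blast
        then show ?thesis by (rule cmat.span_base)
      qed
    qed
  qed
  ultimately show ?thesis by (auto simp: filtration_def R_def)
qed

text \<open>
  The real elements of the Lie algebra of a compact torus have imaginary eigenvalues, so
  conjugation negates the weights.
\<close>

lemma compact_torus_mconj_weight:
  fixes H :: "('n::finite) cmat set"
  assumes H: "zgroup H" "\<And>A. A \<in> H \<Longrightarrow> mconj A \<in> H" and P: "invertible P" "\<And>A. A \<in> H \<Longrightarrow> diag_by P A"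
    and c: "compact (real_points H)" and X: "\<And>h. h \<in> lie_algebra H \<Longrightarrow> lie_bracket h X = cscale (\<alpha> h) X"
    and h: "h \<in> lie_algebra H"
  shows "lie_bracket h (mconj X) = cscale (- \<alpha> h) (mconj X)"
proof (cases "X = 0")
  case False
  then obtain a b where ab: "Ad P X $ a $ b \<noteq> 0" by (rule Ad_nonzero_entry[OF P(1)])
  have w: "\<alpha> h = ev P h a - ev P h b" if "h \<in> lie_algebra H" for h
    using Ad_bracket_diag[OF P(1) lie_algebra_diag[OF H(1) P that], of X a b] X[OF that] ab
    by (auto simp: Ad_simps)
  have h': "mconj h \<in> lie_algebra H" by (rule lie_algebra_mconj[OF H h])
  have "ev P (mconj h) i = - cnj (ev P h i)" for i by (rule compact_torus_ev_mconj[OF H P c h])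
  then have "cnj (\<alpha> (mconj h)) = - \<alpha> h" unfolding w[OF h'] w[OF h] by simp
  moreover have "lie_bracket h (mconj X) = mconj (lie_bracket (mconj h) X)"
    by (simp add: lie_bracket_mconj)
  ultimately show ?thesis using X[OF h'] by simp
qed (simp add: lie_bracket_simps)

lemma orbit_eq:
  assumes G: "zgroup G" and F: "F' \<in> orbit G F" shows "orbit G F' = orbit G F"
proof -
  obtain k where k: "k \<in> G" "F' = (\<lambda>i. Ad k ` F i)" using F unfolding orbit_def by blast
  have ik: "invertible k" "matrix_inv k \<in> G" using zgroupD[OF G] k(1) by blast+
  have "\<exists>l\<in>G. (\<lambda>i. Ad h ` F' i) = (\<lambda>i. Ad l ` F i)" if "h \<in> G" for h
    using that k zgroupD(3,5)[OF G] by (intro bexI[of _ "h ** k"]) (auto simp: image_image Ad_Ad)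
  moreover have "\<exists>l\<in>G. (\<lambda>i. Ad h ` F i) = (\<lambda>i. Ad l ` F' i)" if "h \<in> G" for h
  proof -
    have "h ** matrix_inv k ** k = h" using ik(1) by (simp add: invertible_mult_inv flip: matrix_mul_assoc)
    moreover have l: "h ** matrix_inv k \<in> G" using zgroupD(3)[OF G that ik(2)] .
    ultimately show ?thesis
      using k(2) zgroupD(5)[OF G l] ik(1) by (intro bexI[OF _ l]) (simp add: image_image Ad_Ad)
  qed
  ultimately show ?thesis unfolding orbit_def by blast
qed

text \<open>The curve is connected and passes through \<open>k\<close>.\<close>

lemma identity_component_translate:
  assumes k: "k \<in> identity_component R" and R: "\<And>t. mexp X t ** k \<in> R"
  shows "mexp X t ** k \<in> identity_component R"
proof -
  have "connected ((\<lambda>t. mexp X t ** k) ` UNIV)"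
    by (intro connected_continuous_image connected_UNIV matmul.continuous_on continuous_mexp continuous_intros)
  moreover have "k \<in> (\<lambda>t. mexp X t ** k) ` UNIV" by (rule image_eqI[of _ _ 0]) auto
  ultimately have "(\<lambda>t. mexp X t ** k) ` UNIV \<subseteq> connected_component_set R k"
    using R by (intro connected_component_maximal) auto
  moreover have "connected_component_set R k = connected_component_set R (mat 1)"
    using k unfolding identity_component_def by (rule connected_component_eq)
  ultimately show ?thesis by (auto simp: identity_component_def)
qed

lemma real_pointsD: "k \<in> identity_component (real_points G) \<Longrightarrow> k \<in> G \<and> mconj k = k"
  using connected_component_subset[of "real_points G" "mat 1"]
  by (auto simp: identity_component_def real_points_def)

text \<open>
  A point of the real orbit is the translate of \<open>F\<close> by a real \<open>k\<close>, and is again the filtration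
  of a grading element, \<open>Ad k e\<close>. So the dimensions found at \<open>F\<close> are those at every point.
\<close>

lemma (in graded_lie_algebra) orbit_real_codim:
  assumes codim: "dim \<gg> = dim Q + 2 * c"
  shows "has_real_codim (orbit (identity_component (real_points G)) F) (orbit G F) c"
  unfolding has_real_codim_def
proof (intro conjI ballI)
  define \<Gamma> where "\<Gamma> = identity_component (real_points G)"
  have \<Gamma>: "k \<in> G" "mconj k = k" if "k \<in> \<Gamma>" for k using real_pointsD that by (auto simp: \<Gamma>_def)
  have Adm: "Ad k ` Ad l ` F i = Ad (k ** l) ` F i" if "k \<in> G" "l \<in> G" for k l i
    using that zgroupD(5)[OF zgroup_G] by (simp add: image_image Ad_Ad)
  show "orbit (identity_component (real_points G)) F \<subseteq> orbit G F"
    using \<Gamma> unfolding orbit_def \<Gamma>_def by blast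
  fix F' assume "F' \<in> orbit (identity_component (real_points G)) F"
  then obtain k where k: "k \<in> \<Gamma>" "F' = (\<lambda>i. Ad k ` F i)" unfolding orbit_def \<Gamma>_def by blast
  have kG: "k \<in> G" "mconj k = k" using \<Gamma> k by auto
  have ik: "invertible k" "matrix_inv k \<in> G" using zgroupD[OF zgroup_G] kG by blast+
  note conj = conjugate_by_real[OF kG]
  interpret tr: graded_lie_algebra G "P ** matrix_inv k" "Ad k e" by (rule conj(1))
  have F': "F' = tr.F" unfolding k(2) using conj(2) by blast
  have translate: "(\<lambda>i. Ad h ` F i) = (\<lambda>i. Ad (h ** matrix_inv k) ` tr.F i)" if h: "h \<in> G" for h
  proof -
    have "h ** matrix_inv k ** k = h" using ik(1) by (simp add: invertible_mult_inv flip: matrix_mul_assoc)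
    then show ?thesis unfolding conj(2) using Adm[of "h ** matrix_inv k" k] zgroupD(3)[OF zgroup_G h ik(2)] kG by simp
  qed
  have fwd: "(\<lambda>i. Ad (mexp X t) ` tr.F i) = (\<lambda>i. Ad (mexp X t ** k) ` F i)" if "X \<in> \<gg>" for X t
    unfolding conj(2) using Adm[OF lie_algebra_mexp[OF zgroup_G that] kG(1)] by simp
  have M: "tr.F \<in> orbit G F" using kG k(2) unfolding F'[symmetric] orbit_def by blast
  have S: "tr.F \<in> orbit \<Gamma> F" using k unfolding F'[symmetric] orbit_def by blast
  have M': "\<exists>k\<in>G. \<Phi> = (\<lambda>i. Ad k ` tr.F i)" if "\<Phi> \<in> orbit G F" for \<Phi>
    using that translate zgroupD(3)[OF zgroup_G _ ik(2)] unfolding orbit_def by blast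
  have S': "\<exists>k\<in>G. mconj k = k \<and> \<Phi> = (\<lambda>i. Ad k ` tr.F i)" if "\<Phi> \<in> orbit \<Gamma> F" for \<Phi>
  proof -
    have "\<exists>h\<in>\<Gamma>. \<Phi> = (\<lambda>i. Ad h ` F i)" using that unfolding orbit_def by blast
    then obtain h where h: "h \<in> \<Gamma>" "\<Phi> = (\<lambda>i. Ad h ` F i)" by blast
    have "mconj (matrix_inv k) = matrix_inv k"
    proof (rule matrix_inv_unique[symmetric])
      have "k ** mconj (matrix_inv k) = mconj (k ** matrix_inv k)" by (simp add: kG(2))
      then show "k ** mconj (matrix_inv k) = mat 1" by (simp add: invertible_mult_inv[OF ik(1)])
    qed
    then have "mconj (h ** matrix_inv k) = h ** matrix_inv k" using \<Gamma>(2)[OF h(1)] by simp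
    then show ?thesis
      using h(2) translate[OF \<Gamma>(1)[OF h(1)]] zgroupD(3)[OF zgroup_G \<Gamma>(1)[OF h(1)] ik(2)] by blast
  qed
  have M'': "(\<lambda>i. Ad (mexp X t) ` tr.F i) \<in> orbit G F" if "X \<in> \<gg>" for X t
    unfolding fwd[OF that] orbit_def
    using zgroupD(3)[OF zgroup_G lie_algebra_mexp[OF zgroup_G that] kG(1)] by blast
  have S'': "(\<lambda>i. Ad (mexp X t) ` tr.F i) \<in> orbit \<Gamma> F" if "X \<in> \<gg>" "mconj X = X" for X t
  proof -
    have "mexp X t ** k \<in> real_points G" for t
      using zgroupD(3)[OF zgroup_G lie_algebra_mexp[OF zgroup_G that(1)] kG(1)] mexp_mconj[of X t] that(2) kG(2)
      by (simp add: real_points_def)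
    then have "mexp X t ** k \<in> \<Gamma>" using identity_component_translate k(1) unfolding \<Gamma>_def by blast
    then show ?thesis unfolding fwd[OF that(1)] orbit_def by blast
  qed
  note dims = tr.orbit_tangent_dimensions[OF M M' M'' S S' S'']
  show "velocity.subspace (tangent_space (orbit (identity_component (real_points G)) F) F')"
    using dims(2) unfolding F' \<Gamma>_def .
  show "velocity.subspace (tangent_space (orbit G F) F')" using dims(1) unfolding F' .
  show "velocity.dim (tangent_space (orbit G F) F') =
      velocity.dim (tangent_space (orbit (identity_component (real_points G)) F) F') + c"
    using dims(3) unfolding conj(3) codim F' \<Gamma>_def by linarith
qed

theorem proposition4p1:
  fixes G H0 H :: "(complex^'n::finite^'n) set"
    and \<xi>0 \<xi> :: "complex \<Rightarrow> complex^'n^'n"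
    and \<Delta>p :: "(complex^'n^'n \<Rightarrow> complex) set"
  assumes "connected_adjoint_group_over_Q G"
    and "maximal_torus G H0" and "zariski_closed \<real> H0" and "compact (real_points H0)"
    and "cocharacter H0 \<xi>0"
    and "\<forall>\<alpha>. compact_root G H0 \<alpha> \<longrightarrow> (\<exists>k::int. even k \<and> pi_weight \<xi>0 \<alpha> = of_int k)"
    and "\<forall>\<alpha>. noncompact_root G H0 \<alpha> \<longrightarrow> (\<exists>k::int. odd k \<and> pi_weight \<xi>0 \<alpha> = of_int k)"
    and "positive_system (roots G H0) \<Delta>p"
    and "\<forall>\<alpha>\<in>\<Delta>p. pi_weight \<xi>0 \<alpha> \<in> \<nat>"
    and "\<forall>\<alpha>\<in>simple_roots \<Delta>p. pi_weight \<xi>0 \<alpha> \<in> {0, 1}"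
    and "maximal_torus G H" and "zariski_closed \<real> H" and "cocharacter H \<xi>"
    and "conjugate_pairs G H \<xi> H0 \<xi>0"
    and "filtration G H \<xi> \<in> orbit G (filtration G H0 \<xi>0)"
  shows "has_real_codim
           (orbit (identity_component (real_points G)) (filtration G H \<xi>))
           (orbit G (filtration G H0 \<xi>0))
           (\<Sum>\<^sub>\<infinity>(p, q)\<in>{0<..} \<times> {0<..}. cmat.dim (bigraded_piece G \<xi> p q))"
proof -
  have G: "zgroup G" "semisimple_group G" and realG: "\<And>A. A \<in> G \<Longrightarrow> mconj A \<in> G"
  proof -
    have "algebraic_group \<rat> G" using assms(1) by (simp add: connected_adjoint_group_over_Q_def)
    then show "zgroup G" by (rule algebraic_group_imp_zgroup)
    show "semisimple_group G" using assms(1) by (simp add: connected_adjoint_group_over_Q_def)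
    show "mconj A \<in> G" if "A \<in> G" for A
      using \<open>algebraic_group \<rat> G\<close> zariski_closed_mconj[of \<rat> G A] that Rats_subset_Reals_complex
      by (auto simp: algebraic_group_def)
  qed
  have Gsub: "H0 \<subseteq> G" "H \<subseteq> G" "alg_torus H0" "alg_torus H" using assms(2,11) by (auto simp: maximal_torus_def)
  obtain P0 where P0: "zgroup H0" "invertible P0" "\<And>A. A \<in> H0 \<Longrightarrow> diag_by P0 A"
    using alg_torusE[OF Gsub(3)] by blast
  obtain P where PH: "zgroup H" "invertible P" "\<And>A. A \<in> H \<Longrightarrow> diag_by P A"
    using alg_torusE[OF Gsub(4)] by blast
  have real0: "mconj A \<in> H0" if "A \<in> H0" for A using zariski_closed_mconj[OF assms(3) order_refl that] .
  have realH: "mconj A \<in> H" if "A \<in> H" for A using zariski_closed_mconj[OF assms(12) order_refl that] .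
  obtain g where g: "g \<in> G" "H = Ad g ` H0" "\<And>z. z \<noteq> 0 \<Longrightarrow> \<xi> z = Ad g (\<xi>0 z)"
    using assms(14) unfolding conjugate_pairs_def by blast
  have ig: "invertible g" "matrix_inv g \<in> G" using zgroupD[OF G(1)] g(1) by blast+
  have hH: "lie_algebra H = Ad g ` lie_algebra H0" by (rule lie_algebra_conjugate[OF P0(1) PH(1) ig(1) g(2)])
  have Adg: "Ad g X \<in> lie_algebra G" "Ad (matrix_inv g) X \<in> lie_algebra G" if "X \<in> lie_algebra G" for X
    using that lie_algebra_Ad[OF G(1)] g(1) ig(2) by auto
  define E where "E = cochar_deriv \<xi>"
  have E: "E \<in> lie_algebra H" unfolding E_def by (rule cochar_deriv_in_lie_algebra[OF PH(1) assms(13)])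
  have E0: "E = Ad g (cochar_deriv \<xi>0)" unfolding E_def by (rule cochar_deriv_conjugate[OF assms(5) g(3)])
  have D: "diag_by P h" if "h \<in> lie_algebra H" for h by (rule lie_algebra_diag[OF PH that])
  have hg: "lie_algebra H \<subseteq> lie_algebra G" by (rule lie_algebra_mono[OF Gsub(2)])
  have unconj: "lie_bracket h (Ad (matrix_inv g) X) = Ad (matrix_inv g) (lie_bracket (Ad g h) X)" for h X
    using ig by (simp add: Ad_bracket invertible_matrix_inv Ad_inverse)
  \<comment> \<open>The torus \<open>H\<close> inherits from the compact torus that it is its own centralizer, and that the weights are integral.\<close>
  have cent: "X \<in> lie_algebra H" if X: "X \<in> lie_algebra G" "\<And>h. h \<in> lie_algebra H \<Longrightarrow> lie_bracket h X = 0" for X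
  proof -
    have "Ad (matrix_inv g) X \<in> lie_algebra H0"
    proof (rule compact_maximal_torus_centralizer[OF G assms(2) real0 assms(4)])
      show "Ad (matrix_inv g) X \<in> lie_algebra G" using Adg X by simp
      show "lie_bracket h (Ad (matrix_inv g) X) = 0" if "h \<in> lie_algebra H0" for h
        unfolding unconj using X(2)[of "Ad g h"] that hH by (simp add: Ad_simps)
    qed
    then have "Ad g (Ad (matrix_inv g) X) \<in> lie_algebra H" unfolding hH by blast
    then show ?thesis by (simp add: Ad_inverse ig)
  qed
  have int: "pi_weight \<xi> \<alpha> \<in> \<int>" if \<alpha>: "\<alpha> \<in> roots G H" for \<alpha>
  proof -
    define \<alpha>0 where "\<alpha>0 h = (if h \<in> lie_algebra H0 then \<alpha> (Ad g h) else 0)" for h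
    have "0 \<in> root_space G H \<alpha>"
      using lie_algebra_zero[OF G(1)] by (simp add: root_space_def lie_bracket_simps)
    then obtain X where X: "X \<in> root_space G H \<alpha>" "X \<noteq> 0" using \<alpha> unfolding roots_def by blast
    obtain h where h: "\<alpha> h \<noteq> 0" using \<alpha> by (auto simp: roots_def fun_eq_iff)
    then have "h \<in> lie_algebra H" using \<alpha> by (auto simp: roots_def)
    then obtain h0 where "h0 \<in> lie_algebra H0" "h = Ad g h0" unfolding hH by blast
    then have "\<alpha>0 h0 \<noteq> 0" using h by (simp add: \<alpha>0_def)
    then have "\<alpha>0 \<noteq> 0" by auto
    moreover have "Ad (matrix_inv g) X \<in> root_space G H0 \<alpha>0"
      using X(1) Adg hH by (auto simp: root_space_def \<alpha>0_def unconj Ad_simps)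
    moreover have "Ad (matrix_inv g) X \<noteq> 0"
      using X(2) Ad_eq_iff[OF invertible_matrix_inv[OF ig(1)], of X 0] by (simp add: Ad_simps)
    ultimately have "\<alpha>0 \<in> roots G H0" by (intro weight_vector_root) (auto simp: \<alpha>0_def)
    then have "pi_weight \<xi>0 \<alpha>0 \<in> \<int>" using positive_system_weight_integral[OF assms(8,9)] by blast
    moreover have "pi_weight \<xi>0 \<alpha>0 = pi_weight \<xi> \<alpha>"
      using cochar_deriv_in_lie_algebra[OF P0(1) assms(5)] E0
      by (simp add: pi_weight_def \<alpha>0_def E_def[symmetric])
    ultimately show ?thesis by simp
  qed
  \<comment> \<open>Half the derivative, because the filtration and the bigrading count half the weights of \<open>\<xi>\<close>.\<close>
  define e where "e = cscale (1 / 2) E"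
  have eh: "e \<in> lie_algebra H" unfolding e_def by (rule lie_algebra_cscale[OF PH(1) E])
  have eh': "mconj e \<in> lie_algebra H" by (rule lie_algebra_mconj[OF PH(1) realH eh])
  have graded: "graded_lie_algebra G P e"
  proof unfold_locales
    show "e \<in> lie_algebra G" using eh hg by auto
    show "ev P e a - ev P e b \<in> \<int>" if "Y \<in> lie_algebra G" "Ad P Y $ a $ b \<noteq> 0" for Y a b
      by (rule weight_integral[OF G(1) PH(1) Gsub(2) PH(2,3) E[unfolded E_def] int that]) (simp_all add: e_def E_def)
  qed (use G realG PH D eh eh' in auto)
  interpret graded_lie_algebra G P e by (rule graded)
  have filt: "filtration G H \<xi> = F"
    by (rule ext, rule filtration_eq_fil[OF G(1) PH(1) Gsub(2) PH(2,3) E[unfolded E_def] cent graded])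
       (simp_all add: e_def E_def)
  have bp: "bigraded_piece G \<xi> p q = piece {(of_int p, of_int q)}" for p q
  proof -
    have half: "lie_bracket (cscale (1 / 2) Z) X = cscale c X \<longleftrightarrow> lie_bracket Z X = cscale (2 * c) X" for Z X c
      by (simp add: lie_bracket_simps vec_eq_iff field_simps)
    have "lie_bracket e X = cscale (of_int p) X \<longleftrightarrow> lie_bracket E X = cscale (of_int (2 * p)) X" for X
      by (simp add: e_def half)
    moreover have "lie_bracket (mconj e) X = cscale (of_int q) X \<longleftrightarrow>
        lie_bracket (mconj E) X = cscale (of_int (2 * q)) X" for X
      by (simp add: e_def half)
    moreover have "(\<forall>z. z \<noteq> 0 \<longrightarrow> Ad (\<xi> z) X = cscale (z powi (2 * p)) X) \<longleftrightarrow>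
        lie_bracket E X = cscale (of_int (2 * p)) X" for X
      by (rule weight_space_of_exponential[OF PH(2) D[OF E]])
         (simp add: E_def cocharacter_exp[OF PH(1) assms(13)])
    moreover have "(\<forall>z. z \<noteq> 0 \<longrightarrow> Ad (conj_cocharacter \<xi> z) X = cscale (z powi (2 * q)) X) \<longleftrightarrow>
        lie_bracket (mconj E) X = cscale (of_int (2 * q)) X" for X
    proof (rule weight_space_of_exponential[OF PH(2)])
      show "diag_by P (mconj E)" by (intro D lie_algebra_mconj[OF PH(1) realH E])
      fix u
      have "conj_cocharacter \<xi> (exp u) = mconj (\<xi> (exp (cnj u)))" by (simp add: conj_cocharacter_def exp_cnj)
      also have "\<dots> = mexp (cscale u (mconj E)) 1"
        by (simp add: cocharacter_exp[OF PH(1) assms(13)] E_def flip: mexp_mconj)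
      finally show "conj_cocharacter \<xi> (exp u) = mexp (cscale u (mconj E)) 1" .
    qed
    ultimately have "X \<in> bigraded_piece G \<xi> p q \<longleftrightarrow> X \<in> piece {(of_int p, of_int q)}" for X
      unfolding mem_piece_iff bigraded_piece_def mem_Collect_eq by blast
    then show ?thesis by blast
  qed
  \<comment> \<open>Conjugation, carried over from the compact torus, reverses all weights.\<close>
  define \<sigma> where "\<sigma> X = Ad g (mconj (Ad (matrix_inv g) X))" for X
  have \<sigma>g: "\<sigma> X \<in> lie_algebra G" if "X \<in> lie_algebra G" for X
    using that Adg lie_algebra_mconj[OF G(1) realG] unfolding \<sigma>_def by blast
  have \<sigma>lin: "linear \<sigma>"
    by (rule linearI) (simp_all add: \<sigma>_def Ad_simps)
  have \<sigma>c: "\<sigma> (cscale c X) = cscale (cnj c) (\<sigma> X)" for c X by (simp add: \<sigma>_def Ad_simps)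
  have inv\<sigma>: "\<sigma> (\<sigma> X) = X" for X by (simp add: \<sigma>_def Ad_inverse ig)
  have \<sigma>w: "lie_bracket h (\<sigma> X) = cscale (- \<alpha> h) (\<sigma> X)"
    if X: "\<And>h. h \<in> lie_algebra H \<Longrightarrow> lie_bracket h X = cscale (\<alpha> h) X" and h: "h \<in> lie_algebra H" for X \<alpha> h
  proof -
    obtain h0 where h0: "h0 \<in> lie_algebra H0" "h = Ad g h0" using h unfolding hH by blast
    have "lie_bracket h0 (mconj (Ad (matrix_inv g) X)) = cscale (- \<alpha> (Ad g h0)) (mconj (Ad (matrix_inv g) X))"
    proof (rule compact_torus_mconj_weight[OF P0(1) real0 P0(2,3) assms(4) _ h0(1), of _ "\<lambda>h. \<alpha> (Ad g h)"])
      show "lie_bracket k (Ad (matrix_inv g) X) = cscale (\<alpha> (Ad g k)) (Ad (matrix_inv g) X)"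
        if "k \<in> lie_algebra H0" for k
        unfolding unconj using X[of "Ad g k"] that hH by (simp add: Ad_simps)
    qed
    then show ?thesis unfolding \<sigma>_def h0(2) Ad_bracket[OF ig(1), symmetric] by (simp add: Ad_simps)
  qed
  have \<sigma>piece: "\<sigma> X \<in> piece {(- p, - q)}" if X: "X \<in> piece {(p, q)}" for X p q
  proof -
    let ?A = "{X\<in>piece {(p, q)}. \<sigma> X \<in> piece {(- p, - q)}}"
    have "piece {(p, q)} \<subseteq> ?A"
    proof (rule weight_vectors_span[OF PH(2) D piece_subspace])
      show "lie_bracket h Y \<in> piece {(p, q)}" if hY: "h \<in> lie_algebra H" "Y \<in> piece {(p, q)}" for h Y
      proof -
        have "Y \<in> lie_algebra G" "h \<in> lie_algebra G" using hY hg by (auto simp: piece_def)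
        then have "lie_bracket h Y \<in> lie_algebra G" using lie_algebra_bracket[OF G(1)] by simp
        then show ?thesis using hY(2) by (auto simp: piece_def Ad_bracket_diag[OF PH(2) D[OF hY(1)]])
      qed
      show "cmat.subspace ?A"
        using piece_subspace[of "{(p, q)}"] piece_subspace[of "{(- p, - q)}"]
        by (intro cmat.subspaceI)
           (auto simp: cmat.subspace_0 cmat.subspace_add cmat.subspace_scale linear_0[OF \<sigma>lin] linear_add[OF \<sigma>lin] \<sigma>c)
      fix Y \<alpha> assume Y: "Y \<in> piece {(p, q)}" "\<And>h. h \<in> lie_algebra H \<Longrightarrow> lie_bracket h Y = cscale (\<alpha> h) Y"
      show "Y \<in> ?A"
      proof (cases "Y = 0")
        case True
        then show ?thesis using Y(1) cmat.subspace_0[OF piece_subspace] by (simp add: linear_0[OF \<sigma>lin])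
      next
        case False
        have Yg: "Y \<in> lie_algebra G" "lie_bracket e Y = cscale p Y" "lie_bracket (mconj e) Y = cscale q Y"
          using Y(1) unfolding mem_piece_iff by auto
        have "\<alpha> e = p" "\<alpha> (mconj e) = q" using Yg Y(2)[OF eh] Y(2)[OF eh'] False by auto
        then have "lie_bracket e (\<sigma> Y) = cscale (- p) (\<sigma> Y)" "lie_bracket (mconj e) (\<sigma> Y) = cscale (- q) (\<sigma> Y)"
          using \<sigma>w[OF Y(2) eh] \<sigma>w[OF Y(2) eh'] by auto
        then have "\<sigma> Y \<in> piece {(- p, - q)}" unfolding mem_piece_iff using \<sigma>g[OF Yg(1)] by simp
        then show ?thesis using Y(1) by blast
      qed
    qed
    then show ?thesis using X by blast
  qed
  have sym: "dim (piece {z}) \<le> dim (piece {- z})" for z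
  proof -
    have "inj \<sigma>" by (metis inv\<sigma> injI)
    then have "dim (piece {z}) = dim (\<sigma> ` piece {z})"
      by (intro dim_image_eq[symmetric, OF \<sigma>lin]) (auto intro: inj_on_subset)
    also have "\<dots> \<le> dim (piece {- z})" by (intro dim_subset) (cases z; auto intro: \<sigma>piece)
    finally show ?thesis .
  qed
  have orb: "orbit G (filtration G H0 \<xi>0) = orbit G F"
    using orbit_eq[OF G(1) assms(15)] unfolding filt by simp
  show ?thesis unfolding orb filt by (rule orbit_real_codim[OF codim_Q[OF sym bp]])
qed

end
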